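(* Let $X$ be a Banach space with a semi-normalized supershrinking basis, and suppose $X$ contains no subspace isomorphic to $c_0$. Then every semi-normalized basic sequence in $X$ has a boundedly complete subsequence whose closed linear span is a reflexive or an order one quasireflexive subspace of $X$.
   Context: Let $\{e_n\}$ be a basic sequence in a Banach space $X$; $[e_n]$ denotes its closed linear span. It is semi-normalized if $0<\inf_n\|e_n\|\le\sup_n\|e_n\|<+\infty$. It is: - boundedly complete if, whenever scalars $\{\lambda_i\}$ satisfy $\sup_n\|\sum_{i=1}^n\lambda_ie_i\|<+\infty$, the series $\sum_n\lambda_ne_n$ converges in norm; - shrinking if for every $f\in X^*$ the sequence of norms $\|f|_{[e_n,e_{n+1},\dots]}\|$ converges to $0$; - supershrinking if it is shrinking and, whenever scalars $\{\lambda_i\}$ satisfy $\sup_n\|\sum_{i=1}^n\lambda_ie_i\|<+\infty$ and $\lambda_i\to 0$, the series $\sum_n\lambda_ne_n$ converges in norm. A Banach space $Y$ is order one quasireflexive if (the canonical image of) $Y$ has codimension $1$ in $Y^{**}$. *)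

theory Defs
  imports "HOL-Analysis.Analysis"
begin

definition closed_span :: "'a::real_normed_vector set \<Rightarrow> 'a set" where
  "closed_span A = closure (span A)"

definition schauder_basis_of :: "'a::real_normed_vector set \<Rightarrow> (nat \<Rightarrow> 'a) \<Rightarrow> bool" where
  "schauder_basis_of S e \<longleftrightarrow>
     range e \<subseteq> S \<and> (\<forall>x\<in>S. \<exists>!a :: nat \<Rightarrow> real. (\<lambda>n. a n *\<^sub>R e n) sums x)"

definition basic_sequence :: "(nat \<Rightarrow> 'a::real_normed_vector) \<Rightarrow> bool" where
  "basic_sequence e \<longleftrightarrow> schauder_basis_of (closed_span (range e)) e"

definition semi_normalized :: "(nat \<Rightarrow> 'a::real_normed_vector) \<Rightarrow> bool" where
  "semi_normalized e \<longleftrightarrow>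
     0 < (INF n. norm (e n)) \<and> bdd_above (range (\<lambda>n. norm (e n)))"

definition boundedly_complete :: "(nat \<Rightarrow> 'a::real_normed_vector) \<Rightarrow> bool" where
  "boundedly_complete e \<longleftrightarrow> basic_sequence e \<and>
     (\<forall>a :: nat \<Rightarrow> real. bounded (range (\<lambda>n. \<Sum>i<n. a i *\<^sub>R e i))
        \<longrightarrow> summable (\<lambda>n. a n *\<^sub>R e n))"

text \<open>The norm of the restriction of \<open>f\<close> to the subspace \<open>V\<close>, where \<open>V\<close> is
  normed by \<open>N\<close>. The norm is a parameter because the definition is also used
  for functionals on a dual space.\<close>

definition functional_norm :: "'v set \<Rightarrow> ('v \<Rightarrow> real) \<Rightarrow> ('v \<Rightarrow> real) \<Rightarrow> real" where
  "functional_norm V N f = (SUP x\<in>{x\<in>V. N x \<le> 1}. \<bar>f x\<bar>)"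

definition shrinking :: "(nat \<Rightarrow> 'a::real_normed_vector) \<Rightarrow> bool" where
  "shrinking e \<longleftrightarrow> basic_sequence e \<and>
     (\<forall>f :: 'a \<Rightarrow>\<^sub>L real.
        (\<lambda>n. functional_norm (closed_span (e ` {n..})) norm (blinfun_apply f))
          \<longlonglongrightarrow> 0)"

definition supershrinking :: "(nat \<Rightarrow> 'a::real_normed_vector) \<Rightarrow> bool" where
  "supershrinking e \<longleftrightarrow> shrinking e \<and>
     (\<forall>a :: nat \<Rightarrow> real. bounded (range (\<lambda>n. \<Sum>i<n. a i *\<^sub>R e i)) \<and> a \<longlonglongrightarrow> 0
        \<longrightarrow> summable (\<lambda>n. a n *\<^sub>R e n))"

text \<open>Every real sequence is continuous on the discrete space of natural numbers,
  so the type of bounded continuous functions below is the space of bounded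
  sequences with the supremum norm.\<close>

definition c0 :: "(nat \<Rightarrow>\<^sub>C real) set" where
  "c0 = {a. apply_bcontfun a \<longlonglongrightarrow> 0}"

definition isomorphic_subspaces ::
    "'a::real_normed_vector set \<Rightarrow> 'b::real_normed_vector set \<Rightarrow> bool" where
  "isomorphic_subspaces S T \<longleftrightarrow>
     (\<exists>f g. homeomorphism S T f g \<and>
        (\<forall>x\<in>S. \<forall>y\<in>S. f (x + y) = f x + f y) \<and>
        (\<forall>c. \<forall>x\<in>S. f (c *\<^sub>R x) = c *\<^sub>R f x))"

definition contains_c0 :: "'a::real_normed_vector itself \<Rightarrow> bool" where
  "contains_c0 _ \<longleftrightarrow>
     (\<exists>S :: 'a set. subspace S \<and> closed S \<and> isomorphic_subspaces c0 S)"

text \<open>The bounded linear functionals on a normed space given by its carrier,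
  addition, scalar multiplication and norm. Functionals are total functions in HOL;
  the value 0 outside the carrier makes each functional on \<open>V\<close> correspond
  to exactly one function.\<close>

definition dual_space ::
    "'v set \<Rightarrow> ('v \<Rightarrow> 'v \<Rightarrow> 'v) \<Rightarrow> (real \<Rightarrow> 'v \<Rightarrow> 'v) \<Rightarrow> ('v \<Rightarrow> real) \<Rightarrow> ('v \<Rightarrow> real) set"
  where
  "dual_space V add scl N = {f.
     (\<forall>x\<in>V. \<forall>y\<in>V. f (add x y) = f x + f y) \<and>
     (\<forall>c. \<forall>x\<in>V. f (scl c x) = c * f x) \<and>
     (\<exists>K. \<forall>x\<in>V. \<bar>f x\<bar> \<le> K * N x) \<and>
     (\<forall>x. x \<notin> V \<longrightarrow> f x = 0)}"

definition dual :: "'a::real_normed_vector set \<Rightarrow> ('a \<Rightarrow> real) set" where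
  "dual Y = dual_space Y (+) (*\<^sub>R) norm"

definition bidual :: "'a::real_normed_vector set \<Rightarrow> (('a \<Rightarrow> real) \<Rightarrow> real) set" where
  "bidual Y = dual_space (dual Y) (\<lambda>f g x. f x + g x) (\<lambda>c f x. c * f x)
     (functional_norm Y norm)"

definition canonical :: "'a::real_normed_vector set \<Rightarrow> 'a \<Rightarrow> ('a \<Rightarrow> real) \<Rightarrow> real" where
  "canonical Y y = (\<lambda>f. if f \<in> dual Y then f y else 0)"

definition reflexive_subspace :: "'a::real_normed_vector set \<Rightarrow> bool" where
  "reflexive_subspace Y \<longleftrightarrow> canonical Y ` Y = bidual Y"

text \<open>Codimension 1: the quotient of the bidual by the canonical image is spanned by
  the nonzero class of a single \<open>F\<close>.\<close>

definition order_one_quasireflexive :: "'a::real_normed_vector set \<Rightarrow> bool" where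
  "order_one_quasireflexive Y \<longleftrightarrow>
     (\<exists>F \<in> bidual Y - canonical Y ` Y.
        \<forall>G \<in> bidual Y. \<exists>c. \<exists>y\<in>Y. G = (\<lambda>f. c * F f + canonical Y y f))"

end

theory Submission
  imports Defs
begin

text \<open>
Pass to a subsequence \<open>y\<close> whose coordinates with respect to \<open>e\<close> converge, rapidly, to scalars \<open>\<mu>\<close>.
Since \<open>e\<close> is shrinking, \<open>y\<close> is weakly Cauchy.

If \<open>\<Sum> \<mu>\<^sub>i e\<^sub>i\<close> converges, \<open>y\<close> is weakly null, and by Elton's theorem (which needs that \<open>c\<^sub>0\<close> does not
embed) some subsequence has the property that \<open>a \<rightarrow> 0\<close> whenever the partial sums of \<open>\<Sum> a\<^sub>n y\<^sub>n\<close> are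
bounded. Otherwise \<open>y\<close> has no weak limit, and by Rosenthal's \<open>c\<^sub>0\<close>-theorem some subsequence has the
property that \<open>\<Sum> a\<^sub>n\<close> converges whenever the partial sums of \<open>\<Sum> a\<^sub>n y\<^sub>n\<close> are bounded. Both theorems
are obtained from the same dichotomy: either functionals in the dual ball can oscillate along \<open>y\<close> by
an unbounded amount, and a fusion argument selects the subsequence, or a bounded semicontinuous
potential on the dual ball controls the oscillation and yields a weakly unconditionally Cauchy series
that does not converge, hence a copy of \<open>c\<^sub>0\<close>.

In both cases the coordinates of the limit of a bounded sequence of partial sums tend to 0, so by
supershrinkingness the limit is a vector; thus the subsequence is boundedly complete. A functional
on the dual of its span that vanishes on the biorthogonal functionals is a multiple of the weak*
limit of the subsequence, because the coordinate functionals of \<open>e\<close> are norm dense in the dual. This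
weak* limit lies in the space in the first case only.\<close>

section \<open>The Hahn-Banach theorem and the dual ball\<close>

text \<open>The subsequence has to be fixed before the coefficients are known, while the indices
  where they are large, or close to a limit point, depend on them. Therefore a strategy offers
  continuations at almost all indices instead of at one, and the fusion keeps its nodes playable at
  every later index; once coefficients are given, the moves are placed where they pay.

  Both kinds of oscillation are measured by one supremum of values. In the weakly null case a move
  gains \<open>g (y l)\<close>, a spike at the index played; in the other case it gains the drop
  \<open>lam f - lam g\<close> of the limit functional. If the values are bounded, their supremum
  \<phi> and, in the second case, \<phi> minus \<open>lam\<close> are upper semicontinuous, which
  exhibits \<open>lam\<close> as a difference of bounded semicontinuous functions. As
  \<open>lam\<close> itself is not weak* continuous, compactness alone does not make the convergence
  to it uniform on the dual ball; this is what the minimax lemma supplies.\<close>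

lemma dominated_linear_graph_extend:
  fixes M :: "('a::real_normed_vector \<times> real) set"
  assumes M: "subspace M" and dom: "\<And>x r. (x, r) \<in> M \<Longrightarrow> \<bar>r\<bar> \<le> B * norm x" and "B \<ge> 0"
  obtains c where "\<And>x r s. (x, r) \<in> M \<Longrightarrow> \<bar>r + s * c\<bar> \<le> B * norm (x + s *\<^sub>R z)"
proof -
  have B: "r - r' \<le> B * norm (x - x')" if "(x, r) \<in> M" "(x', r') \<in> M" for x r x' r'
    using dom[of "x - x'" "r - r'"] subspace_diff[OF M that] by simp
  have M0: "(0, 0) \<in> M" using subspace_0[OF M] by (simp add: zero_prod_def)
  \<comment> \<open>The value at \<open>z\<close> has to lie between the lower bounds
    \<open>- B * norm (x + z) - r\<close> collected in \<open>S\<close> and the upper bounds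
    \<open>B * norm (x + z) - r\<close>. Their compatibility is the triangle inequality, and
    \<open>Sup S\<close> is one admissible choice.\<close>
  define S where "S = (\<lambda>(x, r). - B * norm (x + z) - r) ` M"
  have up: "u \<le> B * norm (x + z) - r" if "u \<in> S" "(x, r) \<in> M" for u x r
  proof -
    obtain x' r' where x': "(x', r') \<in> M" "u = - B * norm (x' + z) - r'"
      using \<open>u \<in> S\<close> S_def by auto
    have "r - r' \<le> B * norm (x - x')" by (rule B) fact+
    also have "\<dots> \<le> B * (norm (x + z) + norm (x' + z))"
      using norm_triangle_ineq4[of "x + z" "x' + z"] \<open>B \<ge> 0\<close> by (intro mult_left_mono) auto
    finally show ?thesis using x' by (simp add: algebra_simps)
  qed
  have "bdd_above S" using up M0 by (meson bdd_above.I)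
  define c where "c = Sup S"
  have c1: "\<bar>r + c\<bar> \<le> B * norm (x + z)" if "(x, r) \<in> M" for x r
  proof -
    have "- B * norm (x + z) - r \<in> S" using that by (auto simp: S_def intro!: rev_image_eqI)
    then have "- B * norm (x + z) - r \<le> c"
      unfolding c_def using \<open>bdd_above S\<close> by (intro cSup_upper)
    moreover have "c \<le> B * norm (x + z) - r"
      unfolding c_def using that M0 by (intro cSup_least up) (auto simp: S_def)
    ultimately show ?thesis by auto
  qed
  have "\<bar>r + s * c\<bar> \<le> B * norm (x + s *\<^sub>R z)" if "(x, r) \<in> M" for x r s
  proof (cases "s = 0")
    case True then show ?thesis using dom[OF that] by simp
  next
    case False
    \<comment> \<open>Homogeneity: division by \<open>s\<close> reduces the estimate to the case
      \<open>s = 1\<close>, which is \<open>c1\<close>.\<close>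
    have "((1/s) *\<^sub>R x, r / s) \<in> M"
      using subspace_scale[OF M that, of "1/s"] by simp
    from c1[OF this] have "\<bar>s\<bar> * \<bar>r / s + c\<bar> \<le> \<bar>s\<bar> * (B * norm ((1/s) *\<^sub>R x + z))"
      by (intro mult_left_mono) auto
    moreover have "\<bar>s\<bar> * \<bar>r / s + c\<bar> = \<bar>r + s * c\<bar>"
      using False by (simp flip: abs_mult add: distrib_left)
    moreover have "\<bar>s\<bar> * norm ((1/s) *\<^sub>R x + z) = norm (x + s *\<^sub>R z)"
      using False by (simp flip: norm_scaleR add: scaleR_add_right)
    ultimately show ?thesis by (simp add: mult.left_commute)
  qed
  then show thesis by (rule that)
qed

text \<open>Zorn's lemma is applied to graphs, as subspaces of the product with the reals, so that
  the union of a chain is directly a candidate again. Single-valuedness comes from the bound: it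
  forces \<open>r = 0\<close> for every pair \<open>(0, r)\<close> of the subspace.\<close>

theorem Hahn_Banach:
  fixes f :: "'a::real_normed_vector \<Rightarrow> real"
  assumes S: "subspace S" and add: "\<And>x y. x \<in> S \<Longrightarrow> y \<in> S \<Longrightarrow> f (x + y) = f x + f y"
    and scale: "\<And>c x. x \<in> S \<Longrightarrow> f (c *\<^sub>R x) = c * f x"
    and dom: "\<And>x. x \<in> S \<Longrightarrow> \<bar>f x\<bar> \<le> B * norm x" and "B \<ge> 0"
  obtains g where "linear g" "\<And>x. \<bar>g x\<bar> \<le> B * norm x" "\<And>x. x \<in> S \<Longrightarrow> g x = f x"
proof -
  define G where "G = (\<lambda>x. (x, f x)) ` S"
  have f0: "f 0 = 0" using scale[of 0 0] subspace_0[OF S] by simp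
  define A where "A = {M :: ('a \<times> real) set. subspace M \<and> G \<subseteq> M \<and> (\<forall>(x, r)\<in>M. \<bar>r\<bar> \<le> B * norm x)}"
  have "subspace G"
    using S add scale f0
    by (auto simp: G_def subspace_def zero_prod_def image_iff)
  then have "G \<in> A" using dom by (auto simp: A_def G_def)
  then have "\<exists>M\<in>A. \<forall>X\<in>A. M \<subseteq> X \<longrightarrow> X = M"
  proof (intro subset_Zorn_nonempty)
    fix C assume C: "C \<noteq> {}" "subset.chain A C"
    have CA: "C \<subseteq> A" and CC: "\<And>X Y. X \<in> C \<Longrightarrow> Y \<in> C \<Longrightarrow> X \<subseteq> Y \<or> Y \<subseteq> X"
      using C by (auto simp: subset_chain_def)
    have "subspace (\<Union>C)"
    proof (rule subspaceI)
      obtain X where "X \<in> C" using C by auto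
      then have "0 \<in> X" using CA by (intro subspace_0) (auto simp: A_def)
      then show "0 \<in> \<Union>C" using \<open>X \<in> C\<close> by auto
    next
      fix x y assume "x \<in> \<Union>C" "y \<in> \<Union>C"
      then obtain X Y where "X \<in> C" "x \<in> X" "Y \<in> C" "y \<in> Y" by auto
      then obtain Z where "Z \<in> C" "x \<in> Z" "y \<in> Z" using CC by blast
      then show "x + y \<in> \<Union>C" using CA by (auto simp: A_def intro: subspace_add)
    next
      fix c x assume "x \<in> \<Union>C"
      then show "c *\<^sub>R x \<in> \<Union>C" using CA by (auto simp: A_def intro: subspace_scale)
    qed
    then show "\<Union>C \<in> A" using C CA unfolding A_def by fastforce
  qed auto
  then obtain M where "M \<in> A" and max: "\<And>X. X \<in> A \<Longrightarrow> M \<subseteq> X \<Longrightarrow> X = M" by auto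
  then have M: "subspace M" "G \<subseteq> M" "\<And>x r. (x, r) \<in> M \<Longrightarrow> \<bar>r\<bar> \<le> B * norm x"
    by (auto simp: A_def)
  have total: "\<exists>r. (z, r) \<in> M" for z
  proof -
    obtain c where c: "\<And>x r s. (x, r) \<in> M \<Longrightarrow> \<bar>r + s * c\<bar> \<le> B * norm (x + s *\<^sub>R z)"
      using dominated_linear_graph_extend[OF M(1,3) \<open>B \<ge> 0\<close>] by metis
    define M' where "M' = {m + s *\<^sub>R (z, c) | m s. m \<in> M}"
    have "subspace M'"
    proof (rule subspaceI)
      have "0 = 0 + 0 *\<^sub>R (z, c)" by (simp add: zero_prod_def)
      then show "0 \<in> M'" unfolding M'_def using subspace_0[OF M(1)] by blast
    next
      fix x y assume "x \<in> M'" "y \<in> M'"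
      then obtain m s m' s' where *: "x = m + s *\<^sub>R (z, c)" "y = m' + s' *\<^sub>R (z, c)" "m \<in> M" "m' \<in> M"
        by (auto simp only: M'_def)
      have "x + y = (m + m') + (s + s') *\<^sub>R (z, c)" unfolding * by (simp add: scaleR_add_left algebra_simps del: scaleR_Pair)
      then show "x + y \<in> M'" using * subspace_add[OF M(1)] unfolding M'_def by blast
    next
      fix a x assume "x \<in> M'"
      then obtain m s where *: "x = m + s *\<^sub>R (z, c)" "m \<in> M"
        by (auto simp only: M'_def)
      have "a *\<^sub>R x = a *\<^sub>R m + (a * s) *\<^sub>R (z, c)" unfolding * by (simp add: scaleR_add_right del: scaleR_Pair)
      then show "a *\<^sub>R x \<in> M'" using * subspace_scale[OF M(1)] unfolding M'_def by blast
    qed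
    moreover have MM: "M \<subseteq> M'"
    proof
      fix m assume "m \<in> M"
      then show "m \<in> M'" unfolding M'_def by (intro CollectI exI[of _ m] exI[of _ 0]) (auto simp: zero_prod_def)
    qed
    moreover have "\<bar>r\<bar> \<le> B * norm x" if "(x, r) \<in> M'" for x r
      using that c by (force simp: M'_def)
    ultimately have "M' \<in> A" using M(2) by (auto simp: A_def)
    then have "M' = M" using max MM by blast
    moreover have "(z, c) \<in> M'" unfolding M'_def using subspace_0[OF M(1)]
      by (intro CollectI exI[of _ "0 :: 'a \<times> real"] exI[of _ 1]) (auto simp: zero_prod_def)
    ultimately show ?thesis by blast
  qed
  have uniq: "r = r'" if "(x, r) \<in> M" "(x, r') \<in> M" for x r r'
    using M(3)[of "x - x" "r - r'"] subspace_diff[OF M(1) that] by simp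
  define g where "g x = (THE r. (x, r) \<in> M)" for x
  have gM: "(x, g x) \<in> M" for x unfolding g_def using total uniq by (metis theI')
  have geq: "g x = r" if "(x, r) \<in> M" for x r using uniq gM that by blast
  show thesis
  proof
    show "linear g"
    proof (rule linearI)
      show "g (x + y) = g x + g y" for x y
        using subspace_add[OF M(1) gM[of x] gM[of y]] by (intro geq) simp
      show "g (c *\<^sub>R x) = c *\<^sub>R g x" for c x
        using subspace_scale[OF M(1) gM[of x], of c] by (intro geq) simp
    qed
    show "\<bar>g x\<bar> \<le> B * norm x" for x using M(3) gM by blast
    show "g x = f x" if "x \<in> S" for x using M(2) that by (intro geq) (auto simp: G_def)
  qed
qed

section \<open>The dual ball: norming functionals, separation, weak* compactness\<close>

definition dual_ball :: "('a::real_normed_vector \<Rightarrow> real) set" where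
  "dual_ball = {f. linear f \<and> (\<forall>x. \<bar>f x\<bar> \<le> norm x)}"

lemma dual_ball_linear: "f \<in> dual_ball \<Longrightarrow> linear f"
  and dual_ball_le: "f \<in> dual_ball \<Longrightarrow> \<bar>f x\<bar> \<le> norm x"
  by (auto simp: dual_ball_def)

lemma dual_ball_uminus: "f \<in> dual_ball \<Longrightarrow> (\<lambda>x. - f x) \<in> dual_ball"
  by (auto simp: dual_ball_def linear_compose_neg)

lemma zero_in_dual_ball: "(\<lambda>x. 0) \<in> dual_ball"
  by (auto simp: dual_ball_def linear_zero)

lemma dual_ball_bounded_linear: "f \<in> dual_ball \<Longrightarrow> bounded_linear f"
  by (auto simp: dual_ball_def linear_iff bounded_linear_def bounded_linear_axioms_def
      intro!: exI[of _ 1])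

lemma norming_functional:
  fixes x :: "'a::real_normed_vector"
  obtains f where "f \<in> dual_ball" "f x = norm x"
proof (cases "x = 0")
  case True
  then show ?thesis using that[OF zero_in_dual_ball] by simp
next
  case False
  define h where "h v = (THE c. v = c *\<^sub>R x) * norm x" for v
  have h: "h (c *\<^sub>R x) = c * norm x" for c
    unfolding h_def using False by (subst the_equality[of _ c]) auto
  obtain f where "linear f" "\<And>v. \<bar>f v\<bar> \<le> 1 * norm v" "\<And>v. v \<in> range (\<lambda>c. c *\<^sub>R x) \<Longrightarrow> f v = h v"
  proof (rule Hahn_Banach[of "range (\<lambda>c. c *\<^sub>R x)" h 1])
    show "subspace (range (\<lambda>c. c *\<^sub>R x))"
      using subspace_span[of "{x}"] by (simp add: span_singleton)
    show "h (u + v) = h u + h v" if "u \<in> range (\<lambda>c. c *\<^sub>R x)" "v \<in> range (\<lambda>c. c *\<^sub>R x)" for u v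
      using that h by (auto simp flip: scaleR_add_left simp: distrib_right)
    show "h (c *\<^sub>R u) = c * h u" if "u \<in> range (\<lambda>c. c *\<^sub>R x)" for u c
      using that h by auto
    show "\<bar>h u\<bar> \<le> 1 * norm u" if "u \<in> range (\<lambda>c. c *\<^sub>R x)" for u
      using that h by (auto simp: abs_mult)
  qed auto
  note f = this
  have "f (1 *\<^sub>R x) = h (1 *\<^sub>R x)" by (rule f(3)) blast
  then have "f x = norm x" using h[of 1] by simp
  moreover have "f \<in> dual_ball" using f by (simp add: dual_ball_def)
  ultimately show ?thesis using that by blast
qed

lemma norm_le_dual_ball:
  assumes "\<And>f. f \<in> dual_ball \<Longrightarrow> f x \<le> C"
  shows "norm x \<le> C"
  using norming_functional assms by metis

text \<open>On the span of \<open>S\<close> and \<open>w\<close> the coefficient of \<open>w\<close>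
  is a functional bounded by \<open>1 / d\<close>, where \<open>d\<close> is the distance of
  \<open>w\<close> from \<open>S\<close>; Hahn-Banach extends it.\<close>

lemma separating_functional:
  fixes S :: "'a::real_normed_vector set"
  assumes S: "subspace S" "closed S" and w: "w \<notin> S"
  obtains f where "bounded_linear f" "\<And>x. x \<in> S \<Longrightarrow> f x = 0" "f w \<noteq> (0::real)"
proof -
  define d where "d = infdist w S"
  have "S \<noteq> {}" using subspace_0[OF S(1)] by auto
  then have "d > 0"
    using S w by (metis d_def in_closed_iff_infdist_zero infdist_nonneg less_eq_real_def)
  have dist: "\<bar>c\<bar> * d \<le> norm (u + c *\<^sub>R w)" if "u \<in> S" for u c
  proof (cases "c = 0")
    case False
    have "d \<le> dist w ((-1/c) *\<^sub>R u)"
      unfolding d_def using subspace_scale[OF S(1) that] by (intro infdist_le)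
    then have "\<bar>c\<bar> * d \<le> \<bar>c\<bar> * norm (w + (1/c) *\<^sub>R u)"
      by (simp add: dist_norm mult_left_mono)
    also have "\<dots> = norm (u + c *\<^sub>R w)"
      using False by (simp flip: norm_scaleR add: scaleR_add_right add.commute)
    finally show ?thesis .
  qed auto
  define T where "T = {u + c *\<^sub>R w | u c. u \<in> S}"
  define h where "h v = (THE c. v - c *\<^sub>R w \<in> S)" for v
  have uniq: "c = c'" if "u + c *\<^sub>R w - c' *\<^sub>R w \<in> S" "u \<in> S" for u c c'
  proof -
    have "(u + c *\<^sub>R w - c' *\<^sub>R w) - u \<in> S" using that S(1) by (metis subspace_diff)
    then have "(c - c') *\<^sub>R w \<in> S" by (simp add: algebra_simps)
    then show ?thesis using w subspace_scale[OF S(1), of "(c - c') *\<^sub>R w" "1 / (c - c')"] by (cases "c = c'") auto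
  qed
  have h: "h (u + c *\<^sub>R w) = c" if "u \<in> S" for u c
    unfolding h_def using that uniq[of u c] by (intro the_equality) auto
  have T: "subspace T"
  proof -
    have "T = {x + y | x y. x \<in> S \<and> y \<in> span {w}}"
      by (auto simp: T_def span_singleton)
    then show ?thesis using subspace_sums[OF S(1) subspace_span] by simp
  qed
  obtain f where f: "linear f" "\<And>v. \<bar>f v\<bar> \<le> (1/d) * norm v" "\<And>v. v \<in> T \<Longrightarrow> f v = h v"
  proof (rule Hahn_Banach[of T h "1/d"])
    show "h (x + y) = h x + h y" if "x \<in> T" "y \<in> T" for x y
    proof -
      obtain u c u' c' where *: "x = u + c *\<^sub>R w" "u \<in> S" "y = u' + c' *\<^sub>R w" "u' \<in> S"
        using \<open>x \<in> T\<close> \<open>y \<in> T\<close> by (auto simp: T_def)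
      have "x + y = (u + u') + (c + c') *\<^sub>R w" using * by (simp add: algebra_simps)
      then show ?thesis using * h subspace_add[OF S(1)] by metis
    qed
    show "h (a *\<^sub>R x) = a * h x" if "x \<in> T" for a x
    proof -
      obtain u c where *: "x = u + c *\<^sub>R w" "u \<in> S" using \<open>x \<in> T\<close> by (auto simp: T_def)
      have "a *\<^sub>R x = a *\<^sub>R u + (a * c) *\<^sub>R w" using * by (simp add: algebra_simps)
      then show ?thesis using * h subspace_scale[OF S(1)] by metis
    qed
    show "\<bar>h x\<bar> \<le> 1 / d * norm x" if "x \<in> T" for x
      using that h dist \<open>d > 0\<close> by (auto simp: T_def field_simps)
  qed (use T \<open>d > 0\<close> in auto)
  show thesis
  proof
    show "bounded_linear f"
      using f(1,2) by (auto simp: linear_iff bounded_linear_def bounded_linear_axioms_def mult.commute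
          intro!: exI[of _ "1/d"])
    show "f x = 0" if "x \<in> S" for x
    proof -
      have "x + 0 *\<^sub>R w \<in> T" unfolding T_def using that by blast
      then show ?thesis using f(3)[of "x + 0 *\<^sub>R w"] h[OF that, of 0] by simp
    qed
    have "0 + 1 *\<^sub>R w \<in> T" unfolding T_def using subspace_0[OF S(1)] by blast
    then show "f w \<noteq> 0" using f(3)[of "0 + 1 *\<^sub>R w"] h[OF subspace_0[OF S(1)], of 1] by simp
  qed
qed

lemma continuous_on_eval: "continuous_on A (\<lambda>f::'a \<Rightarrow> real. f x)"
  by (rule continuous_on_subset[OF continuous_on_product_coordinates]) simp

lemma compact_box: "compact (PiE UNIV (\<lambda>x::'a. {l x..u x :: real}))"
proof -
  have "compactin (product_topology (\<lambda>x::'a. euclidean :: real topology) UNIV) (PiE UNIV (\<lambda>x. {l x..u x}))"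
    unfolding compactin_PiE by (auto simp: compactin_euclidean_iff)
  then show ?thesis by (simp add: euclidean_product_topology compactin_euclidean_iff)
qed

text \<open>Banach-Alaoglu. Functionals are plain functions here, so their topology is that of
  pointwise convergence, which is the weak* topology. The ball is a closed subset of a product of
  intervals, compact by Tychonoff.\<close>

lemma compact_dual_ball: "compact (dual_ball :: ('a::real_normed_vector \<Rightarrow> real) set)"
proof -
  have "compact (PiE UNIV (\<lambda>x::'a. {- norm x..norm x}))" by (rule compact_box)
  moreover have "closed {f::'a \<Rightarrow> real. \<forall>x y. f (x + y) = f x + f y}"
    by (rule closed_Collect_all, rule closed_Collect_all, rule closed_Collect_eq)
       (rule continuous_on_add continuous_on_eval)+
  moreover have "closed {f::'a \<Rightarrow> real. \<forall>c x. f (c *\<^sub>R x) = c * f x}"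
    by (rule closed_Collect_all, rule closed_Collect_all, rule closed_Collect_eq)
       (rule continuous_on_mult_left continuous_on_eval)+
  ultimately have "compact (PiE UNIV (\<lambda>x::'a. {- norm x..norm x}) \<inter>
      ({f. \<forall>x y. f (x + y) = f x + f y} \<inter> {f. \<forall>c x. f (c *\<^sub>R x) = c * f x}))"
    by (blast intro: compact_Int_closed closed_Int)
  moreover have "PiE UNIV (\<lambda>x::'a. {- norm x..norm x}) \<inter>
      ({f. \<forall>x y. f (x + y) = f x + f y} \<inter> {f. \<forall>c x. f (c *\<^sub>R x) = c * f x}) = dual_ball"
  proof -
    have *: "\<bar>r\<bar> \<le> n \<longleftrightarrow> r \<in> {- n..n}" for r n :: real by auto
    show ?thesis unfolding dual_ball_def linear_iff * PiE_UNIV_domain Pi_def real_scaleR_def by blast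
  qed
  ultimately show ?thesis by simp
qed

section \<open>Semicontinuous functions and Simons' minimax lemma\<close>

definition usc_on :: "'w::topological_space set \<Rightarrow> ('w \<Rightarrow> real) \<Rightarrow> bool" where
  "usc_on W h \<longleftrightarrow> (\<forall>x\<in>W. \<forall>c>h x. \<exists>U. open U \<and> x \<in> U \<and> (\<forall>y\<in>U \<inter> W. h y < c))"

lemma usc_onD:
  assumes "usc_on W h" "x \<in> W" "h x < c"
  shows "\<exists>U. open U \<and> x \<in> U \<and> (\<forall>y\<in>U \<inter> W. h y < c)"
  using assms unfolding usc_on_def by blast

lemma usc_onI:
  assumes "\<And>x e. x \<in> W \<Longrightarrow> e > 0 \<Longrightarrow> \<exists>U. open U \<and> x \<in> U \<and> (\<forall>y\<in>U \<inter> W. h y \<le> h x + e)"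
  shows "usc_on W h"
  unfolding usc_on_def
proof (intro ballI allI impI)
  fix x c assume "x \<in> W" "h x < c"
  then obtain U where "open U \<and> x \<in> U \<and> (\<forall>y\<in>U \<inter> W. h y \<le> h x + (c - h x) / 2)"
    using assms[of x "(c - h x) / 2"] by auto
  moreover have "a < c" if "a \<le> h x + (c - h x) / 2" for a
    using that \<open>h x < c\<close> by (simp add: field_simps)
  ultimately show "\<exists>U. open U \<and> x \<in> U \<and> (\<forall>y\<in>U \<inter> W. h y < c)" by blast
qed

lemma usc_on_continuous: "continuous_on W h \<Longrightarrow> usc_on W h"
proof -
  assume *: "continuous_on W h"
  show "usc_on W h" unfolding usc_on_def
  proof (intro ballI allI impI)
    fix x c assume "x \<in> W" "h x < c"
    obtain A where "open A" "A \<inter> W = h -` {..<c} \<inter> W"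
      using * unfolding continuous_on_open_invariant by (metis open_lessThan)
    then show "\<exists>U. open U \<and> x \<in> U \<and> (\<forall>y\<in>U \<inter> W. h y < c)"
      using \<open>x \<in> W\<close> \<open>h x < c\<close> by (intro exI[of _ A]) auto
  qed
qed

lemma usc_on_add:
  assumes "usc_on W g" "usc_on W h" shows "usc_on W (\<lambda>x. g x + h x)"
proof (rule usc_onI)
  fix x and e :: real assume "x \<in> W" and "e > 0"
  obtain U where "open U" "x \<in> U" "\<forall>y\<in>U \<inter> W. g y < g x + e / 2"
    using usc_onD[OF assms(1) \<open>x \<in> W\<close>, of "g x + e / 2"] \<open>e > 0\<close> by auto
  moreover obtain V where "open V" "x \<in> V" "\<forall>y\<in>V \<inter> W. h y < h x + e / 2"
    using usc_onD[OF assms(2) \<open>x \<in> W\<close>, of "h x + e / 2"] \<open>e > 0\<close> by auto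
  moreover from calculation have "\<forall>y\<in>U \<inter> V \<inter> W. g y + h y \<le> g x + h x + e"
    by (smt (verit) IntE IntI field_sum_of_halves)
  ultimately show "\<exists>U. open U \<and> x \<in> U \<and> (\<forall>y\<in>U \<inter> W. g y + h y \<le> g x + h x + e)"
    by (intro exI[of _ "U \<inter> V"]) auto
qed

lemma usc_on_max:
  assumes "usc_on W g" "usc_on W h" shows "usc_on W (\<lambda>x. max (g x) (h x))"
  unfolding usc_on_def
proof (intro ballI allI impI)
  fix x c assume x: "x \<in> W" "max (g x) (h x) < c"
  obtain U where "open U" "x \<in> U" "\<forall>y\<in>U \<inter> W. g y < c"
    using usc_onD[OF assms(1) x(1), of c] x(2) by auto
  moreover obtain V where "open V" "x \<in> V" "\<forall>y\<in>V \<inter> W. h y < c"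
    using usc_onD[OF assms(2) x(1), of c] x(2) by auto
  ultimately show "\<exists>U. open U \<and> x \<in> U \<and> (\<forall>y\<in>U \<inter> W. max (g y) (h y) < c)"
    by (intro exI[of _ "U \<inter> V"]) (auto intro: open_Int)
qed

lemma usc_on_cmult:
  assumes "usc_on W g" "c > 0" shows "usc_on W (\<lambda>x. c * g x)"
  unfolding usc_on_def
proof (intro ballI allI impI)
  fix x d assume x: "x \<in> W" "c * g x < d"
  obtain U where "open U" "x \<in> U" "\<forall>y\<in>U \<inter> W. g y < d / c"
    using usc_onD[OF assms(1) x(1), of "d / c"] x(2) \<open>c > 0\<close> by (auto simp: field_simps)
  then show "\<exists>U. open U \<and> x \<in> U \<and> (\<forall>y\<in>U \<inter> W. c * g y < d)"
    using \<open>c > 0\<close> by (intro exI[of _ U]) (auto simp: field_simps)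
qed

lemma usc_on_sum:
  assumes "\<And>i. i \<in> I \<Longrightarrow> usc_on W (g i)" shows "usc_on W (\<lambda>x. \<Sum>i\<in>I. g i x)"
  using assms
proof (induction I rule: infinite_finite_induct)
  case (insert i I)
  have "usc_on W (\<lambda>x. g i x + (\<Sum>i\<in>I. g i x))"
    using insert by (intro usc_on_add) auto
  then show ?case using insert by simp
qed (auto intro: usc_on_continuous)

text \<open>If no point were maximal, the relatively open sets where \<open>h\<close> is below
  \<open>h y\<close> would cover \<open>W\<close>; the best \<open>y\<close> of a finite subcover
  lies in none of its sets.\<close>

lemma usc_attains_sup:
  assumes W: "compact W" "W \<noteq> {}" and h: "usc_on W h"
  obtains x where "x \<in> W" "\<And>y. y \<in> W \<Longrightarrow> h y \<le> h x"
proof -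
  have "\<exists>x\<in>W. \<forall>y\<in>W. h y \<le> h x"
  proof (rule ccontr)
    assume "\<not> ?thesis"
    then have less: "\<exists>y\<in>W. h x < h y" if "x \<in> W" for x
      using that by (auto simp: not_le)
    define U where "U y = (SOME A. open A \<and> A \<inter> W = {x \<in> W. h x < h y})" for y
    have U: "open (U y) \<and> U y \<inter> W = {x \<in> W. h x < h y}" for y
    proof -
      define A where "A = \<Union>{A. open A \<and> (\<forall>x\<in>A \<inter> W. h x < h y)}"
      have "open A" by (auto simp: A_def)
      moreover have "x \<in> A" if "x \<in> W" "h x < h y" for x
        using usc_onD[OF h that] unfolding A_def by auto
      moreover have "h x < h y" if "x \<in> A" "x \<in> W" for x
        using that unfolding A_def by auto
      ultimately have "open A \<and> A \<inter> W = {x \<in> W. h x < h y}" by blast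
      then show ?thesis unfolding U_def by (rule someI)
    qed
    have "W \<subseteq> \<Union>(U ` W)" using less U by blast
    then obtain D where D: "D \<subseteq> W" "finite D" "W \<subseteq> \<Union>(U ` D)"
      using W(1) U by (metis compactE_image)
    then have "D \<noteq> {}" using W(2) by auto
    then have "Max (h ` D) \<in> h ` D" using D(2) by (intro Max_in) auto
    then obtain y where "y \<in> D" and hy: "h y = Max (h ` D)" by (metis imageE)
    then have y: "y \<in> D" "\<And>z. z \<in> D \<Longrightarrow> h z \<le> h y"
      using D(2) by (auto simp: hy)
    then obtain z where "z \<in> D" "y \<in> U z" using D by blast
    then have "h y < h z" using U[of z] y(1) D(1) by blast
    then show False using y(2)[OF \<open>z \<in> D\<close>] by simp
  qed
  then show ?thesis using that by blast
qed

text \<open>The points \<open>z n\<close> are chosen so that \<open>z n\<close> almost minimizes the supremum when it receives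
  all of the weight left; at the point where the resulting infinite convex combination attains its
  supremum, all of its normalized tails are then almost as large.\<close>

lemma Simons_minimax:
  fixes W :: "'w::topological_space set" and B :: "nat \<Rightarrow> 'z::real_vector set"
  assumes W: "compact W" "W \<noteq> {}"
    and B: "\<And>n. convex (B n)" "\<And>n. B n \<noteq> {}" "\<And>n. B (Suc n) \<subseteq> B n"
    and usc: "\<And>z. z \<in> B 0 \<Longrightarrow> usc_on W (H z)"
    and bound: "\<And>z x. z \<in> B 0 \<Longrightarrow> x \<in> W \<Longrightarrow> 0 \<le> H z x \<and> H z x \<le> C"
    and conv: "\<And>x. x \<in> W \<Longrightarrow> convex_on (B 0) (\<lambda>z. H z x)"
    and lim: "\<And>x. x \<in> W \<Longrightarrow> \<exists>n. \<forall>z\<in>B n. H z x \<le> V"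
    and "e > 0"
  shows "\<exists>z\<in>B 0. \<forall>x\<in>W. H z x \<le> V + e"
proof (rule ccontr)
  assume "\<not> ?thesis"
  then have big: "\<exists>x\<in>W. H z x > V + e" if "z \<in> B 0" for z using that by (meson not_le)
  have Bmono: "B n \<subseteq> B m" if "m \<le> n" for m n
    using B(3) that by (rule lift_Suc_antimono_le)
  define S where "S g = (SUP x\<in>W. g x)" for g :: "'w \<Rightarrow> real"
  \<comment> \<open>The error of stage \<open>n\<close> is later multiplied by \<open>2 ^ n\<close>.
    With the tolerance \<open>e / 4 / 4 ^ n\<close> the scaled errors \<open>e / 4 / 2 ^ n\<close>
    add up to at most \<open>e / 2\<close>, half of the assumed excess.\<close>
  define good where "good s n z \<longleftrightarrow> z \<in> B n \<and> (\<forall>z'\<in>B n.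
      S (\<lambda>x. s x + H z x / 2 ^ n) \<le> S (\<lambda>x. s x + H z' x / 2 ^ n) + e / 4 / 4 ^ n)" for s n z
  define bdd where "bdd s \<longleftrightarrow> (\<exists>c. \<forall>x\<in>W. \<bar>s x\<bar> \<le> c)" for s :: "'w \<Rightarrow> real"
  have bddS: "g x \<le> S g" if "bdd g" "x \<in> W" for g x
  proof -
    obtain c where "\<And>x. x \<in> W \<Longrightarrow> \<bar>g x\<bar> \<le> c" using \<open>bdd g\<close> bdd_def by auto
    then have "bdd_above (g ` W)" by (intro bdd_aboveI2[of _ _ c]) (auto simp: abs_le_iff)
    then show ?thesis unfolding S_def using that(2) by (intro cSUP_upper)
  qed
  have leS: "S g \<le> c" if "\<And>x. x \<in> W \<Longrightarrow> g x \<le> c" for g c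
    unfolding S_def using that W by (intro cSUP_least) auto
  have bddH: "bdd (\<lambda>x. s x + H z x / 2 ^ n)" if "bdd s" "z \<in> B m" for s z m and n :: nat
  proof -
    obtain c where c: "\<And>x. x \<in> W \<Longrightarrow> \<bar>s x\<bar> \<le> c" using \<open>bdd s\<close> bdd_def by auto
    have "\<bar>s x + H z x / 2 ^ n\<bar> \<le> c + C / 2 ^ n" if "x \<in> W" for x
    proof -
      have "0 \<le> H z x / 2 ^ n" "H z x / 2 ^ n \<le> C / 2 ^ n"
        using bound[of z x] \<open>z \<in> B m\<close> Bmono[of 0 m] that by (auto simp: divide_right_mono subset_iff)
      then show ?thesis using c[OF that] by linarith
    qed
    then show ?thesis unfolding bdd_def by blast
  qed
  have ex_good: "\<exists>z. good s n z" if "bdd s" for s n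
  proof -
    define A where "A = (\<lambda>z. S (\<lambda>x. s x + H z x / 2 ^ n)) ` B n"
    obtain c where c: "\<And>x. x \<in> W \<Longrightarrow> \<bar>s x\<bar> \<le> c" using \<open>bdd s\<close> bdd_def by auto
    obtain x0 where "x0 \<in> W" using W by auto
    have "- c \<le> a" if "a \<in> A" for a
    proof -
      obtain z where z: "z \<in> B n" "a = S (\<lambda>x. s x + H z x / 2 ^ n)" using \<open>a \<in> A\<close> A_def by auto
      have "- c \<le> s x0" using c[OF \<open>x0 \<in> W\<close>] by auto
      also have "\<dots> \<le> s x0 + H z x0 / 2 ^ n" using bound[of z x0] z Bmono[of 0 n] \<open>x0 \<in> W\<close> by auto
      also have "\<dots> \<le> a" using bddS[OF bddH[OF \<open>bdd s\<close> z(1)] \<open>x0 \<in> W\<close>] z by simp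
      finally show ?thesis .
    qed
    then have "bdd_below A" by (rule bdd_belowI)
    moreover have "A \<noteq> {}" using B(2) A_def by auto
    moreover have "Inf A < Inf A + e / 4 / 4 ^ n" using \<open>e > 0\<close> by simp
    ultimately obtain a where a: "a \<in> A" "a < Inf A + e / 4 / 4 ^ n"
      using cInf_lessD by metis
    then obtain z where "z \<in> B n" "a = S (\<lambda>x. s x + H z x / 2 ^ n)" using A_def by auto
    moreover have "a \<le> b + e / 4 / 4 ^ n" if "b \<in> A" for b
      using a cInf_lower[OF that \<open>bdd_below A\<close>] by linarith
    ultimately show ?thesis unfolding good_def A_def by blast
  qed
  define nxt where "nxt s n = (SOME z. good s n z)" for s n
  \<comment> \<open>\<open>s n\<close> is the part of the convex combination already fixed, with
    weights \<open>1/2\<close>, \<open>1/4\<close> and so on. The weight left is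
    \<open>1 / 2 ^ n\<close>, and \<open>good\<close> tests each candidate with all of it.\<close>
  define s where "s = rec_nat (\<lambda>x. 0) (\<lambda>n s x. s x + H (nxt s n) x / 2 ^ Suc n)"
  define z where "z n = nxt (s n) n" for n
  have s0: "s 0 = (\<lambda>x. 0)" by (simp add: s_def)
  have sS: "s (Suc n) = (\<lambda>x. s n x + H (z n) x / 2 ^ Suc n)" for n by (simp add: s_def z_def)
  have sb: "bdd (s n) \<and> good (s n) n (z n)" for n
  proof (induction n)
    case 0
    have "bdd (s 0)" by (auto simp: bdd_def s0)
    then show ?case unfolding z_def nxt_def using ex_good someI_ex by metis
  next
    case (Suc n)
    then have "bdd (s (Suc n))" unfolding sS by (intro bddH) (auto simp: good_def)
    then show ?case unfolding z_def nxt_def using ex_good someI_ex by metis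
  qed
  then have zB: "z n \<in> B n" for n by (simp add: good_def)
  have zB0: "z n \<in> B 0" for n using zB Bmono by blast
  have Hz: "0 \<le> H (z n) x" "H (z n) x \<le> C" if "x \<in> W" for n x using bound zB0 that by auto
  have s_sum: "s n x = (\<Sum>i<n. H (z i) x / 2 ^ Suc i)" for n x
    by (induction n) (auto simp: s0 sS)
  have smono: "s n x \<le> s (Suc n) x" if "x \<in> W" for n x using Hz(1)[OF that, of n] by (simp add: sS)
  have tail: "s m x + c / 2 ^ m \<le> s n x + c / 2 ^ n"
    if "n \<le> m" "\<And>i. n \<le> i \<Longrightarrow> H (z i) x \<le> c" for n m x c
    using that(1)
  proof (induction m rule: dec_induct)
    case (step m)
    have "H (z m) x / 2 ^ Suc m \<le> c / 2 ^ Suc m" using that(2)[of m] step by (intro divide_right_mono) auto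
    moreover have "c / 2 ^ m = c / 2 ^ Suc m + c / 2 ^ Suc m" by simp
    moreover have "s (Suc m) x = s m x + H (z m) x / 2 ^ Suc m" by (simp add: sS)
    ultimately show ?case using step.IH by linarith
  qed auto
  define h where "h x = (\<Sum>i. H (z i) x / 2 ^ Suc i)" for x
  have summ: "summable (\<lambda>i. H (z i) x / 2 ^ Suc i)" if "x \<in> W" for x
  proof (rule summable_comparison_test'[of "\<lambda>i. C * (1/2) ^ Suc i" 0])
    show "summable (\<lambda>i. C * (1 / 2) ^ Suc i)"
      by (intro summable_mult summable_Suc_iff[THEN iffD2] summable_geometric) auto
    show "norm (H (z n) x / 2 ^ Suc n) \<le> C * (1 / 2) ^ Suc n" for n
      using Hz[OF that, of n] by (auto simp: field_simps power_one_over)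
  qed
  have slim: "(\<lambda>n. s n x) \<longlonglongrightarrow> h x" if "x \<in> W" for x
    unfolding s_sum h_def using summ[OF that] by (rule summable_LIMSEQ)
  have s_le_h: "s n x \<le> h x" if "x \<in> W" for n x
  proof (rule LIMSEQ_le_const[OF slim[OF that]])
    have "s n x \<le> s m x" if "n \<le> m" for m using smono[OF \<open>x \<in> W\<close>] that by (rule lift_Suc_mono_le)
    then show "\<exists>N. \<forall>m\<ge>N. s n x \<le> s m x" by blast
  qed
  have h_le: "h x \<le> s n x + c / 2 ^ n" if "x \<in> W" "\<And>i. n \<le> i \<Longrightarrow> H (z i) x \<le> c" for n x c
  proof (rule LIMSEQ_le_const2)
    show "(\<lambda>m. s m x + c * (1/2) ^ m) \<longlonglongrightarrow> h x"
      using tendsto_add[OF slim[OF that(1)] tendsto_mult_right_zero[OF LIMSEQ_power_zero[of "1/2::real"], of c]] by simp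
    show "\<exists>N. \<forall>m\<ge>N. s m x + c * (1 / 2) ^ m \<le> s n x + c / 2 ^ n"
      using tail[of n _ x c] that(2) by (intro exI[of _ n]) (auto simp: power_one_over)
  qed
  \<comment> \<open>The partial sums \<open>s n\<close> are upper semicontinuous and approach
    \<open>h\<close> uniformly, with error at most \<open>C / 2 ^ n\<close>.\<close>
  have usch: "usc_on W h"
  proof (rule usc_onI)
    fix x and d :: real assume "x \<in> W" "d > 0"
    have "(\<lambda>n. C * (1/2) ^ n) \<longlonglongrightarrow> 0" by (intro tendsto_mult_right_zero LIMSEQ_power_zero) auto
    then have "eventually (\<lambda>n. C * (1/2) ^ n < d / 2) sequentially"
      using \<open>d > 0\<close> by (intro order_tendstoD(2)) auto
    then obtain n where n: "C / 2 ^ n < d / 2"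
      by (auto simp: eventually_sequentially power_one_over)
    have "usc_on W (s n)" unfolding s_sum
    proof (rule usc_on_sum)
      fix i show "usc_on W (\<lambda>x. H (z i) x / 2 ^ Suc i)"
        using usc_on_cmult[OF usc[OF zB0[of i]], of "1 / 2 ^ Suc i"] by simp
    qed
    then obtain U where U: "open U" "x \<in> U" "\<forall>y\<in>U \<inter> W. s n y < s n x + d / 2"
      using usc_onD[OF _ \<open>x \<in> W\<close>, of "s n" "s n x + d / 2"] \<open>d > 0\<close> by auto
    have "h y \<le> h x + d" if "y \<in> U" "y \<in> W" for y
    proof -
      have "s n y < s n x + d / 2" using U(3) that by blast
      then show ?thesis
        using s_le_h[OF \<open>x \<in> W\<close>, of n] h_le[OF \<open>y \<in> W\<close> Hz(2)[OF \<open>y \<in> W\<close>], of n] n by linarith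
    qed
    then show "\<exists>U. open U \<and> x \<in> U \<and> (\<forall>y\<in>U \<inter> W. h y \<le> h x + d)" using U by blast
  qed
  obtain x where x: "x \<in> W" "\<And>y. y \<in> W \<Longrightarrow> h y \<le> h x" using usc_attains_sup[OF W usch] by blast
  \<comment> \<open>Going down from \<open>m\<close>, convexity merges \<open>z n\<close>, ...,
    \<open>z m\<close> into one point of \<open>B n\<close> that carries all of the weight
    \<open>1 / 2 ^ n\<close>. This makes the near-minimality of \<open>z n\<close> comparable with
    the full combination.\<close>
  have comb: "\<exists>\<zeta>\<in>B n. \<forall>x\<in>W. s n x + H \<zeta> x / 2 ^ n \<le> s m x + H (z m) x / 2 ^ m" if "n \<le> m" for n m
    using that
  proof (induction n rule: inc_induct)
    case base
    then show ?case using zB by blast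
  next
    case (step n)
    then obtain \<zeta> where \<zeta>: "\<zeta> \<in> B (Suc n)" "\<And>x. x \<in> W \<Longrightarrow> s (Suc n) x + H \<zeta> x / 2 ^ Suc n \<le> s m x + H (z m) x / 2 ^ m"
      by blast
    define \<xi> where "\<xi> = (1/2) *\<^sub>R z n + (1/2) *\<^sub>R \<zeta>"
    have \<zeta>n: "\<zeta> \<in> B n" using \<zeta> B(3) by blast
    then have "\<xi> \<in> B n" unfolding \<xi>_def using zB by (intro convexD[OF B(1)]) auto
    moreover have "s n x + H \<xi> x / 2 ^ n \<le> s m x + H (z m) x / 2 ^ m" if "x \<in> W" for x
    proof -
      have "H \<xi> x \<le> (1 - 1/2) * H (z n) x + (1/2) * H \<zeta> x"
        using convex_onD[OF conv[OF that], of "1/2" "z n" \<zeta>] zB0 \<zeta>n Bmono[of 0 n] by (auto simp: \<xi>_def)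
      then have "H \<xi> x / 2 ^ n \<le> (H (z n) x / 2 + H \<zeta> x / 2) / 2 ^ n"
        by (intro divide_right_mono) auto
      also have "\<dots> = H (z n) x / 2 ^ Suc n + H \<zeta> x / 2 ^ Suc n" by (simp add: add_divide_distrib)
      finally show ?thesis using \<zeta>(2)[OF that] by (simp add: sS)
    qed
    ultimately show ?case by blast
  qed
  have lim_C: "a \<le> b" if "\<And>m. m \<ge> n \<Longrightarrow> a \<le> b + C / 2 ^ m" for a b n
  proof (rule LIMSEQ_le_const)
    show "(\<lambda>m. b + C * (1/2) ^ m) \<longlonglongrightarrow> b"
      using tendsto_add[OF tendsto_const tendsto_mult_right_zero[OF LIMSEQ_power_zero[of "1/2::real"], of C]] by simp
    show "\<exists>N. \<forall>m\<ge>N. a \<le> b + C * (1/2) ^ m" using that by (intro exI[of _ n]) (auto simp: power_one_over)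
  qed
  have sm: "s m y + H (z m) y / 2 ^ m \<le> h x + C / 2 ^ m" if "y \<in> W" for m y
    using s_le_h[OF that, of m] x(2)[OF that] divide_right_mono[OF Hz(2)[OF that, of m], of "2 ^ m"] by simp
  have hx: "V + e \<le> h x"
  proof (rule lim_C)
    fix m :: nat
    obtain \<zeta> where \<zeta>: "\<zeta> \<in> B 0" "\<And>x. x \<in> W \<Longrightarrow> s 0 x + H \<zeta> x / 2 ^ 0 \<le> s m x + H (z m) x / 2 ^ m"
      using comb[of 0 m] by auto
    obtain y where "y \<in> W" "H \<zeta> y > V + e" using big[OF \<zeta>(1)] by auto
    then show "V + e \<le> h x + C / 2 ^ m" using \<zeta>(2)[of y] sm[of y m] by (simp add: s0)
  qed
  have step: "s n x + H (z n) x / 2 ^ n \<le> h x + e / 4 / 4 ^ n" for n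
  proof (rule lim_C)
    fix m assume "m \<ge> n"
    obtain \<zeta> where \<zeta>: "\<zeta> \<in> B n" "\<And>x. x \<in> W \<Longrightarrow> s n x + H \<zeta> x / 2 ^ n \<le> s m x + H (z m) x / 2 ^ m"
      using comb[OF \<open>m \<ge> n\<close>] by auto
    have "s n x + H (z n) x / 2 ^ n \<le> S (\<lambda>x. s n x + H (z n) x / 2 ^ n)"
      using bddS[OF bddH[OF _ zB] x(1)] sb by blast
    also have "\<dots> \<le> S (\<lambda>x. s n x + H \<zeta> x / 2 ^ n) + e / 4 / 4 ^ n"
      using sb[of n] \<zeta>(1) by (auto simp: good_def)
    also have "S (\<lambda>x. s n x + H \<zeta> x / 2 ^ n) \<le> h x + C / 2 ^ m"
      using \<zeta>(2) sm by (intro leS) (meson order_trans)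
    finally show "s n x + H (z n) x / 2 ^ n \<le> h x + e / 4 / 4 ^ n + C / 2 ^ m" by simp
  qed
  \<comment> \<open>\<open>2 ^ n * (h x - s n x)\<close> is the normalized tail from
    \<open>n\<close> on. Doubling it and removing \<open>H (z n) x\<close> gives the next one, and
    by \<open>step\<close> the removed value exceeds the tail by at most
    \<open>e / 4 / 2 ^ n\<close>.\<close>
  have low: "V + e - e / 2 * (1 - 1 / 2 ^ n) \<le> 2 ^ n * (h x - s n x)" for n
  proof (induction n)
    case 0 then show ?case using hx by (simp add: s0)
  next
    case (Suc n)
    have "H (z n) x \<le> 2 ^ n * (h x - s n x) + e / 4 / 2 ^ n"
    proof -
      have "(4::real) ^ n = 2 ^ n * 2 ^ n" by (simp flip: power_mult_distrib)
      then show ?thesis using mult_left_mono[OF step[of n], of "2 ^ n"] by (simp add: algebra_simps)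
    qed
    moreover have "2 ^ Suc n * (h x - s (Suc n) x) = 2 * (2 ^ n * (h x - s n x)) - H (z n) x"
      by (simp add: sS field_simps)
    moreover have "e / 2 * (1 - 1 / 2 ^ Suc n) = e / 2 * (1 - 1 / 2 ^ n) + e / 4 / 2 ^ n"
      by (simp add: field_simps)
    ultimately show ?case using Suc by linarith
  qed
  \<comment> \<open>At the maximizing point the hypothesis \<open>lim\<close> bounds all late values
    by \<open>V\<close>, hence also a late normalized tail, against \<open>low\<close>.\<close>
  obtain p where p: "\<And>z. z \<in> B p \<Longrightarrow> H z x \<le> V" using lim[OF x(1)] by blast
  have "h x \<le> s p x + V / 2 ^ p"
    using p zB Bmono by (intro h_le[OF x(1)]) blast
  then have "2 ^ p * (h x - s p x) \<le> V" by (simp add: field_simps)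
  moreover have "e / 2 * (1 - 1 / 2 ^ p) < e" 
  proof -
    have "e / 2 * (1 - 1 / 2 ^ p) = e / 2 - e / 2 * (1 / 2 ^ p)" by (simp only: right_diff_distrib mult_1_right)
    moreover have "0 \<le> e / 2 * (1 / 2 ^ p)" using \<open>e > 0\<close> by simp
    ultimately show ?thesis using \<open>e > 0\<close> by linarith
  qed
  ultimately show False using low[of p] by linarith
qed

section \<open>Oscillation strategies\<close>

text \<open>A maximal family whose finite intersections are infinite generates an ultrafilter.
  Asking for infinite instead of nonempty intersections puts every tail of the natural numbers into
  the family, so that \<open>U\<close> refines \<open>sequentially\<close>.\<close>

lemma free_ultrafilter_exists:
  obtains U :: "nat filter" where "U \<le> sequentially" "U \<noteq> bot"
    "\<And>P. eventually P U \<or> eventually (\<lambda>n. \<not> P n) U"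
proof -
  define \<A> where "\<A> = {F :: nat set set. \<forall>D\<subseteq>F. finite D \<longrightarrow> infinite (\<Inter>D)}"
  have "\<exists>M\<in>\<A>. \<forall>X\<in>\<A>. M \<subseteq> X \<longrightarrow> X = M"
  proof (rule subset_Zorn_nonempty)
    have "{} \<in> \<A>" by (auto simp: \<A>_def)
    then show "\<A> \<noteq> {}" by blast
  next
    fix C assume C: "C \<noteq> {}" "subset.chain \<A> C"
    show "\<Union>C \<in> \<A>" unfolding \<A>_def
    proof (intro CollectI allI impI)
      fix D assume D: "D \<subseteq> \<Union>C" "finite D"
      then obtain F where "F \<in> C" "D \<subseteq> F" using finite_subset_Union_chain[OF D(2,1) C] by metis
      moreover have "C \<subseteq> \<A>" using C(2) by (auto simp: subset_chain_def)
      ultimately show "infinite (\<Inter>D)" using D by (auto simp: \<A>_def)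
    qed
  qed
  then obtain M where M: "M \<in> \<A>" and max: "\<And>X. X \<in> \<A> \<Longrightarrow> M \<subseteq> X \<Longrightarrow> X = M" by blast
  have inf: "infinite (\<Inter>D)" if "D \<subseteq> M" "finite D" for D using M that by (auto simp: \<A>_def)
  have ins: "A \<in> M" if *: "\<And>D. D \<subseteq> M \<Longrightarrow> finite D \<Longrightarrow> infinite (A \<inter> \<Inter>D)" for A
  proof -
    have "insert A M \<in> \<A>" unfolding \<A>_def
    proof (intro CollectI allI impI)
      fix D assume "D \<subseteq> insert A M" "finite D"
      then have "infinite (A \<inter> \<Inter>(D - {A}))" by (intro *) auto
      moreover have "A \<inter> \<Inter>(D - {A}) \<subseteq> \<Inter>D" by auto
      ultimately show "infinite (\<Inter>D)" using infinite_super by blast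
    qed
    then show ?thesis using max by blast
  qed
  define U where "U = (INF A\<in>M. principal A)"
  have ev: "eventually (\<lambda>n. n \<in> A) U" if "A \<in> M" for A
    unfolding U_def using that by (intro eventually_INF1[of A]) (auto simp: eventually_principal)
  have ult: "A \<in> M \<or> - A \<in> M" for A
  proof (rule ccontr)
    assume "\<not> (A \<in> M \<or> - A \<in> M)"
    then obtain D E where D: "D \<subseteq> M" "finite D" "finite (A \<inter> \<Inter>D)" and E: "E \<subseteq> M" "finite E" "finite (- A \<inter> \<Inter>E)"
      using ins by meson
    have "infinite (\<Inter>(D \<union> E))" using D E by (intro inf) auto
    moreover have "\<Inter>(D \<union> E) \<subseteq> (A \<inter> \<Inter>D) \<union> (- A \<inter> \<Inter>E)" by auto
    ultimately show False using D E by (meson finite_UnI infinite_super)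
  qed
  show thesis
  proof
    show "U \<le> sequentially"
    proof (rule filter_leI)
      fix P :: "nat \<Rightarrow> bool" assume "eventually P sequentially"
      then obtain N where N: "\<And>n. n \<ge> N \<Longrightarrow> P n" by (auto simp: eventually_sequentially)
      have "{N..} \<in> M"
      proof (rule ins)
        fix D assume "D \<subseteq> M" "finite D"
        then have "infinite (\<Inter>D)" by (rule inf)
        then have "infinite (\<Inter>D - {..<N})" by (intro Diff_infinite_finite) auto
        moreover have "\<Inter>D - {..<N} \<subseteq> {N..} \<inter> \<Inter>D" by auto
        ultimately show "infinite ({N..} \<inter> \<Inter>D)" by (meson infinite_super)
      qed
      from ev[OF this] show "eventually P U" by (rule eventually_mono) (use N in auto)
    qed
    show "U \<noteq> bot"
    proof
      assume "U = bot"
      then have "eventually (\<lambda>n. False) U" by simp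
      then obtain X where X: "X \<subseteq> M" "finite X" "eventually (\<lambda>n. False) (INF A\<in>X. principal A)"
        unfolding U_def eventually_INF[of _ _ M] by blast
      then have "\<Inter>X = {}"
        using INF_principal_finite[OF X(2), of "\<lambda>A. A"] by (simp add: eventually_principal) blast
      then show False using inf[OF X(1,2)] by simp
    qed
    show "eventually P U \<or> eventually (\<lambda>n. \<not> P n) U" for P
      using ult[of "{n. P n}"] ev[of "{n. P n}"] ev[of "- {n. P n}"] by auto
  qed
qed

text \<open>A subsequence that serves infinitely many nodes at once: in each stage only finitely many
  nodes are active, so the next index can be chosen to suit all of them.\<close>

lemma fusion:
  fixes P :: "nat \<Rightarrow> 'n \<Rightarrow> nat \<Rightarrow> bool" and child :: "nat \<Rightarrow> 'n \<Rightarrow> nat \<Rightarrow> 'n" and F :: "nat filter"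
  assumes F: "F \<noteq> bot" "F \<le> sequentially"
    and step: "\<And>n T. good T \<Longrightarrow> eventually (\<lambda>l. P n T l \<and> good (child n T l)) F"
    and R: "\<And>j. good (R j)"
  obtains m :: "nat \<Rightarrow> nat" and p :: "nat \<Rightarrow> nat" and N :: "nat \<Rightarrow> 'n set"
  where "strict_mono m" "p 0 = 0" "\<And>j. p (Suc j) = Suc (m j)" "\<And>j. p j \<le> m j"
    "\<And>j. R j \<in> N j" "\<And>j. N j \<subseteq> N (Suc j)" "\<And>j T. T \<in> N j \<Longrightarrow> good T"
    "\<And>j T. T \<in> N j \<Longrightarrow> P (p j) T (m j)" "\<And>j T. T \<in> N j \<Longrightarrow> child (p j) T (m j) \<in> N (Suc j)"
proof -
  define ok where "ok s l \<longleftrightarrow> snd s \<le> l \<and> (\<forall>T\<in>fst s. P (snd s) T l \<and> good (child (snd s) T l))" for s l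
  define pick where "pick s = (SOME l. ok s l)" for s
  \<comment> \<open>Nodes are kept beside their children, so that a node may pause and move at any
    later index; one new root enters per stage, so that the set of active nodes stays
    finite.\<close>
  define nxt where "nxt j s = (fst s \<union> (\<lambda>T. child (snd s) T (pick s)) ` fst s \<union> {R (Suc j)}, Suc (pick s))" for j s
  define S where "S = rec_nat ({R 0}, 0) nxt"
  have S0: "S 0 = ({R 0}, 0)" and SS: "\<And>j. S (Suc j) = nxt j (S j)" by (simp_all add: S_def)
  have ex: "\<exists>l. ok s l" if "finite (fst s)" "\<forall>T\<in>fst s. good T" for s
  proof -
    have "eventually (\<lambda>l. \<forall>T\<in>fst s. P (snd s) T l \<and> good (child (snd s) T l)) F"
      using that step by (intro eventually_ball_finite) auto
    moreover have "eventually (\<lambda>l. snd s \<le> l) F"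
      using F(2) eventually_ge_at_top by (rule filter_leD)
    ultimately have "eventually (ok s) F" unfolding ok_def by eventually_elim auto
    then show ?thesis using F(1) eventually_happens' by blast
  qed
  have inv: "finite (fst (S j)) \<and> (\<forall>T\<in>fst (S j). good T) \<and> ok (S j) (pick (S j))" for j
  proof (induction j)
    case 0
    have "finite (fst (S 0)) \<and> (\<forall>T\<in>fst (S 0). good T)" by (simp add: S0 R)
    then show ?case unfolding pick_def using ex someI_ex by metis
  next
    case (Suc j)
    then have "finite (fst (S (Suc j))) \<and> (\<forall>T\<in>fst (S (Suc j)). good T)"
      by (auto simp: SS nxt_def R ok_def)
    then show ?case unfolding pick_def using ex someI_ex by metis
  qed
  define m where "m j = pick (S j)" for j
  define p where "p j = snd (S j)" for j
  have pm: "p (Suc j) = Suc (m j)" "p j \<le> m j" for j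
    using inv[of j] by (auto simp: p_def m_def SS nxt_def ok_def)
  show thesis
  proof (rule that[of m p "\<lambda>j. fst (S j)"])
    show "strict_mono m" using pm by (metis Suc_le_lessD strict_mono_Suc_iff)
    show "R j \<in> fst (S j)" for j by (cases j) (auto simp: S0 SS nxt_def)
    show "P (p j) T (m j)" if "T \<in> fst (S j)" for j T
      using inv[of j] that by (auto simp: p_def m_def ok_def)
    show "child (p j) T (m j) \<in> fst (S (Suc j))" if "T \<in> fst (S j)" for j T
      using that by (auto simp: p_def m_def SS nxt_def)
    show "fst (S j) \<subseteq> fst (S (Suc j))" for j by (auto simp: SS nxt_def)
  qed (use pm inv in \<open>auto simp: p_def S0\<close>)
qed

text \<open>A strategy is a well-founded record of how functionals can keep oscillating. At an \<open>Up\<close> node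
  there are, arbitrarily close to the functional of the node, functionals from which the strategy can
  be continued; at a \<open>Step\<close> node the move to the nearby functional in addition gains \<open>G\<close>. The
  first index of a branch measures closeness, the second one is the place of the move in the sequence.
  The datatype replaces a transfinite iteration of oscillations.\<close>

datatype 'w strategy =
    Leaf 'w
  | Up 'w "nat \<Rightarrow> nat \<Rightarrow> 'w strategy"
  | Step 'w "nat \<Rightarrow> nat \<Rightarrow> 'w strategy"

primrec origin :: "'w strategy \<Rightarrow> 'w" where
  "origin (Leaf f) = f"
| "origin (Up f c) = f"
| "origin (Step f c) = f"

text \<open>\<open>G l\<close> is the gain of a move played at index \<open>l\<close>, and \<nu> the
  closeness demanded of a gaining move. The latter is a parameter because in one application it must
  not involve \<open>l\<close>, while in the other it does.\<close>

locale oscillation =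
  fixes W :: "'w set" and near :: "nat \<Rightarrow> 'w \<Rightarrow> 'w \<Rightarrow> bool" and \<nu> :: "nat \<Rightarrow> nat \<Rightarrow> nat"
    and G :: "nat \<Rightarrow> 'w \<Rightarrow> 'w \<Rightarrow> real" and F :: "nat filter"
  assumes F_neq_bot: "F \<noteq> bot" and F_le: "F \<le> sequentially"
begin

text \<open>\<open>v\<close> is the total gain that the strategy still guarantees on each of its
  branches; it changes along the recursion, hence the functions on the right-hand sides.
  Continuations are demanded only for \<open>F\<close>-almost all indices.\<close>

primrec valid :: "'w strategy \<Rightarrow> real \<Rightarrow> bool" where
  "valid (Leaf f) = (\<lambda>v. f \<in> W \<and> v \<le> 0)"
| "valid (Up f c) = (\<lambda>v. f \<in> W \<and> (\<forall>n. eventually (\<lambda>l. near (n + l) f (origin (c n l)) \<and> valid (c n l) v) F))"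
| "valid (Step f c) = (\<lambda>v. f \<in> W \<and> (\<forall>n. eventually (\<lambda>l. near (\<nu> n l) f (origin (c n l)) \<and>
      0 \<le> G l f (origin (c n l)) \<and> valid (c n l) (v - G l f (origin (c n l)))) F))"

primrec link :: "'w strategy \<Rightarrow> nat \<Rightarrow> nat \<Rightarrow> bool" where
  "link (Leaf f) n l \<longleftrightarrow> True"
| "link (Up f c) n l \<longleftrightarrow> near (n + l) f (origin (c n l))"
| "link (Step f c) n l \<longleftrightarrow> near (\<nu> n l) f (origin (c n l)) \<and> 0 \<le> G l f (origin (c n l))"

text \<open>A leaf is its own child, so that the fusion can apply one rule to all active
  nodes.\<close>

primrec child_value :: "'w strategy \<Rightarrow> real \<Rightarrow> nat \<Rightarrow> nat \<Rightarrow> 'w strategy \<times> real" where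
  "child_value (Leaf f) v n l = (Leaf f, v)"
| "child_value (Up f c) v n l = (c n l, v)"
| "child_value (Step f c) v n l = (c n l, v - G l f (origin (c n l)))"

lemma valid_origin: "valid T v \<Longrightarrow> origin T \<in> W"
  by (cases T) auto

lemma valid_mono: "valid T v \<Longrightarrow> v' \<le> v \<Longrightarrow> valid T v'"
proof (induction T arbitrary: v v')
  case (Up f c)
  have "valid (c n l) v'" if "valid (c n l) v" for n l
    using Up.IH[of "c n" "c n l", OF _ _ that] Up.prems by auto
  then show ?case using Up.prems by (auto elim!: eventually_mono)
next
  case (Step f c)
  have "valid (c n l) (v' - a)" if "valid (c n l) (v - a)" for n l a
    using Step.IH[of "c n" "c n l", OF _ _ that] Step.prems by auto
  then show ?case using Step.prems by (auto elim!: eventually_mono)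
qed auto

lemma eventually_child:
  "valid T v \<Longrightarrow> eventually (\<lambda>l. link T n l \<and> case_prod valid (child_value T v n l)) F"
  by (cases T) (auto elim!: eventually_mono)

text \<open>Root \<open>j\<close> has value at least \<open>j\<close>, so one subsequence serves
  strategies of unbounded value. \<open>Z\<close> is a further condition on the index played; it
  will say that the functional of each active node has already settled along the sequence.\<close>

lemma fusion_strategies:
  assumes unbounded: "\<And>V. \<exists>T v. valid T v \<and> v \<ge> V"
    and Z: "\<And>n f. f \<in> W \<Longrightarrow> eventually (Z n f) F"
  obtains m p :: "nat \<Rightarrow> nat" and N :: "nat \<Rightarrow> ('w strategy \<times> real) set"
  where "strict_mono m" "\<And>j. j \<le> p j" "\<And>i j. i < j \<Longrightarrow> m i < p j"
    "\<And>V. \<exists>j T v. (T, v) \<in> N j \<and> v \<ge> V" "\<And>i j. i \<le> j \<Longrightarrow> N i \<subseteq> N j"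
    "\<And>j T v. (T, v) \<in> N j \<Longrightarrow> valid T v"
    "\<And>j T v. (T, v) \<in> N j \<Longrightarrow> link T (p j) (m j) \<and> Z (p j) (origin T) (m j)"
    "\<And>j T v. (T, v) \<in> N j \<Longrightarrow> child_value T v (p j) (m j) \<in> N (Suc j)"
proof -
  obtain R where R: "\<And>j. case_prod valid (R j)" "\<And>j. snd (R j) \<ge> real j"
  proof -
    have "\<exists>Tv. case_prod valid Tv \<and> snd Tv \<ge> real j" for j using unbounded[of "real j"] by auto
    then show thesis using that by metis
  qed
  have ev: "eventually (\<lambda>l. (link (fst Tv) n l \<and> Z n (origin (fst Tv)) l) \<and>
      case_prod valid (child_value (fst Tv) (snd Tv) n l)) F" if "case_prod valid Tv" for n Tv
  proof -
    have "valid (fst Tv) (snd Tv)" using that by (simp add: case_prod_beta)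
    from eventually_child[OF this, of n] Z[OF valid_origin[OF this], of n] show ?thesis
      by eventually_elim auto
  qed
  obtain m p N where *: "strict_mono m" "p 0 = 0" "\<And>j. p (Suc j) = Suc (m j)" "\<And>j. p j \<le> m j"
    "\<And>j. R j \<in> N j" "\<And>j. N j \<subseteq> N (Suc j)" "\<And>j T. T \<in> N j \<Longrightarrow> case_prod valid T"
    "\<And>j Tv. Tv \<in> N j \<Longrightarrow> link (fst Tv) (p j) (m j) \<and> Z (p j) (origin (fst Tv)) (m j)"
    "\<And>j Tv. Tv \<in> N j \<Longrightarrow> child_value (fst Tv) (snd Tv) (p j) (m j) \<in> N (Suc j)"
    by (rule fusion[OF F_neq_bot F_le, of "case_prod valid"
          "\<lambda>n Tv l. link (fst Tv) n l \<and> Z n (origin (fst Tv)) l"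
          "\<lambda>n Tv l. child_value (fst Tv) (snd Tv) n l" R, OF ev R(1)]) blast+
  show thesis
  proof (rule that[of m p N])
    show "j \<le> p j" for j
    proof (cases j)
      case (Suc i)
      then show ?thesis using *(3)[of i] strict_mono_imp_increasing[OF *(1), of i] by simp
    qed simp
    show "m i < p j" if "i < j" for i j
    proof -
      obtain k where k: "j = Suc k" "i \<le> k" using \<open>i < j\<close> by (cases j) auto
      then have "m i \<le> m k" using *(1) by (simp add: strict_mono_less_eq)
      then show ?thesis using k *(3) by simp
    qed
    show "\<exists>j T v. (T, v) \<in> N j \<and> v \<ge> V" for V
    proof -
      obtain j where "V \<le> real j" using real_arch_simple by blast
      then show ?thesis using *(5)[of j] R(2)[of j] by (metis order_trans prod.collapse)
    qed
    show "N i \<subseteq> N j" if "i \<le> j" for i j using *(6) that by (rule lift_Suc_mono_le)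
    show "valid T v" if "(T, v) \<in> N j" for j T v using *(7)[OF that] by simp
    show "link T (p j) (m j) \<and> Z (p j) (origin T) (m j)" if "(T, v) \<in> N j" for j T v using *(8)[OF that] by simp
    show "child_value T v (p j) (m j) \<in> N (Suc j)" if "(T, v) \<in> N j" for j T v using *(9)[OF that] by simp
  qed (rule *(1))
qed

text \<open>If the values of strategies are bounded, then \<open>\<phi>\<close> is a bounded upper semicontinuous
  potential that absorbs every further gain.\<close>

definition \<phi> :: "'w \<Rightarrow> real" where
  "\<phi> f = Sup {v. \<exists>T. origin T = f \<and> valid T v}"

context
  fixes V :: real
  assumes bounded: "\<forall>T v. valid T v \<longrightarrow> v \<le> V"
begin

lemma valid_le_\<phi>: "valid T v \<Longrightarrow> v \<le> \<phi> (origin T)"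
  unfolding \<phi>_def by (intro cSup_upper) (auto intro!: bdd_aboveI[of _ V] dest: bounded[rule_format])

lemma \<phi>_bounds: assumes "f \<in> W" shows "0 \<le> \<phi> f" "\<phi> f \<le> V"
proof -
  have "valid (Leaf f) 0" using assms by simp
  then show "0 \<le> \<phi> f" using valid_le_\<phi>[of "Leaf f" 0] by simp
  show "\<phi> f \<le> V" unfolding \<phi>_def using \<open>valid (Leaf f) 0\<close>
    by (intro cSup_least) (auto dest: bounded[rule_format] intro!: exI[of _ "Leaf f"] exI[of _ 0])
qed

lemma less_\<phi>: assumes "f \<in> W" "a < \<phi> f" obtains T where "origin T = f" "valid T a"
proof -
  have "valid (Leaf f) 0" using assms by simp
  then have ne: "{v. \<exists>T. origin T = f \<and> valid T v} \<noteq> {}" by (auto intro!: exI[of _ "Leaf f"] exI[of _ 0])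
  have "\<exists>v\<in>{v. \<exists>T. origin T = f \<and> valid T v}. a < v"
    by (rule less_cSupD[OF ne]) (use assms(2) in \<open>simp add: \<phi>_def\<close>)
  then obtain v T where "origin T = f" "valid T v" "a < v" by auto
  then show thesis using that[of T] valid_mono[of T v a] by auto
qed

text \<open>Otherwise every neighbourhood of \<open>f\<close> would contain the origin of a strategy
  worth \<open>\<phi> f + e\<close>, and an \<open>Up\<close> node over these would be a strategy at
  \<open>f\<close> that exceeds the supremum.\<close>

lemma \<phi>_up:
  assumes "f \<in> W" "e > 0"
  shows "\<exists>n. \<forall>g\<in>W. near n f g \<longrightarrow> \<phi> g \<le> \<phi> f + e"
proof (rule ccontr)
  assume "\<not> ?thesis"
  then have "\<exists>T. near n f (origin T) \<and> valid T (\<phi> f + e)" for n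
    using less_\<phi> by (metis not_le)
  then obtain c where c: "\<And>n. near n f (origin (c n)) \<and> valid (c n) (\<phi> f + e)" by metis
  then have "valid (Up f (\<lambda>n l. c (n + l))) (\<phi> f + e)" using assms by simp
  from valid_le_\<phi>[OF this] show False using \<open>e > 0\<close> by simp
qed

text \<open>Otherwise, at every closeness and for almost all indices, a gaining move would lead to a
  point whose potential plus the gain exceeds \<open>\<phi> f + e\<close>; a \<open>Step\<close>
  node would combine these moves into a strategy at \<open>f\<close> worth
  \<open>\<phi> f + e\<close>.\<close>

lemma \<phi>_step:
  assumes "f \<in> W" "e > 0"
  shows "\<exists>n. \<not> eventually (\<lambda>l. \<exists>g\<in>W. near (\<nu> n l) f g \<and> 0 \<le> G l f g \<and> \<phi> f + e < \<phi> g + G l f g) F"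
proof (rule ccontr)
  assume "\<not> ?thesis"
  then have *: "eventually (\<lambda>l. \<exists>g\<in>W. near (\<nu> n l) f g \<and> 0 \<le> G l f g \<and> \<phi> f + e < \<phi> g + G l f g) F" for n
    by blast
  define Q where "Q n l T \<longleftrightarrow> near (\<nu> n l) f (origin T) \<and> 0 \<le> G l f (origin T) \<and> valid T (\<phi> f + e - G l f (origin T))" for n l T
  define c where "c n l = (SOME T. Q n l T)" for n l
  have "eventually (\<lambda>l. Q n l (c n l)) F" for n
  proof (rule eventually_mono[OF *[of n]])
    fix l assume "\<exists>g\<in>W. near (\<nu> n l) f g \<and> 0 \<le> G l f g \<and> \<phi> f + e < \<phi> g + G l f g"
    then obtain g where g: "g \<in> W" "near (\<nu> n l) f g" "0 \<le> G l f g" "\<phi> f + e - G l f g < \<phi> g" by fastforce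
    obtain T where "origin T = g" "valid T (\<phi> f + e - G l f g)" using less_\<phi>[OF g(1,4)] by blast
    then have "Q n l T" using g by (simp add: Q_def)
    then show "Q n l (c n l)" unfolding c_def by (rule someI)
  qed
  then have "valid (Step f c) (\<phi> f + e)" using assms by (simp add: Q_def)
  from valid_le_\<phi>[OF this] show False using \<open>e > 0\<close> by simp
qed

end

end

section \<open>Copies of the space of null sequences\<close>

lemma closed_c0: "closed c0"
proof (unfold closed_sequential_limits, intro allI impI, elim conjE)
  fix a :: "nat \<Rightarrow> (nat \<Rightarrow>\<^sub>C real)" and b
  assume a: "\<forall>n. a n \<in> c0" and lim: "a \<longlonglongrightarrow> b"
  have "(\<lambda>i. apply_bcontfun b i) \<longlonglongrightarrow> 0"
  proof (rule LIMSEQ_I)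
    fix e :: real assume "e > 0"
    then obtain n where n: "dist (a n) b < e / 2"
      using lim by (metis half_gt_zero lim_sequentially order_refl)
    obtain N where N: "\<And>i. i \<ge> N \<Longrightarrow> norm (apply_bcontfun (a n) i) < e / 2"
      using a \<open>e > 0\<close> LIMSEQ_D[of "apply_bcontfun (a n)" 0 "e / 2"] by (auto simp: c0_def)
    have "norm (apply_bcontfun b i - 0) < e" if "i \<ge> N" for i
      using dist_bounded[of "a n" i b] N[OF that] n by (auto simp: dist_real_def)
    then show "\<exists>N. \<forall>i\<ge>N. norm (apply_bcontfun b i - 0) < e" by blast
  qed
  then show "b \<in> c0" by (simp add: c0_def)
qed

text \<open>The upper estimate makes the series over null sequences converge and \<open>T\<close>
  bounded. The lower one makes \<open>T\<close> bounded below, so that its inverse is continuous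
  and, \<open>c0\<close> being complete, its range is closed.\<close>

lemma contains_c0I:
  fixes u :: "nat \<Rightarrow> 'a::banach"
  assumes upper: "\<And>J a M. finite J \<Longrightarrow> 0 \<le> M \<Longrightarrow> (\<And>j. j \<in> J \<Longrightarrow> \<bar>a j\<bar> \<le> M) \<Longrightarrow> norm (\<Sum>j\<in>J. a j *\<^sub>R u j) \<le> C * M"
    and lower: "\<And>a k N. k < N \<Longrightarrow> c * \<bar>a k\<bar> \<le> norm (\<Sum>j<N. a j *\<^sub>R u j)" and "c > 0"
  shows "contains_c0 TYPE('a)"
proof -
  define T where "T a = (\<Sum>j. apply_bcontfun a j *\<^sub>R u j)" for a :: "nat \<Rightarrow>\<^sub>C real"
  have "C \<ge> 0" using upper[where J = "{}" and M = 1 and a = "\<lambda>_. 0"] by simp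
  have summ: "summable (\<lambda>j. apply_bcontfun a j *\<^sub>R u j)" if "a \<in> c0" for a
    unfolding summable_Cauchy
  proof (intro allI impI)
    fix e :: real assume "e > 0"
    then have e': "e / (C + 1) > 0" using \<open>C \<ge> 0\<close> by simp
    have "apply_bcontfun a \<longlonglongrightarrow> 0" using \<open>a \<in> c0\<close> by (simp add: c0_def)
    then have "\<exists>N. \<forall>i\<ge>N. norm (apply_bcontfun a i - 0) < e / (C + 1)" using e' by (rule LIMSEQ_D)
    then obtain N where N: "\<And>i. i \<ge> N \<Longrightarrow> norm (apply_bcontfun a i - 0) < e / (C + 1)" by blast
    have "norm (\<Sum>j\<in>{m..<n}. apply_bcontfun a j *\<^sub>R u j) < e" if "m \<ge> N" for m n
    proof -
      have "norm (\<Sum>j\<in>{m..<n}. apply_bcontfun a j *\<^sub>R u j) \<le> C * (e / (C + 1))"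
        using N that e' by (intro upper less_imp_le) auto
      also have "\<dots> < e" using \<open>C \<ge> 0\<close> \<open>e > 0\<close> by (simp add: field_simps)
      finally show ?thesis .
    qed
    then show "\<exists>N. \<forall>m\<ge>N. \<forall>n. norm (\<Sum>j\<in>{m..<n}. apply_bcontfun a j *\<^sub>R u j) < e" by blast
  qed
  have c0_add: "a + b \<in> c0" if "a \<in> c0" "b \<in> c0" for a b
    using that tendsto_add[of "apply_bcontfun a" 0 sequentially "apply_bcontfun b" 0] by (simp add: c0_def)
  have c0_scale: "r *\<^sub>R a \<in> c0" if "a \<in> c0" for a r
    using that tendsto_mult_right_zero[of "apply_bcontfun a" sequentially r] by (simp add: c0_def)
  have c0_diff: "a - b \<in> c0" if "a \<in> c0" "b \<in> c0" for a b
    using c0_add[OF that(1) c0_scale[OF that(2), of "-1"]] by simp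
  have T_add: "T (a + b) = T a + T b" if "a \<in> c0" "b \<in> c0" for a b
    unfolding T_def using suminf_add[OF summ[OF that(1)] summ[OF that(2)]] by (simp add: scaleR_add_left)
  have T_scale: "T (r *\<^sub>R a) = r *\<^sub>R T a" if "a \<in> c0" for a r
    unfolding T_def using suminf_scaleR_right[OF summ[OF that], of r] by simp
  have T_diff: "T (a - b) = T a - T b" if "a \<in> c0" "b \<in> c0" for a b
    using T_add[OF that(1) c0_scale[OF that(2), of "-1"]] T_scale[OF that(2), of "-1"] by simp
  have lim: "(\<lambda>N. \<Sum>j<N. apply_bcontfun a j *\<^sub>R u j) \<longlonglongrightarrow> T a" if "a \<in> c0" for a
    unfolding T_def using summ[OF that] by (rule summable_LIMSEQ)
  have T_upper: "norm (T a) \<le> C * norm a" if "a \<in> c0" for a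
  proof (rule LIMSEQ_le_const2[OF tendsto_norm[OF lim[OF that]]])
    show "\<exists>N. \<forall>n\<ge>N. norm (\<Sum>j<n. apply_bcontfun a j *\<^sub>R u j) \<le> C * norm a"
    proof (intro exI allI impI)
      fix n
      show "norm (\<Sum>j<n. apply_bcontfun a j *\<^sub>R u j) \<le> C * norm a"
        using norm_bounded[of a] by (intro upper) auto
    qed
  qed
  have T_lower: "norm a \<le> (1 / c) * norm (T a)" if "a \<in> c0" for a
  proof (rule norm_bound)
    fix k
    have "c * \<bar>apply_bcontfun a k\<bar> \<le> norm (T a)"
    proof (rule LIMSEQ_le_const[OF tendsto_norm[OF lim[OF that]]])
      show "\<exists>N. \<forall>n\<ge>N. c * \<bar>apply_bcontfun a k\<bar> \<le> norm (\<Sum>j<n. apply_bcontfun a j *\<^sub>R u j)"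
        using lower[of k] by (intro exI[of _ "Suc k"]) auto
    qed
    then show "norm (apply_bcontfun a k) \<le> (1 / c) * norm (T a)" using \<open>c > 0\<close> by (simp add: field_simps)
  qed
  have inj: "inj_on T c0"
  proof (rule inj_onI)
    fix a b assume "a \<in> c0" "b \<in> c0" "T a = T b"
    then have "norm (a - b) \<le> 0" using T_lower[OF c0_diff[of a b]] T_diff[of a b] by simp
    then show "a = b" by simp
  qed
  define g where "g = inv_into c0 T"
  have g: "g (T a) = a" if "a \<in> c0" for a unfolding g_def using inv_into_f_f[OF inj that] .
  have zero: "0 \<in> c0" by (simp add: c0_def)
  have "homeomorphism c0 (T ` c0) T g"
    unfolding homeomorphism_def
  proof (intro conjI ballI)
    show "continuous_on c0 T"
    proof (rule continuous_onI)
      fix a and e :: real assume "a \<in> c0" and "e > 0"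
      have "dist (T b) (T a) \<le> e" if "b \<in> c0" "dist b a < e / (C + 1)" for b
      proof -
        have "dist (T b) (T a) \<le> C * norm (b - a)"
          using T_upper[OF c0_diff[OF that(1) \<open>a \<in> c0\<close>]] T_diff[OF that(1) \<open>a \<in> c0\<close>] by (simp add: dist_norm)
        also have "\<dots> \<le> (C + 1) * norm (b - a)" by (intro mult_right_mono) auto
        also have "\<dots> \<le> e" using that(2) \<open>C \<ge> 0\<close> by (simp add: dist_norm field_simps)
        finally show ?thesis .
      qed
      then show "\<exists>d>0. \<forall>b\<in>c0. dist b a < d \<longrightarrow> dist (T b) (T a) \<le> e"
        using \<open>e > 0\<close> \<open>C \<ge> 0\<close> by (intro exI[of _ "e / (C + 1)"]) auto
    qed
    show "continuous_on (T ` c0) g"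
    proof (rule continuous_onI)
      fix x and e :: real assume "x \<in> T ` c0" and "e > 0"
      then obtain a where a: "a \<in> c0" "x = T a" by auto
      have "dist (g y) (g x) \<le> e" if "y \<in> T ` c0" "dist y x < c * e" for y
      proof -
        obtain b where b: "b \<in> c0" "y = T b" using \<open>y \<in> T ` c0\<close> by auto
        have "dist (g y) (g x) \<le> (1 / c) * dist y x"
          using T_lower[OF c0_diff[OF b(1) a(1)]] T_diff[OF b(1) a(1)] a b g by (simp add: dist_norm)
        also have "\<dots> \<le> e" using that(2) \<open>c > 0\<close> by (simp add: field_simps)
        finally show ?thesis .
      qed
      then show "\<exists>d>0. \<forall>y\<in>T ` c0. dist y x < d \<longrightarrow> dist (g y) (g x) \<le> e"
        using \<open>e > 0\<close> \<open>c > 0\<close> by (intro exI[of _ "c * e"]) auto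
    qed
  qed (use g in \<open>auto simp: image_iff\<close>)
  moreover have "subspace (T ` c0)"
  proof (rule subspaceI)
    have "T 0 = 0" using T_scale[OF zero, of 0] by simp
    then show "0 \<in> T ` c0" using zero by (metis image_eqI)
    show "x + y \<in> T ` c0" if "x \<in> T ` c0" "y \<in> T ` c0" for x y
    proof -
      obtain a b where "x = T a" "a \<in> c0" "y = T b" "b \<in> c0" using \<open>x \<in> T ` c0\<close> \<open>y \<in> T ` c0\<close> by blast
      then show ?thesis using T_add[of a b] c0_add[of a b] by (metis image_eqI)
    qed
    show "r *\<^sub>R x \<in> T ` c0" if "x \<in> T ` c0" for r x
    proof -
      obtain a where "x = T a" "a \<in> c0" using \<open>x \<in> T ` c0\<close> by blast
      then show ?thesis using T_scale[of a r] c0_scale[of a r] by (metis image_eqI)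
    qed
  qed
  moreover have "closed (T ` c0)"
  proof (unfold closed_sequential_limits, intro allI impI, elim conjE)
    fix x l assume x: "\<forall>n. x n \<in> T ` c0" and l: "x \<longlonglongrightarrow> l"
    have "\<forall>n. \<exists>a. a \<in> c0 \<and> x n = T a" using x by blast
    then obtain a where "\<forall>n. a n \<in> c0 \<and> x n = T (a n)" by (rule choice[THEN exE])
    then have a: "\<And>n. a n \<in> c0" "\<And>n. x n = T (a n)" by auto
    have "Cauchy a"
    proof (rule metric_CauchyI)
      fix e :: real assume "e > 0"
      obtain M where M: "\<And>m n. m \<ge> M \<Longrightarrow> n \<ge> M \<Longrightarrow> dist (x m) (x n) < c * e"
        using metric_CauchyD[OF LIMSEQ_imp_Cauchy[OF l], of "c * e"] \<open>e > 0\<close> \<open>c > 0\<close> by auto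
      have "dist (a m) (a n) < e" if "m \<ge> M" "n \<ge> M" for m n
      proof -
        have "dist (a m) (a n) \<le> (1 / c) * dist (x m) (x n)"
          using T_lower[OF c0_diff[OF a(1) a(1)]] T_diff[OF a(1) a(1)] a(2) by (simp add: dist_norm)
        also have "\<dots> < e" using M[OF that] \<open>c > 0\<close> by (simp add: field_simps)
        finally show ?thesis .
      qed
      then show "\<exists>M. \<forall>m\<ge>M. \<forall>n\<ge>M. dist (a m) (a n) < e" by blast
    qed
    then have "\<forall>e>0. \<exists>M. \<forall>m n x. M \<le> m \<and> M \<le> n \<longrightarrow> dist (apply_bcontfun (a m) x) (apply_bcontfun (a n) x) < e"
      unfolding Cauchy_def by (meson dist_fun_lt_imp_dist_val_lt)
    then obtain g where "uniform_limit UNIV (\<lambda>n. apply_bcontfun (a n)) g sequentially"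
      using uniformly_convergent_eq_cauchy[of "\<lambda>_. True" "\<lambda>n. apply_bcontfun (a n)"]
      by (auto simp: uniform_limit_sequentially_iff)
    from uniform_limit_bcontfunE[OF this sequentially_bot] obtain b where b: "a \<longlonglongrightarrow> b"
      by metis
    then have "b \<in> c0" using closed_c0[unfolded closed_sequential_limits] a(1) by blast
    have lim0: "(\<lambda>n. C * norm (a n - b)) \<longlonglongrightarrow> 0"
      using b by (intro tendsto_mult_right_zero) (simp add: LIM_zero tendsto_norm_zero)
    have bnd: "norm (x n - T b) \<le> C * norm (a n - b)" for n
      using T_upper[OF c0_diff[OF a(1) \<open>b \<in> c0\<close>], of n] T_diff[OF a(1) \<open>b \<in> c0\<close>, of n] a(2) by simp
    have "(\<lambda>n. x n - T b) \<longlonglongrightarrow> 0"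
      by (rule Lim_null_comparison[OF always_eventually[OF allI[OF bnd]] lim0])
    then have "x \<longlonglongrightarrow> T b" by (simp add: LIM_zero_iff)
    then show "l \<in> T ` c0" using LIMSEQ_unique[OF l] \<open>b \<in> c0\<close> by blast
  qed
  ultimately show ?thesis unfolding contains_c0_def isomorphic_subspaces_def
    using T_add T_scale by blast
qed

section \<open>Weakly unconditionally Cauchy series\<close>

lemma sum_half_powers: "(\<Sum>j<N. (1/2::real) ^ j) \<le> 2"
proof -
  have "(\<Sum>j<N. (1/2::real) ^ j) = 2 - 2 * (1/2) ^ N" by (induction N) auto
  then show ?thesis by simp
qed

text \<open>Bessaga-Pelczynski. Functionals \<open>F n\<close> norming \<open>w n\<close> cluster
  weak* at some \<open>f\<close>. Along a suitable subsequence the differences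
  \<open>F (r k) - f\<close> are almost biorthogonal to the vectors \<open>w (r j)\<close>, which
  gives the lower estimate of a \<open>c0\<close>-basis; the upper one is
  \<open>wuc\<close>.\<close>

lemma wuc_contains_c0:
  fixes w :: "nat \<Rightarrow> 'a::banach"
  assumes wuc: "\<And>f N. f \<in> dual_ball \<Longrightarrow> (\<Sum>n<N. \<bar>f (w n)\<bar>) \<le> C"
    and lower: "\<And>n. \<delta> \<le> norm (w n)" and "\<delta> > 0"
  shows "contains_c0 TYPE('a)"
proof -
  have "\<exists>f. f \<in> dual_ball \<and> f (w n) = norm (w n)" for n using norming_functional by metis
  then obtain F where F: "\<And>n. F n \<in> dual_ball" "\<And>n. F n (w n) = norm (w n)" by metis
  have "\<forall>\<^sub>F f in filtermap F sequentially. f \<in> dual_ball"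
    using F(1) by (simp add: eventually_filtermap)
  moreover have "filtermap F sequentially \<noteq> bot" by (simp add: filtermap_bot_iff)
  \<comment> \<open>Weak* compactness of the dual ball does not in general provide convergent
    subsequences, hence a cluster point of the filter.\<close>
  ultimately have "\<exists>f\<in>dual_ball. inf (nhds f) (filtermap F sequentially) \<noteq> bot"
    using compact_dual_ball[unfolded compact_filter, rule_format, of "filtermap F sequentially"]
    by (simp add: le_principal)
  then obtain f where f: "f \<in> dual_ball" "inf (nhds f) (filtermap F sequentially) \<noteq> bot"
    by blast
  have cluster: "\<exists>k\<ge>K. \<forall>j\<in>J. \<bar>F k (w j) - f (w j)\<bar> < e j" if "finite J" "\<And>j. e j > 0" for J K and e :: "nat \<Rightarrow> real"
  proof -
    have "open {g. \<bar>g (w j) - f (w j)\<bar> < e j}" for j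
      by (intro open_Collect_less continuous_intros continuous_on_eval)
    then have "eventually (\<lambda>g. \<forall>j\<in>J. \<bar>g (w j) - f (w j)\<bar> < e j) (nhds f)"
      using that by (intro eventually_ball_finite ballI)
        (auto simp: eventually_nhds intro!: exI[of _ "{g. \<bar>g (w _) - f (w _)\<bar> < e _}"])
    moreover have "eventually (\<lambda>g. \<exists>k\<ge>K. g = F k) (filtermap F sequentially)"
      unfolding eventually_filtermap eventually_sequentially by blast
    ultimately have "eventually (\<lambda>g. (\<forall>j\<in>J. \<bar>g (w j) - f (w j)\<bar> < e j) \<and> (\<exists>k\<ge>K. g = F k)) (inf (nhds f) (filtermap F sequentially))"
      unfolding eventually_inf by blast
    then show ?thesis using f(2) eventually_happens' by blast
  qed
  have null: "(\<lambda>n. g (w n)) \<longlonglongrightarrow> 0" if "g \<in> dual_ball" for g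
  proof -
    have "summable (\<lambda>n. \<bar>g (w n)\<bar>)" using wuc[OF that] by (intro summableI_nonneg_bounded) auto
    then show ?thesis using summable_LIMSEQ_zero tendsto_rabs_zero_iff by blast
  qed
  \<comment> \<open>With this choice the off-diagonal terms \<open>2 * \<eta> j\<close> sum to at
    most \<open>\<delta> / 4\<close>, half of the lower bound \<open>\<delta> / 2\<close> for the
    diagonal terms.\<close>
  define \<eta> where "\<eta> j = \<delta> / 16 * (1/2) ^ j" for j :: nat
  have \<eta>: "\<eta> j > 0" "\<eta> j \<le> \<delta> / 16" for j
    using \<open>\<delta> > 0\<close> power_le_one[of "1/2::real" j] by (auto simp: \<eta>_def)
  \<comment> \<open>The new functional \<open>F k\<close> copies \<open>f\<close> on the earlier
    vectors, and the new vector \<open>w k\<close> is nearly annihilated by \<open>f\<close> and by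
    the earlier functionals: the two halves of almost biorthogonality.\<close>
  define P where "P r j k \<longleftrightarrow> (\<forall>i<j. r i < k \<and> \<bar>F k (w (r i)) - f (w (r i))\<bar> < \<eta> i \<and> \<bar>F (r i) (w k)\<bar> < \<eta> j) \<and>
      \<bar>f (w k)\<bar> < \<eta> j" for r :: "nat \<Rightarrow> nat" and j k
  have "\<exists>r. \<forall>j. P r j (r j)"
  proof (rule dependent_wellorder_choice)
    show "P r j k = P r' j k" if "\<And>i. i < j \<Longrightarrow> r i = r' i" for k r r' j
      using that by (simp add: P_def)
    show "\<exists>k. P r j k" for j r
    proof -
      have "eventually (\<lambda>k. (\<forall>i\<in>{..<j}. \<bar>F (r i) (w k)\<bar> < \<eta> j) \<and> \<bar>f (w k)\<bar> < \<eta> j \<and> (\<forall>i\<in>{..<j}. r i < k)) sequentially"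
        using \<eta>(1)[of j]
        by (intro eventually_conj eventually_ball_finite ballI eventually_gt_at_top)
          (auto intro!: order_tendstoD(2)[OF tendsto_rabs_zero] null F(1) f(1))
      then obtain K where K: "\<And>k. k \<ge> K \<Longrightarrow> (\<forall>i\<in>{..<j}. \<bar>F (r i) (w k)\<bar> < \<eta> j) \<and> \<bar>f (w k)\<bar> < \<eta> j \<and> (\<forall>i\<in>{..<j}. r i < k)"
        by (auto simp: eventually_sequentially)
      \<comment> \<open>The tolerances \<open>\<eta> i\<close> belong to positions, while
        \<open>cluster\<close> is indexed by the vectors \<open>r i\<close>; the minimum over the
        positions serves them all.\<close>
      define e where "e n = Min (\<eta> ` {..j})" for n :: nat
      have e: "e n > 0" "i < j \<Longrightarrow> e n \<le> \<eta> i" for n i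
        using \<eta>(1) by (auto simp: e_def intro!: Min_le)
      obtain k where "k \<ge> K" "\<forall>n\<in>r ` {..<j}. \<bar>F k (w n) - f (w n)\<bar> < e n"
        using cluster[of "r ` {..<j}" e K] e(1) by auto
      then have "P r j k" using K[of k] e(2) unfolding P_def by (force intro: less_le_trans)
      then show ?thesis by blast
    qed
  qed
  then obtain r where r: "\<And>j. P r j (r j)" by blast
  have "strict_mono r" using r unfolding P_def strict_mono_def by blast
  define g where "g k x = F (r k) x - f x" for k x
  have g_lin: "linear (g k)" for k
    unfolding g_def using F(1) f(1) by (intro linear_compose_sub dual_ball_linear)
  have g_le: "\<bar>g k x\<bar> \<le> 2 * norm x" for k x
    using dual_ball_le[OF F(1)[of "r k"], of x] dual_ball_le[OF f(1), of x] by (simp add: g_def)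
  have g_off: "\<bar>g k (w (r j))\<bar> \<le> 2 * \<eta> j" if "j \<noteq> k" for j k
  proof (cases "j < k")
    case True
    then show ?thesis using r[of k] \<eta>(1)[of j] by (force simp: P_def g_def)
  next
    case False
    then have "k < j" using that by simp
    then have "\<bar>F (r k) (w (r j))\<bar> < \<eta> j" "\<bar>f (w (r j))\<bar> < \<eta> j" using r[of j] by (auto simp: P_def)
    then show ?thesis by (simp add: g_def)
  qed
  have g_diag: "g k (w (r k)) \<ge> \<delta> / 2" for k
  proof -
    have "\<bar>f (w (r k))\<bar> < \<eta> k" using r[of k] by (simp add: P_def)
    then show ?thesis using F(2)[of "r k"] lower[of "r k"] \<eta>(2)[of k] by (simp add: g_def)
  qed
  show ?thesis
  proof (rule contains_c0I[of "w \<circ> r" C "\<delta> / 8"])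
    fix J and a :: "nat \<Rightarrow> real" and M
    assume J: "finite J" and "0 \<le> M" and J2: "\<And>j. j \<in> J \<Longrightarrow> \<bar>a j\<bar> \<le> M"
    show "norm (\<Sum>j\<in>J. a j *\<^sub>R (w \<circ> r) j) \<le> C * M"
    proof (rule norm_le_dual_ball)
      fix h :: "'a \<Rightarrow> real" assume h: "h \<in> dual_ball"
      have "h (\<Sum>j\<in>J. a j *\<^sub>R (w \<circ> r) j) = (\<Sum>j\<in>J. a j * h (w (r j)))"
        using dual_ball_linear[OF h] by (simp add: linear_sum linear_cmul)
      also have "\<dots> \<le> (\<Sum>j\<in>J. M * \<bar>h (w (r j))\<bar>)"
      proof (rule sum_mono)
        fix j assume "j \<in> J"
        have "a j * h (w (r j)) \<le> \<bar>a j\<bar> * \<bar>h (w (r j))\<bar>" by (metis abs_ge_self abs_mult)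
        also have "\<dots> \<le> M * \<bar>h (w (r j))\<bar>" using J2[OF \<open>j \<in> J\<close>] by (rule mult_right_mono) simp
        finally show "a j * h (w (r j)) \<le> M * \<bar>h (w (r j))\<bar>" .
      qed
      also have "\<dots> = M * (\<Sum>n\<in>r ` J. \<bar>h (w n)\<bar>)"
        using strict_mono_imp_inj_on[OF \<open>strict_mono r\<close>] by (simp add: sum_distrib_left sum.reindex inj_on_subset)
      also have "\<dots> \<le> M * (\<Sum>n<Suc (Max (r ` J)). \<bar>h (w n)\<bar>)"
        using \<open>M \<ge> 0\<close> J by (intro mult_left_mono sum_mono2) (auto simp: less_Suc_eq_le)
      also have "\<dots> \<le> M * C" using \<open>M \<ge> 0\<close> wuc[OF h] by (rule mult_left_mono[rotated])
      finally show "h (\<Sum>j\<in>J. a j *\<^sub>R (w \<circ> r) j) \<le> C * M" by (simp add: mult.commute)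
    qed
  next
    fix a :: "nat \<Rightarrow> real" and k N :: nat
    assume "k < N"
    define x where "x = (\<Sum>j<N. a j *\<^sub>R (w \<circ> r) j)"
    \<comment> \<open>It suffices to test a coefficient of maximal modulus: there the diagonal term
      dominates all others together.\<close>
    define A where "A = Max ((\<lambda>j. \<bar>a j\<bar>) ` {..<N})"
    have "A \<in> (\<lambda>j. \<bar>a j\<bar>) ` {..<N}" unfolding A_def using \<open>k < N\<close> by (intro Max_in) auto
    then obtain i where i: "i < N" "A = \<bar>a i\<bar>" by blast
    have max: "\<bar>a j\<bar> \<le> \<bar>a i\<bar>" if "j < N" for j
      unfolding i(2)[symmetric] A_def using that by (intro Max_ge) auto
    have "g i x = (\<Sum>j<N. a j * g i (w (r j)))"
      using g_lin[of i] by (simp add: x_def linear_sum linear_cmul)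
    also have "\<dots> = a i * g i (w (r i)) + (\<Sum>j\<in>{..<N} - {i}. a j * g i (w (r j)))"
      using i(1) by (intro sum.remove) auto
    finally have eq: "g i x = a i * g i (w (r i)) + (\<Sum>j\<in>{..<N} - {i}. a j * g i (w (r j)))" .
    have "\<bar>\<Sum>j\<in>{..<N} - {i}. a j * g i (w (r j))\<bar> \<le> (\<Sum>j\<in>{..<N} - {i}. \<bar>a i\<bar> * (2 * \<eta> j))"
      using max g_off by (intro order_trans[OF sum_abs] sum_mono) (auto simp: abs_mult intro!: mult_mono)
    also have "\<dots> \<le> (\<Sum>j<N. \<bar>a i\<bar> * (2 * \<eta> j))" using \<eta>(1) by (intro sum_mono2) (auto simp: less_imp_le)
    also have "\<dots> = \<bar>a i\<bar> * (\<delta> / 8) * (\<Sum>j<N. (1/2) ^ j)" by (simp add: sum_distrib_left \<eta>_def algebra_simps)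
    also have "\<dots> \<le> \<bar>a i\<bar> * (\<delta> / 8) * 2" using \<open>\<delta> > 0\<close> sum_half_powers by (intro mult_left_mono) auto
    finally have "\<bar>\<Sum>j\<in>{..<N} - {i}. a j * g i (w (r j))\<bar> \<le> \<bar>a i\<bar> * (\<delta> / 8) * 2" .
    moreover have "\<bar>a i * g i (w (r i))\<bar> \<ge> \<bar>a i\<bar> * (\<delta> / 2)"
      unfolding abs_mult using g_diag[of i] by (intro mult_left_mono) auto
    ultimately have "\<bar>a i\<bar> * (\<delta> / 4) \<le> \<bar>g i x\<bar>" unfolding eq by linarith
    also have "\<dots> \<le> 2 * norm x" by (rule g_le)
    finally have "\<delta> / 8 * \<bar>a i\<bar> \<le> norm x" by (simp add: field_simps)
    moreover have "\<delta> / 8 * \<bar>a k\<bar> \<le> \<delta> / 8 * \<bar>a i\<bar>" using max[OF \<open>k < N\<close>] \<open>\<delta> > 0\<close> by (intro mult_left_mono) auto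
    ultimately show "\<delta> / 8 * \<bar>a k\<bar> \<le> norm (\<Sum>j<N. a j *\<^sub>R (w \<circ> r) j)" unfolding x_def by linarith
  qed (use \<open>\<delta> > 0\<close> in simp)
qed

section \<open>Weakly null sequences\<close>

lemma half_power_mono: "i \<le> j \<Longrightarrow> (1/2::real) ^ j \<le> (1/2) ^ i"
  by (intro power_decreasing) auto

text \<open>For the positions from \<open>k\<close> to \<open>j\<close> that are skipped between two
  moves: each carries a perturbation of order \<open>(1/2) ^ j\<close> from later moves and its own
  error of order \<open>(1/2) ^ i\<close>. There are \<open>j - k\<close> of the former, and
  \<open>(j - k) * (1/2) ^ (j - k)\<close> is at most 1.\<close>

lemma sum_half_powers_bound:
  assumes "k \<le> j" "0 \<le> c" "0 \<le> d"
  shows "(\<Sum>i=k..<j. c * (1/2::real) ^ j + d * (1/2) ^ i) \<le> (c + 2 * d) * (1/2) ^ k"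
proof -
  have "real (j - k) \<le> 2 ^ (j - k)" using of_nat_less_two_power[of "j - k"] by (simp add: less_imp_le)
  then have "real (j - k) * (1/2) ^ (j - k) \<le> 1" by (simp add: power_one_over field_simps)
  then have "c * (real (j - k) * (1/2) ^ (j - k)) * (1/2) ^ k \<le> c * 1 * (1/2) ^ k"
    using assms by (intro mult_right_mono mult_left_mono) auto
  moreover have "(1/2::real) ^ j = (1/2) ^ (j - k) * (1/2) ^ k" using assms(1) by (simp flip: power_add)
  ultimately have 1: "(\<Sum>i=k..<j. c * (1/2::real) ^ j) \<le> c * (1/2) ^ k" by (simp add: mult_ac)
  have "(\<Sum>i=k..<j. (1/2::real) ^ i) = 2 * (1/2) ^ k - 2 * (1/2) ^ j"
    using assms(1) by (induction j rule: dec_induct) auto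
  then have "(\<Sum>i=k..<j. (1/2::real) ^ i) \<le> 2 * (1/2) ^ k" by simp
  then have "d * (\<Sum>i=k..<j. (1/2::real) ^ i) \<le> d * (2 * (1/2) ^ k)" using assms by (intro mult_left_mono)
  with 1 show ?thesis by (simp add: sum.distrib sum_distrib_left distrib_right)
qed

text \<open>Weak* neighbourhoods tested on the given sequence only. Tying the tolerance to the
  number of vectors makes them decrease with \<open>n\<close>, so that one index measures
  closeness.\<close>

definition near_along :: "(nat \<Rightarrow> 'a) \<Rightarrow> nat \<Rightarrow> ('a \<Rightarrow> real) \<Rightarrow> ('a \<Rightarrow> real) \<Rightarrow> bool" where
  "near_along y n f g \<longleftrightarrow> (\<forall>i\<le>n. \<bar>g (y i) - f (y i)\<bar> < (1/2) ^ n)"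

lemma near_alongD: "near_along y n f g \<Longrightarrow> i \<le> n \<Longrightarrow> j \<le> n \<Longrightarrow> \<bar>g (y i) - f (y i)\<bar> \<le> (1/2) ^ j"
  unfolding near_along_def using half_power_mono[of j n] by (meson less_imp_le order_trans)

lemma open_near_along: "open {g. near_along y n f g}"
proof -
  have "{g. near_along y n f g} = (\<Inter>i\<in>{..n}. {g. \<bar>g (y i) - f (y i)\<bar> < (1/2) ^ n})"
    by (auto simp: near_along_def)
  moreover have "open {g. \<bar>g (y i) - f (y i)\<bar> < (1/2) ^ n}" for i
    by (intro open_Collect_less continuous_intros continuous_on_eval)
  ultimately show ?thesis by (auto intro!: open_INT)
qed

lemma near_along_mono: "near_along y n f g \<Longrightarrow> m \<le> n \<Longrightarrow> near_along y m f g"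
  unfolding near_along_def using half_power_mono[of m n] by (meson le_trans less_le_trans)

lemma near_along_refl: "near_along y n f f"
  by (simp add: near_along_def)

locale spikes =
  fixes y :: "nat \<Rightarrow> 'a::banach" and U :: "nat filter"
  assumes U: "U \<noteq> bot" "U \<le> sequentially"
    and null: "\<And>f. f \<in> dual_ball \<Longrightarrow> (\<lambda>n. f (y n)) \<longlonglongrightarrow> 0"
begin

text \<open>The closeness of a gaining move does not depend on \<open>l\<close>: closeness on
  \<open>y l\<close> itself would tie \<open>g (y l)\<close> to \<open>f (y l)\<close>, which tends
  to 0, and leave no gain.\<close>

sublocale oscillation dual_ball "near_along y" "\<lambda>n l. n" "\<lambda>l f g. g (y l)" U
  by unfold_locales (fact U)+

text \<open>Given coefficients not tending to 0, a strategy is played at places where the coefficients are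
  at least \<open>\<alpha>\<close>: the resulting functional is small off the places played, hence the partial sums
  are at least \<open>\<alpha>\<close> times the value of the strategy, up to a constant.\<close>

lemma unbounded_case:
  assumes unbounded: "\<And>V. \<exists>T v. valid T v \<and> v \<ge> V"
  shows "\<exists>m :: nat \<Rightarrow> nat. strict_mono m \<and> (\<forall>a. bounded (range (\<lambda>N. \<Sum>n<N. a n *\<^sub>R y (m n))) \<longrightarrow>
    bounded (range a) \<longrightarrow> a \<longlonglongrightarrow> 0)"
proof -
  \<comment> \<open>At the index chosen, the functional of every active node is already small on the
    whole rest of the sequence.\<close>
  define Z where "Z n f l \<longleftrightarrow> (\<forall>k\<ge>l. \<bar>f (y k)\<bar> \<le> (1/2) ^ n)" for n l and f :: "'a \<Rightarrow> real"
  have evZ: "eventually (Z n f) U" if "f \<in> dual_ball" for n f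
  proof -
    have "eventually (\<lambda>k. \<bar>f (y k)\<bar> < (1/2) ^ n) sequentially"
      by (rule order_tendstoD(2)[OF tendsto_rabs_zero[OF null[OF that]]]) simp
    then obtain K where "\<And>k. k \<ge> K \<Longrightarrow> \<bar>f (y k)\<bar> < (1/2) ^ n" by (auto simp: eventually_sequentially)
    then have "eventually (Z n f) sequentially"
      unfolding Z_def eventually_sequentially by (meson less_imp_le order_trans)
    then show ?thesis using U(2) filter_leD by blast
  qed
  obtain m p N where m: "strict_mono m" and p: "\<And>j. j \<le> p j" "\<And>i j. i < j \<Longrightarrow> m i < p j"
    and N_unbdd: "\<And>V. \<exists>j T v. (T, v) \<in> N j \<and> v \<ge> V"
    and N_mono: "\<And>i j. i \<le> j \<Longrightarrow> N i \<subseteq> N j"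
    and N_valid: "\<And>j T v. (T, v) \<in> N j \<Longrightarrow> valid T v"
    and N_link: "\<And>j T v. (T, v) \<in> N j \<Longrightarrow> link T (p j) (m j) \<and> Z (p j) (origin T) (m j)"
    and N_child: "\<And>j T v. (T, v) \<in> N j \<Longrightarrow> child_value T v (p j) (m j) \<in> N (Suc j)"
    by (rule fusion_strategies[where Z = Z, OF unbounded evZ]) (assumption, rule that)
  have small: "\<bar>origin T (y (m i))\<bar> \<le> (1/2) ^ i" if "(T, v) \<in> N k" "k \<le> i" for T v k i
  proof -
    have "(T, v) \<in> N i" using that N_mono by blast
    then have "\<bar>origin T (y (m i))\<bar> \<le> (1/2) ^ p i" using N_link[of T v i] by (auto simp: Z_def)
    then show ?thesis using half_power_mono[OF p(1)[of i]] by linarith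
  qed
  have key: False if a: "\<And>i. \<bar>a i\<bar> \<le> A" and \<alpha>: "\<alpha> > 0" "\<And>k. \<exists>j\<ge>k. a j \<ge> \<alpha>"
    and D: "\<And>n. norm (\<Sum>i<n. a i *\<^sub>R y (m i)) \<le> D" for a A \<alpha> D
  proof -
    have "A \<ge> 0" using a[of 0] by linarith
    \<comment> \<open>The factor 2 sums the perturbations \<open>(1/2) ^ k\<close>,
      \<open>(1/2) ^ Suc k\<close>, ... caused by all moves still to come. The budget
      \<open>10 * A\<close> consists of \<open>4 * A\<close> for the terms skipped, \<open>A\<close>
      for the perturbed term of a gaining move and \<open>5 * A\<close> for the rest of the branch,
      which starts at \<open>Suc k\<close> or later.\<close>
    have claim: "\<exists>n\<ge>k. \<exists>w\<in>dual_ball. (\<forall>i<k. \<bar>w (y (m i)) - origin T (y (m i))\<bar> \<le> 2 * (1/2) ^ k) \<and>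
        \<alpha> * v - 10 * A * (1/2) ^ k \<le> (\<Sum>i=k..<n. a i * w (y (m i)))" if "(T, v) \<in> N k" for T v k
      using that
    proof (induction T arbitrary: v k)
      case (Leaf f)
      then have "f \<in> dual_ball" "v \<le> 0" using N_valid[OF Leaf] by auto
      then have "\<alpha> * v \<le> 0" using \<alpha> by (simp add: mult_le_0_iff)
      moreover have "0 \<le> 10 * A * (1/2) ^ k" using \<open>A \<ge> 0\<close> by simp
      ultimately have "\<alpha> * v - 10 * A * (1/2) ^ k \<le> 0" by linarith
      then show ?case using \<open>f \<in> dual_ball\<close> by (intro exI[of _ k] conjI bexI[of _ f]) auto
    next
      case (Up f c)
      \<comment> \<open>An \<open>Up\<close> move is made at once. Its closeness covers
        \<open>y (m k)\<close>, where \<open>f\<close> is small, so the term at \<open>k\<close>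
        costs at most \<open>3 * A * (1/2) ^ k\<close>.\<close>
      define T' where "T' = c (p k) (m k)"
      define g where "g = origin T'"
      have "(T', v) \<in> N (Suc k)" using N_child[OF Up.prems] by (simp add: T'_def)
      then obtain n w where n: "n \<ge> Suc k" and w: "w \<in> dual_ball"
        "\<And>i. i < Suc k \<Longrightarrow> \<bar>w (y (m i)) - g (y (m i))\<bar> \<le> 2 * (1/2) ^ Suc k"
        "\<alpha> * v - 10 * A * (1/2) ^ Suc k \<le> (\<Sum>i=Suc k..<n. a i * w (y (m i)))"
        using Up.IH[of "c (p k)" T' v "Suc k"] unfolding T'_def g_def by blast
      have near: "near_along y (p k + m k) f g" using N_link[OF Up.prems] by (simp add: g_def T'_def)
      have wf: "\<bar>w (y (m i)) - f (y (m i))\<bar> \<le> 2 * (1/2) ^ k" if "i \<le> k" for i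
      proof -
        have "m i \<le> m k" using that m by (simp add: strict_mono_less_eq)
        then have "\<bar>g (y (m i)) - f (y (m i))\<bar> \<le> (1/2) ^ k"
          using p(1)[of k] by (intro near_alongD[OF near]) auto
        then show ?thesis using w(2)[of i] that by simp
      qed
      have "\<bar>w (y (m k))\<bar> \<le> 3 * (1/2) ^ k" using wf[of k] small[OF Up.prems, of k] by simp
      then have "\<bar>a k * w (y (m k))\<bar> \<le> A * (3 * (1/2) ^ k)" unfolding abs_mult using a \<open>A \<ge> 0\<close> by (intro mult_mono) auto
      moreover have "(\<Sum>i=k..<n. a i * w (y (m i))) = a k * w (y (m k)) + (\<Sum>i=Suc k..<n. a i * w (y (m i)))"
        using n by (intro sum.atLeast_Suc_lessThan) auto
      moreover have "0 \<le> A * (1/2) ^ k" using \<open>A \<ge> 0\<close> by simp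
      ultimately have "\<alpha> * v - 10 * A * (1/2) ^ k \<le> (\<Sum>i=k..<n. a i * w (y (m i)))"
        using w(3) by simp
      then show ?case using n w(1) wf by (intro exI[of _ n] conjI bexI[of _ w]) auto
    next
      case (Step f c)
      \<comment> \<open>A gaining move waits for a coefficient of at least \<alpha>. The node is
        still active then, and on the indices in between \<open>w\<close> is small because it is
        close to \<open>f\<close>.\<close>
      obtain j where j: "j \<ge> k" "a j \<ge> \<alpha>" using \<alpha>(2) by blast
      have Nj: "(Step f c, v) \<in> N j" using Step.prems N_mono[OF j(1)] by blast
      define T' where "T' = c (p j) (m j)"
      define g where "g = origin T'"
      define v' where "v' = v - g (y (m j))"
      have "(T', v') \<in> N (Suc j)" using N_child[OF Nj] by (simp add: T'_def g_def v'_def)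
      then obtain n w where n: "n \<ge> Suc j" and w: "w \<in> dual_ball"
        "\<And>i. i < Suc j \<Longrightarrow> \<bar>w (y (m i)) - g (y (m i))\<bar> \<le> 2 * (1/2) ^ Suc j"
        "\<alpha> * v' - 10 * A * (1/2) ^ Suc j \<le> (\<Sum>i=Suc j..<n. a i * w (y (m i)))"
        using Step.IH[of "c (p j)" T' v' "Suc j"] unfolding T'_def g_def by blast
      have near: "near_along y (p j) f g" and pos: "0 \<le> g (y (m j))"
        using N_link[OF Nj] by (simp_all add: g_def T'_def)
      have wf: "\<bar>w (y (m i)) - f (y (m i))\<bar> \<le> 2 * (1/2) ^ j" if "i < j" for i
      proof -
        have "\<bar>g (y (m i)) - f (y (m i))\<bar> \<le> (1/2) ^ j"
          using p(1)[of j] p(2)[OF that] by (intro near_alongD[OF near]) auto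
        then show ?thesis using w(2)[of i] that by simp
      qed
      have "\<bar>\<Sum>i=k..<j. a i * w (y (m i))\<bar> \<le> (\<Sum>i=k..<j. 2 * A * (1/2) ^ j + A * (1/2) ^ i)"
      proof (intro order_trans[OF sum_abs] sum_mono)
        fix i assume i: "i \<in> {k..<j}"
        have "\<bar>w (y (m i))\<bar> \<le> 2 * (1/2) ^ j + (1/2) ^ i"
          using wf[of i] small[OF Step.prems, of i] i by simp
        then have "\<bar>a i * w (y (m i))\<bar> \<le> A * (2 * (1/2) ^ j + (1/2) ^ i)"
          unfolding abs_mult using a \<open>A \<ge> 0\<close> by (intro mult_mono) auto
        then show "\<bar>a i * w (y (m i))\<bar> \<le> 2 * A * (1/2) ^ j + A * (1/2) ^ i" by (simp add: algebra_simps)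
      qed
      also have "\<dots> \<le> (2 * A + 2 * A) * (1/2) ^ k" using j(1) \<open>A \<ge> 0\<close> by (intro sum_half_powers_bound) auto
      finally have 1: "\<bar>\<Sum>i=k..<j. a i * w (y (m i))\<bar> \<le> 4 * A * (1/2) ^ k" by simp
      have "\<alpha> * g (y (m j)) \<le> a j * g (y (m j))" using j(2) pos by (rule mult_right_mono)
      moreover have "\<bar>a j * (w (y (m j)) - g (y (m j)))\<bar> \<le> A * (1/2) ^ j"
        unfolding abs_mult using a \<open>A \<ge> 0\<close> w(2)[of j] by (intro mult_mono) auto
      ultimately have 2: "\<alpha> * g (y (m j)) - A * (1/2) ^ j \<le> a j * w (y (m j))"
        by (simp add: right_diff_distrib)
      have "(\<Sum>i=k..<n. a i * w (y (m i))) = (\<Sum>i=k..<j. a i * w (y (m i))) + (\<Sum>i=j..<n. a i * w (y (m i)))"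
        using j(1) n by (simp add: sum.atLeastLessThan_concat)
      also have "(\<Sum>i=j..<n. a i * w (y (m i))) = a j * w (y (m j)) + (\<Sum>i=Suc j..<n. a i * w (y (m i)))"
        using n by (intro sum.atLeast_Suc_lessThan) auto
      finally have 3: "(\<Sum>i=k..<n. a i * w (y (m i))) = (\<Sum>i=k..<j. a i * w (y (m i))) +
          (a j * w (y (m j)) + (\<Sum>i=Suc j..<n. a i * w (y (m i))))" .
      have 4: "A * (1/2) ^ j \<le> A * (1/2) ^ k" using half_power_mono[OF j(1)] \<open>A \<ge> 0\<close> by (rule mult_left_mono)
      have 5: "\<alpha> * v' = \<alpha> * v - \<alpha> * g (y (m j))" by (simp add: v'_def right_diff_distrib)
      have "0 \<le> A * (1/2) ^ k" using \<open>A \<ge> 0\<close> by simp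
      then have "\<alpha> * v - 10 * A * (1/2) ^ k \<le> (\<Sum>i=k..<n. a i * w (y (m i)))"
        using 1 2 3 4 5 w(3) by simp
      moreover have "\<bar>w (y (m i)) - f (y (m i))\<bar> \<le> 2 * (1/2) ^ k" if "i < k" for i
        using wf[of i] that j(1) half_power_mono[OF j(1)] by linarith
      ultimately show ?case using n j(1) w(1) by (intro exI[of _ n] conjI bexI[of _ w]) auto
    qed
    obtain k T v where T: "(T, v) \<in> N k" "v \<ge> (2 * D + 10 * A + 1) / \<alpha>" using N_unbdd by blast
    obtain n w where n: "n \<ge> k" and w: "w \<in> dual_ball"
      "\<alpha> * v - 10 * A * (1/2) ^ k \<le> (\<Sum>i=k..<n. a i * w (y (m i)))" using claim[OF T(1)] by blast
    have "(\<Sum>i=k..<n. a i * w (y (m i))) = w ((\<Sum>i<n. a i *\<^sub>R y (m i)) - (\<Sum>i<k. a i *\<^sub>R y (m i)))"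
      using n dual_ball_linear[OF w(1)]
      by (simp add: linear_diff linear_sum linear_cmul lessThan_atLeast0 sum_diff_nat_ivl)
    also have "\<dots> \<le> norm ((\<Sum>i<n. a i *\<^sub>R y (m i)) - (\<Sum>i<k. a i *\<^sub>R y (m i)))"
      using dual_ball_le[OF w(1)] abs_le_D1 by blast
    also have "\<dots> \<le> D + D" using D by (intro order_trans[OF norm_triangle_ineq4] add_mono)
    finally have "\<alpha> * v - 10 * A * (1/2) ^ k \<le> 2 * D" using w(2) by simp
    moreover have "A * (1/2) ^ k \<le> A * 1" using \<open>A \<ge> 0\<close> by (intro mult_left_mono power_le_one) auto
    moreover have "2 * D + 10 * A + 1 \<le> \<alpha> * v" using T(2) \<alpha>(1) by (simp add: field_simps)
    ultimately show False by linarith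
  qed
  have "a \<longlonglongrightarrow> 0" if a: "bounded (range (\<lambda>N. \<Sum>n<N. a n *\<^sub>R y (m n)))" "bounded (range a)" for a
  proof (rule ccontr)
    assume "\<not> a \<longlonglongrightarrow> 0"
    then obtain \<alpha> where \<alpha>: "\<alpha> > 0" "\<And>k. \<exists>j\<ge>k. \<bar>a j\<bar> \<ge> \<alpha>"
      by (auto simp: lim_sequentially not_less)
    obtain A where A: "\<And>i. \<bar>a i\<bar> \<le> A" using a(2) by (auto simp: bounded_iff)
    obtain D where D: "\<And>n. norm (\<Sum>i<n. a i *\<^sub>R y (m i)) \<le> D" using a(1) by (auto simp: bounded_iff)
    show False
    \<comment> \<open>If the modulus is large infinitely often, then \<open>a\<close> or
      \<open>- a\<close> is.\<close>
    proof (cases "\<forall>k. \<exists>j\<ge>k. a j \<ge> \<alpha>")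
      case True
      then show False using key[of a A \<alpha> D] A \<alpha>(1) D by blast
    next
      case False
      then obtain K where "\<forall>j\<ge>K. \<not> \<alpha> \<le> a j" by blast
      then have K: "\<And>j. j \<ge> K \<Longrightarrow> a j < \<alpha>" by force
      have "\<exists>j\<ge>k. - a j \<ge> \<alpha>" for k
      proof -
        obtain j where "j \<ge> max k K" "\<bar>a j\<bar> \<ge> \<alpha>" using \<alpha>(2) by blast
        then show ?thesis using K[of j] by (intro exI[of _ j]) auto
      qed
      moreover have "norm (\<Sum>i<n. - a i *\<^sub>R y (m i)) \<le> D" for n using D[of n] by (simp add: sum_negf)
      ultimately show False using key[of "\<lambda>i. - a i" A \<alpha> D] A \<alpha>(1) by simp
    qed
  qed
  then show ?thesis using m by blast
qed

text \<open>The positive parts of \<open>f\<close> on the chosen vectors plus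
  \<open>\<phi> f\<close> stay below \<open>V + 1\<close> uniformly on the dual ball: the potential
  pays for each new positive part. As the ball is symmetric, bounding the positive parts bounds the
  absolute values.\<close>

lemma bounded_case:
  assumes bounded: "\<forall>T v. valid T v \<longrightarrow> v \<le> V"
    and ultra: "\<And>P. eventually P U \<or> eventually (\<lambda>n. \<not> P n) U"
  shows "\<exists>r :: nat \<Rightarrow> nat. strict_mono r \<and> (\<forall>f\<in>dual_ball. \<forall>N. (\<Sum>n<N. \<bar>f (y (r n))\<bar>) \<le> 2 * (V + 1))"
proof -
  \<comment> \<open>The ultrafilter turns the failure of eventual gains in
    \<open>\<phi>_step\<close> into the eventual absence of gains, so that finitely many
    neighbourhoods can be handled at a common index.\<close>
  have nbhd: "\<exists>n. eventually (\<lambda>l. \<forall>g\<in>dual_ball. near_along y n f g \<longrightarrow> \<phi> g + max 0 (g (y l)) \<le> \<phi> f + e) U"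
    if "f \<in> dual_ball" "e > 0" for f e
  proof -
    obtain n1 where n1: "\<forall>g\<in>dual_ball. near_along y n1 f g \<longrightarrow> \<phi> g \<le> \<phi> f + e"
      using \<phi>_up[OF bounded \<open>f \<in> dual_ball\<close> \<open>e > 0\<close>] by blast
    obtain n2 where "\<not> eventually (\<lambda>l. \<exists>g\<in>dual_ball. near_along y n2 f g \<and> 0 \<le> g (y l) \<and> \<phi> f + e < \<phi> g + g (y l)) U"
      using \<phi>_step[OF bounded \<open>f \<in> dual_ball\<close> \<open>e > 0\<close>] by blast
    then have "eventually (\<lambda>l. \<not> (\<exists>g\<in>dual_ball. near_along y n2 f g \<and> 0 \<le> g (y l) \<and> \<phi> f + e < \<phi> g + g (y l))) U"
      using ultra by blast
    then have "eventually (\<lambda>l. \<forall>g\<in>dual_ball. near_along y (max n1 n2) f g \<longrightarrow> \<phi> g + max 0 (g (y l)) \<le> \<phi> f + e) U"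
    proof (rule eventually_mono, intro ballI impI)
      fix l g
      assume l: "\<not> (\<exists>g\<in>dual_ball. near_along y n2 f g \<and> 0 \<le> g (y l) \<and> \<phi> f + e < \<phi> g + g (y l))"
        and g: "g \<in> dual_ball" "near_along y (max n1 n2) f g"
      have "near_along y n1 f g" "near_along y n2 f g" using g(2) by (auto elim: near_along_mono)
      then show "\<phi> g + max 0 (g (y l)) \<le> \<phi> f + e" using n1 l g(1) by (auto simp: max_def not_less)
    qed
    then show ?thesis by blast
  qed
  have next_spike: "\<exists>l\<ge>l0. \<forall>f\<in>dual_ball. E f + max 0 (f (y l)) + \<phi> f \<le> b + e"
    if E: "continuous_on UNIV E" and b: "\<And>f. f \<in> dual_ball \<Longrightarrow> E f + \<phi> f \<le> b" and "e > 0" for E b e l0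
  proof -
    have "e / 2 > 0" using \<open>e > 0\<close> by simp
    then have "\<forall>f. \<exists>n. f \<in> dual_ball \<longrightarrow> eventually (\<lambda>l. \<forall>g\<in>dual_ball.
        near_along y n f g \<longrightarrow> \<phi> g + max 0 (g (y l)) \<le> \<phi> f + e / 2) U"
      using nbhd[OF _ \<open>e / 2 > 0\<close>] by blast
    then obtain n where n: "\<forall>f. f \<in> dual_ball \<longrightarrow> eventually (\<lambda>l. \<forall>g\<in>dual_ball.
        near_along y (n f) f g \<longrightarrow> \<phi> g + max 0 (g (y l)) \<le> \<phi> f + e / 2) U"
      by (rule choice[THEN exE])
    \<comment> \<open>On \<open>Q f\<close> the accumulated sum \<open>E\<close> exceeds its value
      at \<open>f\<close> by less than \<open>e / 2\<close>, by continuity, and the potential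
      together with the new positive part exceeds \<open>\<phi> f\<close> by at most
      \<open>e / 2\<close>, by the choice of \<open>n f\<close>.\<close>
    define Q where "Q f = {g. near_along y (n f) f g} \<inter> {g. E g < E f + e / 2}" for f
    have opQ: "open (Q f)" for f unfolding Q_def
      by (intro open_Int open_near_along open_Collect_less E continuous_on_const)
    have "dual_ball \<subseteq> (\<Union>f\<in>dual_ball. Q f)"
      using \<open>e / 2 > 0\<close> by (auto simp: Q_def near_along_refl)
    then obtain D where D: "D \<subseteq> dual_ball" "finite D" "dual_ball \<subseteq> (\<Union>f\<in>D. Q f)"
      by (rule compactE_image[OF compact_dual_ball opQ])
    have "eventually (\<lambda>l. \<forall>f\<in>D. \<forall>g\<in>dual_ball. near_along y (n f) f g \<longrightarrow> \<phi> g + max 0 (g (y l)) \<le> \<phi> f + e / 2) U"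
      using D(1,2) n by (intro eventually_ball_finite) auto
    moreover have "eventually (\<lambda>l. l0 \<le> l) U" using U(2) eventually_ge_at_top by (rule filter_leD)
    ultimately have "eventually (\<lambda>l. (\<forall>f\<in>D. \<forall>g\<in>dual_ball. near_along y (n f) f g \<longrightarrow>
        \<phi> g + max 0 (g (y l)) \<le> \<phi> f + e / 2) \<and> l0 \<le> l) U"
      by (rule eventually_conj)
    then obtain l where l: "l0 \<le> l" "\<And>f g. f \<in> D \<Longrightarrow> g \<in> dual_ball \<Longrightarrow> near_along y (n f) f g \<Longrightarrow>
        \<phi> g + max 0 (g (y l)) \<le> \<phi> f + e / 2"
      using eventually_happens'[OF U(1)] by blast
    have "E g + max 0 (g (y l)) + \<phi> g \<le> b + e" if g: "g \<in> dual_ball" for g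
    proof -
      obtain f where f: "f \<in> D" "g \<in> Q f" using D(3) g by blast
      then have "\<phi> g + max 0 (g (y l)) \<le> \<phi> f + e / 2" "E g < E f + e / 2"
        using l(2)[OF f(1) g] by (auto simp: Q_def)
      moreover have "E f + \<phi> f \<le> b" using b f(1) D(1) by blast
      ultimately show ?thesis by linarith
    qed
    then show ?thesis using l(1) by blast
  qed
  define E where "E L f = (\<Sum>i\<in>L. max 0 (f (y i)))" for L :: "nat set" and f :: "'a \<Rightarrow> real"
  have cont: "continuous_on UNIV (E L)" for L
    unfolding E_def by (intro continuous_on_sum continuous_on_max continuous_on_const continuous_on_eval)
  \<comment> \<open>The allowance grows by \<open>(1/2) ^ Suc k\<close> from stage \<open>k\<close>
    to the next and so never exceeds \<open>V + 1\<close>.\<close>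
  define P where "P k L \<longleftrightarrow> finite L \<and> (\<forall>f\<in>dual_ball. E L f + \<phi> f \<le> V + (1 - (1/2) ^ k))" for k L
  have "\<exists>L. \<forall>k. P k (L k) \<and> (\<exists>l. (\<forall>i\<in>L k. i < l) \<and> L (Suc k) = insert l (L k))"
  proof (rule dependent_nat_choice)
    show "\<exists>L. P 0 L" using \<phi>_bounds(2)[OF bounded] by (intro exI[of _ "{}"]) (auto simp: P_def E_def)
  next
    fix L k assume L: "P k L"
    obtain l0 where l0: "\<And>i. i \<in> L \<Longrightarrow> i < l0"
      using L finite_nat_set_iff_bounded[of L] by (auto simp: P_def)
    obtain l where l: "l0 \<le> l" "\<forall>f\<in>dual_ball. E L f + max 0 (f (y l)) + \<phi> f \<le> V + (1 - (1/2) ^ k) + (1/2) ^ Suc k"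
      using next_spike[OF cont[of L], of "V + (1 - (1/2) ^ k)" "(1/2) ^ Suc k" l0] L by (auto simp: P_def)
    have less: "\<forall>i\<in>L. i < l" using l0 l(1) by force
    then have "l \<notin> L" by blast
    then have "E (insert l L) f = max 0 (f (y l)) + E L f" for f using L by (simp add: E_def P_def)
    then have "P (Suc k) (insert l L)" using L l(2) by (auto simp: P_def algebra_simps)
    then show "\<exists>L'. P (Suc k) L' \<and> (\<exists>l. (\<forall>i\<in>L. i < l) \<and> L' = insert l L)" using less by blast
  qed
  then obtain L where L: "\<And>k. P k (L k)" "\<And>k. \<exists>l. (\<forall>i\<in>L k. i < l) \<and> L (Suc k) = insert l (L k)" by blast
  then obtain l where l: "\<And>k. (\<forall>i\<in>L k. i < l k) \<and> L (Suc k) = insert (l k) (L k)" by metis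
  have "strict_mono l" unfolding strict_mono_Suc_iff using l by (metis insertI1)
  have sub: "l ` {..<k} \<subseteq> L k" for k by (induction k) (use l in \<open>auto simp: lessThan_Suc\<close>)
  have pos: "(\<Sum>n<N. max 0 (f (y (l n)))) \<le> V + 1" if "f \<in> dual_ball" for f N
  proof -
    have "(\<Sum>n<N. max 0 (f (y (l n)))) = E (l ` {..<N}) f"
      using strict_mono_imp_inj_on[OF \<open>strict_mono l\<close>] by (simp add: E_def sum.reindex inj_on_subset)
    also have "\<dots> \<le> E (L N) f" unfolding E_def using L(1)[of N] sub by (intro sum_mono2) (auto simp: P_def)
    also have "\<dots> \<le> V + (1 - (1/2) ^ N)"
      using L(1)[of N] \<phi>_bounds(1)[OF bounded that] that by (force simp: P_def)
    also have "\<dots> \<le> V + 1" by simp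
    finally show ?thesis .
  qed
  have "(\<Sum>n<N. \<bar>f (y (l n))\<bar>) \<le> 2 * (V + 1)" if "f \<in> dual_ball" for f N
  proof -
    have "(\<Sum>n<N. \<bar>f (y (l n))\<bar>) = (\<Sum>n<N. max 0 (f (y (l n)))) + (\<Sum>n<N. max 0 (- f (y (l n))))"
      by (simp flip: sum.distrib add: max_def) (intro sum.cong, auto)
    then show ?thesis using pos[OF that, of N] pos[OF dual_ball_uminus[OF that], of N] by simp
  qed
  then show ?thesis using \<open>strict_mono l\<close> by blast
qed

end

theorem weakly_null_subsequence:
  fixes y :: "nat \<Rightarrow> 'a::banach"
  assumes null: "\<And>f. f \<in> dual_ball \<Longrightarrow> (\<lambda>n. f (y n)) \<longlonglongrightarrow> 0"
    and lower: "\<And>n. \<delta> \<le> norm (y n)" "\<delta> > 0" and c0: "\<not> contains_c0 TYPE('a)"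
  shows "\<exists>m :: nat \<Rightarrow> nat. strict_mono m \<and> (\<forall>a. bounded (range (\<lambda>N. \<Sum>n<N. a n *\<^sub>R y (m n))) \<longrightarrow>
    bounded (range a) \<longrightarrow> a \<longlonglongrightarrow> 0)"
proof -
  obtain U :: "nat filter" where Uf: "U \<le> sequentially" "U \<noteq> bot" "\<And>P. eventually P U \<or> eventually (\<lambda>n. \<not> P n) U"
    using free_ultrafilter_exists by metis
  interpret spikes y U by unfold_locales (use Uf null in auto)
  show ?thesis
  proof (cases "\<exists>V. \<forall>T v. valid T v \<longrightarrow> v \<le> V")
    case True
    then obtain V where "\<forall>T v. valid T v \<longrightarrow> v \<le> V" by blast
    then obtain r :: "nat \<Rightarrow> nat" where "\<forall>f\<in>dual_ball. \<forall>N. (\<Sum>n<N. \<bar>f (y (r n))\<bar>) \<le> 2 * (V + 1)"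
      using bounded_case Uf(3) by blast
    then have "contains_c0 TYPE('a)"
      using lower by (intro wuc_contains_c0[of "\<lambda>n. y (r n)" "2 * (V + 1)" \<delta>]) auto
    then show ?thesis using c0 by blast
  next
    case False
    then have "\<exists>T v. valid T v \<and> v \<ge> V" for V by (meson linear)
    then show ?thesis by (rule unbounded_case)
  qed
qed

section \<open>Weakly Cauchy sequences\<close>

text \<open>\<open>lam\<close> is the limit of the sequence in the bidual, known through its values
  on the dual ball.\<close>

locale steps =
  fixes y :: "nat \<Rightarrow> 'a::banach" and lam :: "('a \<Rightarrow> real) \<Rightarrow> real" and C :: real
  assumes norm_y: "\<And>n. norm (y n) \<le> C"
    and lam: "\<And>f. f \<in> dual_ball \<Longrightarrow> (\<lambda>n. f (y n)) \<longlonglongrightarrow> lam f"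
begin

text \<open>Here the gain is a difference of limits, which survives closeness on any initial
  segment. Hence even gaining moves can preserve the values up to \<open>y l\<close>; only later
  vectors feel the move.\<close>

sublocale oscillation dual_ball "near_along y" "\<lambda>n l. n + l" "\<lambda>l f g. lam f - lam g" sequentially
  by unfold_locales auto

lemma abs_y_le: "f \<in> dual_ball \<Longrightarrow> \<bar>f (y n)\<bar> \<le> C"
  using dual_ball_le[of f "y n"] norm_y[of n] by linarith

lemma abs_lam_le: "f \<in> dual_ball \<Longrightarrow> \<bar>lam f\<bar> \<le> C"
  using tendsto_rabs[OF lam, of f] abs_y_le[of f]
  by (intro LIMSEQ_le_const2[of "\<lambda>n. \<bar>f (y n)\<bar>"]) auto

text \<open>After subtracting a limit point, \<open>t\<close> is near 0 infinitely often and at least \<open>\<gamma>\<close> infinitely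
  often. \<open>Up\<close> moves are played where it is near 0, so that they cost nothing, and \<open>Step\<close> moves
  where it is at least \<open>\<gamma>\<close>.\<close>

lemma unbounded_case:
  assumes unbounded: "\<And>V. \<exists>T v. valid T v \<and> v \<ge> V"
  shows "\<exists>m :: nat \<Rightarrow> nat. strict_mono m \<and> (\<forall>t. bounded (range t) \<longrightarrow>
    bounded (range (\<lambda>N. \<Sum>i<N. t i *\<^sub>R (y (m i) - y (m (Suc i))))) \<longrightarrow> convergent t)"
proof -
  define Z where "Z n f l \<longleftrightarrow> (\<forall>k\<ge>l. \<bar>f (y k) - lam f\<bar> \<le> (1/2) ^ n)" for n l and f :: "'a \<Rightarrow> real"
  have evZ: "eventually (Z n f) sequentially" if "f \<in> dual_ball" for n f
  proof -
    have "(\<lambda>k. f (y k) - lam f) \<longlonglongrightarrow> 0" using lam[OF that] by (rule LIM_zero)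
    then have "eventually (\<lambda>k. \<bar>f (y k) - lam f\<bar> < (1/2) ^ n) sequentially"
      by (intro order_tendstoD(2)[OF tendsto_rabs_zero]) auto
    then obtain K where "\<And>k. k \<ge> K \<Longrightarrow> \<bar>f (y k) - lam f\<bar> < (1/2) ^ n" by (auto simp: eventually_sequentially)
    then show "eventually (Z n f) sequentially"
      unfolding Z_def eventually_sequentially by (meson less_imp_le order_trans)
  qed
  obtain m p N where m: "strict_mono m" and p: "\<And>j. j \<le> p j" "\<And>i j. i < j \<Longrightarrow> m i < p j"
    and N_unbdd: "\<And>V. \<exists>j T v. (T, v) \<in> N j \<and> v \<ge> V"
    and N_mono: "\<And>i j. i \<le> j \<Longrightarrow> N i \<subseteq> N j"
    and N_valid: "\<And>j T v. (T, v) \<in> N j \<Longrightarrow> valid T v"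
    and N_link: "\<And>j T v. (T, v) \<in> N j \<Longrightarrow> link T (p j) (m j) \<and> Z (p j) (origin T) (m j)"
    and N_child: "\<And>j T v. (T, v) \<in> N j \<Longrightarrow> child_value T v (p j) (m j) \<in> N (Suc j)"
    by (rule fusion_strategies[where Z = Z, OF unbounded evZ]) (assumption, rule that)
  have close: "\<bar>origin T (y (m i)) - lam (origin T)\<bar> \<le> (1/2) ^ j" if "(T, v) \<in> N k" "k \<le> j" "j \<le> i" for T v k i j
  proof -
    have "(T, v) \<in> N j" using that N_mono by blast
    moreover have "m j \<le> m i" using that m by (simp add: strict_mono_less_eq)
    ultimately have "\<bar>origin T (y (m i)) - lam (origin T)\<bar> \<le> (1/2) ^ p j" using N_link[of T v j] by (auto simp: Z_def)
    then show ?thesis using half_power_mono[OF p(1)[of j]] by linarith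
  qed
  have "C \<ge> 0" using norm_y[of 0] norm_ge_zero[of "y 0"] by linarith
  have key: False if \<tau>: "\<And>i. \<bar>\<tau> i\<bar> \<le> A" and \<gamma>: "\<gamma> > 0" "\<And>k. \<exists>j\<ge>k. \<tau> j \<ge> \<gamma>"
    and small: "\<And>k e. e > 0 \<Longrightarrow> \<exists>j\<ge>k. \<bar>\<tau> j\<bar> \<le> e"
    and D: "\<And>n. norm (\<Sum>i<n. \<tau> i *\<^sub>R (y (m i) - y (m (Suc i)))) \<le> D" for \<tau> A \<gamma> D
  proof -
    have "A \<ge> 0" using \<tau>[of 0] by linarith
    \<comment> \<open>Budget of a move: \<open>8 * A\<close> for the terms skipped,
      \<open>5 * A\<close> for the error of the term played, \<open>2 * C\<close> for the loss
      allowed to an \<open>Up\<close> move, and half of \<open>B\<close>, that is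
      \<open>13 * A + 2 * C\<close>, for the rest of the branch.\<close>
    define B where "B = 26 * A + 4 * C"
    define S where "S w k n = (\<Sum>i=k..<n. \<tau> i * (w (y (m i)) - w (y (m (Suc i)))))" for w k n
    define Cl where "Cl T v k \<longleftrightarrow> (\<exists>n\<ge>k. \<exists>w\<in>dual_ball. (\<forall>i\<le>k. \<bar>w (y (m i)) - origin T (y (m i))\<bar> \<le> 2 * (1/2) ^ k) \<and>
        \<gamma> * v - B * (1/2) ^ k \<le> S w k n)" for T v k
    \<comment> \<open>One move at \<open>j\<close>, in a form common to both kinds of nodes:
      \<open>gain\<close> asks the term at \<open>j\<close> to earn \<gamma> times the decrease of
      the value, up to \<open>2 * C * (1/2) ^ k\<close>.\<close>
    have advance: "Cl T v k"
      if T: "(T, v) \<in> N k" and j: "k \<le> j" and IH: "Cl T' v' (Suc j)"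
        and near: "near_along y (p j + m j) (origin T) (origin T')" and T': "(T', v') \<in> N (Suc j)"
        and gain: "\<gamma> * (v - v') - 2 * C * (1/2) ^ k \<le> \<tau> j * (lam (origin T) - lam (origin T'))" for T v k j T' v'
    proof -
      define f where "f = origin T"
      define g where "g = origin T'"
      obtain n w where n: "n \<ge> Suc j" and w: "w \<in> dual_ball"
        "\<And>i. i \<le> Suc j \<Longrightarrow> \<bar>w (y (m i)) - g (y (m i))\<bar> \<le> 2 * (1/2) ^ Suc j"
        "\<gamma> * v' - B * (1/2) ^ Suc j \<le> S w (Suc j) n"
        using IH unfolding Cl_def g_def by blast
      have wf: "\<bar>w (y (m i)) - f (y (m i))\<bar> \<le> 2 * (1/2) ^ j" if "i \<le> j" for i
      proof -
        have "m i \<le> m j" using that m by (simp add: strict_mono_less_eq)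
        then have "\<bar>g (y (m i)) - f (y (m i))\<bar> \<le> (1/2) ^ j"
          unfolding f_def g_def using p(1)[of j] by (intro near_alongD[OF near]) auto
        then show ?thesis using w(2)[of i] that by simp
      qed
      have "\<bar>S w k j\<bar> \<le> (\<Sum>i=k..<j. 4 * A * (1/2) ^ j + 2 * A * (1/2) ^ i)"
        unfolding S_def
      proof (intro order_trans[OF sum_abs] sum_mono)
        fix i assume i: "i \<in> {k..<j}"
        have "\<bar>f (y (m i)) - lam f\<bar> \<le> (1/2) ^ i" "\<bar>f (y (m (Suc i))) - lam f\<bar> \<le> (1/2) ^ i"
          using close[OF T, of i] i by (auto simp: f_def)
        then have "\<bar>w (y (m i)) - w (y (m (Suc i)))\<bar> \<le> 4 * (1/2) ^ j + 2 * (1/2) ^ i"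
          using wf[of i] wf[of "Suc i"] i by auto
        then have "\<bar>\<tau> i * (w (y (m i)) - w (y (m (Suc i))))\<bar> \<le> A * (4 * (1/2) ^ j + 2 * (1/2) ^ i)"
          unfolding abs_mult using \<tau> \<open>A \<ge> 0\<close> by (intro mult_mono) auto
        then show "\<bar>\<tau> i * (w (y (m i)) - w (y (m (Suc i))))\<bar> \<le> 4 * A * (1/2) ^ j + 2 * A * (1/2) ^ i"
          by (simp add: algebra_simps)
      qed
      also have "\<dots> \<le> (4 * A + 2 * (2 * A)) * (1/2) ^ k" using j \<open>A \<ge> 0\<close> by (intro sum_half_powers_bound) auto
      finally have 1: "\<bar>S w k j\<bar> \<le> 8 * A * (1/2) ^ k" by simp
      \<comment> \<open>The move takes effect between \<open>y (m j)\<close>, where \<open>w\<close>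
        is still close to \<open>lam f\<close>, and \<open>y (m (Suc j))\<close>, where it is
        already close to \<open>lam g\<close>; so the difference of the two values is about
        \<open>lam f - lam g\<close>.\<close>
      have "\<bar>f (y (m j)) - lam f\<bar> \<le> (1/2) ^ j" using close[OF T j] by (auto simp: f_def)
      moreover have "\<bar>g (y (m (Suc j))) - lam g\<bar> \<le> (1/2) ^ Suc j" using close[OF T', of "Suc j"] by (auto simp: g_def)
      moreover have "\<bar>w (y (m (Suc j))) - g (y (m (Suc j)))\<bar> \<le> 2 * (1/2) ^ Suc j" by (rule w(2)) simp
      moreover have "(0::real) \<le> (1/2) ^ j" by simp
      ultimately have "\<bar>(w (y (m j)) - w (y (m (Suc j)))) - (lam f - lam g)\<bar> \<le> 5 * (1/2) ^ j"
        using wf[OF order_refl] unfolding power_Suc by linarith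
      then have "\<bar>\<tau> j * ((w (y (m j)) - w (y (m (Suc j)))) - (lam f - lam g))\<bar> \<le> A * (5 * (1/2) ^ j)"
        unfolding abs_mult using \<tau> \<open>A \<ge> 0\<close> by (intro mult_mono) auto
      also have "\<dots> \<le> A * (5 * (1/2) ^ k)" using half_power_mono[OF j] \<open>A \<ge> 0\<close> by (intro mult_left_mono) auto
      finally have 2: "\<tau> j * (lam f - lam g) - 5 * A * (1/2) ^ k \<le> \<tau> j * (w (y (m j)) - w (y (m (Suc j))))"
        by (simp add: right_diff_distrib)
      have "S w k n = S w k j + S w j n" unfolding S_def using j n by (simp add: sum.atLeastLessThan_concat)
      also have "S w j n = \<tau> j * (w (y (m j)) - w (y (m (Suc j)))) + S w (Suc j) n"
        unfolding S_def using n by (intro sum.atLeast_Suc_lessThan) auto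
      finally have 3: "S w k n = S w k j + (\<tau> j * (w (y (m j)) - w (y (m (Suc j)))) + S w (Suc j) n)" .
      have "B * (1/2) ^ Suc j \<le> B * (1/2) ^ Suc k"
        using half_power_mono[of "Suc k" "Suc j"] j \<open>A \<ge> 0\<close> \<open>C \<ge> 0\<close> by (intro mult_left_mono) (auto simp: B_def)
      then have 4: "B * (1/2) ^ Suc j \<le> 13 * A * (1/2) ^ k + 2 * C * (1/2) ^ k"
        by (simp add: B_def algebra_simps)
      have 5: "B * (1/2) ^ k = 26 * A * (1/2) ^ k + 4 * C * (1/2) ^ k" by (simp add: B_def algebra_simps)
      have 6: "\<gamma> * (v - v') = \<gamma> * v - \<gamma> * v'" by (simp add: right_diff_distrib)
      have "\<gamma> * v - B * (1/2) ^ k \<le> S w k n"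
        using 1 2 3 4 5 6 w(3) gain[folded f_def g_def] by linarith
      moreover have "\<bar>w (y (m i)) - f (y (m i))\<bar> \<le> 2 * (1/2) ^ k" if "i \<le> k" for i
        using wf[of i] that j half_power_mono[OF j] by linarith
      ultimately show "Cl T v k" unfolding Cl_def f_def[symmetric]
        using n j w(1) by (intro exI[of _ n] conjI bexI[of _ w]) auto
    qed
    have claim: "Cl T v k" if "(T, v) \<in> N k" for T v k
      using that
    proof (induction T arbitrary: v k)
      case (Leaf f)
      then have "f \<in> dual_ball" "v \<le> 0" using N_valid[OF Leaf] by auto
      then have "\<gamma> * v \<le> 0" using \<gamma> by (simp add: mult_le_0_iff)
      moreover have "0 \<le> B * (1/2) ^ k" using \<open>A \<ge> 0\<close> \<open>C \<ge> 0\<close> by (simp add: B_def)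
      ultimately have "\<gamma> * v - B * (1/2) ^ k \<le> 0" by linarith
      then show ?case unfolding Cl_def S_def using \<open>f \<in> dual_ball\<close>
        by (intro exI[of _ k] conjI bexI[of _ f]) auto
    next
      case (Up f c)
      \<comment> \<open>An \<open>Up\<close> move may change \<open>lam\<close> by up to
        \<open>2 * C\<close> in either direction, so it waits for a coefficient of modulus at most
        \<open>(1/2) ^ k\<close>.\<close>
      obtain j where j: "j \<ge> k" "\<bar>\<tau> j\<bar> \<le> (1/2) ^ k" using small[of "(1/2) ^ k" k] by auto
      have Nj: "(Up f c, v) \<in> N j" using Up.prems N_mono[OF j(1)] by blast
      define T' where "T' = c (p j) (m j)"
      have T': "(T', v) \<in> N (Suc j)" using N_child[OF Nj] by (simp add: T'_def)
      have mem: "f \<in> dual_ball" "origin T' \<in> dual_ball"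
        using valid_origin[OF N_valid[OF Nj]] valid_origin[OF N_valid[OF T']] by auto
      have "\<bar>lam f - lam (origin T')\<bar> \<le> 2 * C" using abs_lam_le[OF mem(1)] abs_lam_le[OF mem(2)] by linarith
      then have "\<bar>\<tau> j * (lam f - lam (origin T'))\<bar> \<le> (1/2) ^ k * (2 * C)"
        unfolding abs_mult using j(2) by (intro mult_mono) auto
      then have "\<gamma> * (v - v) - 2 * C * (1/2) ^ k \<le> \<tau> j * (lam (origin (Up f c)) - lam (origin T'))"
        by (simp add: mult.commute)
      moreover have "near_along y (p j + m j) (origin (Up f c)) (origin T')" using N_link[OF Nj] by (simp add: T'_def)
      moreover have "Cl T' v (Suc j)" using Up.IH[of "c (p j)" T' v "Suc j"] T' unfolding T'_def by blast
      ultimately show ?case using advance[OF Up.prems j(1)] T' by blast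
    next
      case (Step f c)
      obtain j where j: "j \<ge> k" "\<tau> j \<ge> \<gamma>" using \<gamma>(2) by blast
      have Nj: "(Step f c, v) \<in> N j" using Step.prems N_mono[OF j(1)] by blast
      define T' where "T' = c (p j) (m j)"
      define v' where "v' = v - (lam f - lam (origin T'))"
      have T': "(T', v') \<in> N (Suc j)" using N_child[OF Nj] by (simp add: T'_def v'_def)
      have "near_along y (p j + m j) f (origin T')" and pos: "0 \<le> lam f - lam (origin T')"
        using N_link[OF Nj] by (simp_all add: T'_def)
      have "\<gamma> * (lam f - lam (origin T')) \<le> \<tau> j * (lam f - lam (origin T'))" using j(2) pos by (rule mult_right_mono)
      moreover have "0 \<le> 2 * C * (1/2) ^ k" using \<open>C \<ge> 0\<close> by simp
      moreover have "v - v' = lam f - lam (origin T')" by (simp add: v'_def)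
      ultimately have "\<gamma> * (v - v') - 2 * C * (1/2) ^ k \<le> \<tau> j * (lam (origin (Step f c)) - lam (origin T'))"
        by simp
      moreover have "near_along y (p j + m j) (origin (Step f c)) (origin T')" by simp fact
      moreover have "Cl T' v' (Suc j)" using Step.IH[of "c (p j)" T' v' "Suc j"] T' unfolding T'_def by blast
      ultimately show ?case using advance[OF Step.prems j(1)] T' by blast
    qed
    obtain k T v where T: "(T, v) \<in> N k" "v \<ge> (2 * D + B + 1) / \<gamma>" using N_unbdd by blast
    obtain n w where n: "n \<ge> k" and w: "w \<in> dual_ball" "\<gamma> * v - B * (1/2) ^ k \<le> S w k n"
      using claim[OF T(1)] unfolding Cl_def by blast
    define s where "s n = (\<Sum>i<n. \<tau> i *\<^sub>R (y (m i) - y (m (Suc i))))" for n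
    have "S w k n = w (s n - s k)"
      using n dual_ball_linear[OF w(1)] unfolding S_def s_def
      by (simp add: linear_diff linear_sum linear_cmul lessThan_atLeast0 sum_diff_nat_ivl)
    also have "\<dots> \<le> norm (s n - s k)"
      using dual_ball_le[OF w(1)] abs_le_D1 by blast
    also have "\<dots> \<le> D + D" using D unfolding s_def by (intro order_trans[OF norm_triangle_ineq4] add_mono)
    finally have "\<gamma> * v - B * (1/2) ^ k \<le> 2 * D" using w(2) by simp
    moreover have "B * (1/2) ^ k \<le> B * 1"
      using \<open>A \<ge> 0\<close> \<open>C \<ge> 0\<close> by (intro mult_left_mono power_le_one) (auto simp: B_def)
    moreover have "2 * D + B + 1 \<le> \<gamma> * v" using T(2) \<gamma>(1) by (simp add: field_simps)
    ultimately show False by linarith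
  qed
  have "convergent t" if t: "bounded (range t)"
    "bounded (range (\<lambda>N. \<Sum>i<N. t i *\<^sub>R (y (m i) - y (m (Suc i)))))" for t
  proof (rule ccontr)
    assume "\<not> convergent t"
    obtain \<alpha> and q :: "nat \<Rightarrow> nat" where q: "strict_mono q" "(t \<circ> q) \<longlonglongrightarrow> \<alpha>"
      using bounded_imp_convergent_subsequence[OF t(1)] by blast
    have "\<not> t \<longlonglongrightarrow> \<alpha>" using \<open>\<not> convergent t\<close> by (auto simp: convergent_def)
    then obtain \<gamma> where \<gamma>: "\<gamma> > 0" "\<And>k. \<exists>j\<ge>k. \<bar>t j - \<alpha>\<bar> \<ge> \<gamma>"
      by (auto simp: lim_sequentially not_less dist_real_def)
    have small: "\<exists>j\<ge>k. \<bar>t j - \<alpha>\<bar> \<le> e" if "e > 0" for k e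
    proof -
      obtain M where "\<And>j. j \<ge> M \<Longrightarrow> \<bar>t (q j) - \<alpha>\<bar> < e"
        using q(2) \<open>e > 0\<close> by (auto simp: lim_sequentially dist_real_def)
      moreover have "q (max k M) \<ge> k" using strict_mono_imp_increasing[OF q(1), of "max k M"] by simp
      ultimately show ?thesis by (intro exI[of _ "q (max k M)"]) (auto simp: less_imp_le)
    qed
    obtain A where A: "\<And>i. \<bar>t i\<bar> \<le> A" using t(1) by (auto simp: bounded_iff)
    obtain D where D: "\<And>n. norm (\<Sum>i<n. t i *\<^sub>R (y (m i) - y (m (Suc i)))) \<le> D" using t(2) by (auto simp: bounded_iff)
    \<comment> \<open>The differences telescope, so subtracting a constant from the coefficients
      keeps the partial sums bounded.\<close>
    have sum_eq: "(\<Sum>i<n. (t i - \<alpha>) *\<^sub>R (y (m i) - y (m (Suc i)))) =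
        (\<Sum>i<n. t i *\<^sub>R (y (m i) - y (m (Suc i)))) - \<alpha> *\<^sub>R (y (m 0) - y (m n))" for n
      by (induction n) (auto simp: algebra_simps)
    have D': "norm (\<Sum>i<n. (t i - \<alpha>) *\<^sub>R (y (m i) - y (m (Suc i)))) \<le> D + \<bar>\<alpha>\<bar> * (2 * C)" for n
    proof -
      have "norm (y (m 0) - y (m n)) \<le> 2 * C"
        using norm_triangle_ineq4[of "y (m 0)" "y (m n)"] norm_y[of "m 0"] norm_y[of "m n"] by linarith
      then have "norm (\<alpha> *\<^sub>R (y (m 0) - y (m n))) \<le> \<bar>\<alpha>\<bar> * (2 * C)" by (simp add: mult_left_mono)
      then show ?thesis unfolding sum_eq using norm_triangle_ineq4 D[of n] by (meson add_mono order_trans)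
    qed
    have A': "\<bar>t i - \<alpha>\<bar> \<le> A + \<bar>\<alpha>\<bar>" for i using A[of i] by linarith
    show False
    proof (cases "\<forall>k. \<exists>j\<ge>k. t j - \<alpha> \<ge> \<gamma>")
      case True
      show False by (rule key[of "\<lambda>i. t i - \<alpha>", OF A' \<gamma>(1) _ small D']) (use True in auto)
    next
      case False
      then obtain K where "\<forall>j\<ge>K. \<not> \<gamma> \<le> t j - \<alpha>" by blast
      then have K: "\<And>j. j \<ge> K \<Longrightarrow> t j - \<alpha> < \<gamma>" by force
      have neg: "\<exists>j\<ge>k. \<alpha> - t j \<ge> \<gamma>" for k
      proof -
        obtain j where "j \<ge> max k K" "\<bar>t j - \<alpha>\<bar> \<ge> \<gamma>" using \<gamma>(2) by blast
        then show ?thesis using K[of j] by (intro exI[of _ j]) auto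
      qed
      have "(\<Sum>i<n. (\<alpha> - t i) *\<^sub>R (y (m i) - y (m (Suc i)))) = - (\<Sum>i<n. (t i - \<alpha>) *\<^sub>R (y (m i) - y (m (Suc i))))" for n
        by (simp flip: sum_negf add: algebra_simps)
      then have D'': "norm (\<Sum>i<n. (\<alpha> - t i) *\<^sub>R (y (m i) - y (m (Suc i)))) \<le> D + \<bar>\<alpha>\<bar> * (2 * C)" for n
        using D'[of n] by simp
      show False
        by (rule key[of "\<lambda>i. \<alpha> - t i", OF _ \<gamma>(1) neg _ D'']) (use A' small in \<open>simp_all add: abs_minus_commute\<close>)
    qed
  qed
  then show ?thesis using m by blast
qed

section \<open>Convex blocks of bounded weak variation\<close>

lemma block_limit:
  assumes "f \<in> dual_ball" "e > 0"
  shows "\<exists>n. \<forall>z\<in>convex hull (y ` {n..}). \<bar>f z - lam f\<bar> \<le> e"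
proof -
  obtain n where n: "\<And>k. k \<ge> n \<Longrightarrow> \<bar>f (y k) - lam f\<bar> < e"
    using lam[OF assms(1)] assms(2) by (auto simp: lim_sequentially dist_real_def)
  have "convex hull (y ` {n..}) \<subseteq> {z. \<bar>f z - lam f\<bar> \<le> e}"
  proof (rule hull_minimal)
    show "y ` {n..} \<subseteq> {z. \<bar>f z - lam f\<bar> \<le> e}" using n by (auto simp: less_imp_le)
    have "convex (f -` {lam f - e..lam f + e})"
      using dual_ball_linear[OF assms(1)] by (rule convex_linear_vimage) simp
    moreover have "f -` {lam f - e..lam f + e} = {z. \<bar>f z - lam f\<bar> \<le> e}" by auto
    ultimately show "convex {z. \<bar>f z - lam f\<bar> \<le> e}" by simp
  qed
  then show ?thesis by blast
qed

lemma hull_norm_le: "z \<in> convex hull (y ` A) \<Longrightarrow> norm z \<le> C"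
proof -
  assume z: "z \<in> convex hull (y ` A)"
  have "convex hull (y ` A) \<subseteq> cball 0 C"
    using norm_y by (intro hull_minimal) auto
  then show ?thesis using z by auto
qed

lemma max_convex:
  fixes a :: real
  assumes "0 \<le> t" "t \<le> 1"
  shows "max ((1 - t) * a + t * a') ((1 - t) * b + t * b') \<le> (1 - t) * max a b + t * max a' b'"
  using assms by (intro max.boundedI add_mono mult_left_mono) auto

text \<open>Along the indices, \<open>f z - lam f\<close> becomes small only pointwise in \<open>f\<close>; the minimax lemma makes
  it uniform by passing to convex combinations. It applies because \<open>\<phi>\<close> and \<open>\<phi> - lam\<close> are upper
  semicontinuous: \<open>lam\<close> is a difference of bounded semicontinuous functions.\<close>

lemma convex_block_exists:
  assumes bounded: "\<forall>T v. valid T v \<longrightarrow> v \<le> V"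
    and E: "continuous_on UNIV E" "\<And>f. f \<in> dual_ball \<Longrightarrow> 0 \<le> E f \<and> E f \<le> K"
    and inv: "\<And>f. f \<in> dual_ball \<Longrightarrow> E f + \<phi> f + max 0 (f z0 - lam f) \<le> b" and "e > 0"
  shows "\<exists>z\<in>convex hull (y ` {n0..}). \<forall>f\<in>dual_ball.
    E f + max 0 (f z0 - f z) + \<phi> f + max 0 (f z - lam f) \<le> b + e"
proof -
  have C0: "C \<ge> 0" using norm_y[of 0] norm_ge_zero[of "y 0"] by linarith
  define B where "B n = convex hull (y ` {n0 + n..})" for n
  \<comment> \<open>By itself \<open>max 0 (f z - lam f)\<close> need not be semicontinuous in
    \<open>f\<close>. Together with \<open>\<phi> f\<close> it becomes the maximum of
    \<open>\<phi> f\<close> and \<open>\<phi> f - lam f + f z\<close>, which are both upper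
    semicontinuous.\<close>
  define H where "H z f = E f + max 0 (f z0 - f z) + max (\<phi> f) ((\<phi> f - lam f) + f z)" for z and f :: "'a \<Rightarrow> real"
  have H_eq: "H z f = E f + max 0 (f z0 - f z) + \<phi> f + max 0 (f z - lam f)" for z f
    by (simp add: H_def max_def)
  have usc\<phi>: "usc_on dual_ball \<phi>"
  proof (rule usc_onI)
    fix f :: "'a \<Rightarrow> real" and d :: real assume "f \<in> dual_ball" "d > 0"
    then obtain n where "\<forall>g\<in>dual_ball. near_along y n f g \<longrightarrow> \<phi> g \<le> \<phi> f + d"
      using \<phi>_up[OF bounded] by blast
    then show "\<exists>U. open U \<and> f \<in> U \<and> (\<forall>g\<in>U \<inter> dual_ball. \<phi> g \<le> \<phi> f + d)"
      by (intro exI[of _ "{g. near_along y n f g}"]) (auto simp: open_near_along near_along_refl)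
  qed
  \<comment> \<open>Where \<open>lam g\<close> is above \<open>lam f\<close>, the bound on \<phi>
    suffices; elsewhere the drop of \<open>lam\<close> is a gain limited by
    \<open>\<phi>_step\<close>. A single index \<open>l\<close> without excessive gains is enough,
    as it fixes the neighbourhood \<open>n + l\<close>.\<close>
  have usc\<psi>: "usc_on dual_ball (\<lambda>f. \<phi> f - lam f)"
  proof (rule usc_onI)
    fix f :: "'a \<Rightarrow> real" and d :: real assume f: "f \<in> dual_ball" "d > 0"
    obtain n1 where n1: "\<forall>g\<in>dual_ball. near_along y n1 f g \<longrightarrow> \<phi> g \<le> \<phi> f + d"
      using \<phi>_up[OF bounded f] by blast
    obtain n where "\<not> eventually (\<lambda>l. \<exists>g\<in>dual_ball. near_along y (n + l) f g \<and> 0 \<le> lam f - lam g \<and>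
        \<phi> f + d < \<phi> g + (lam f - lam g)) sequentially"
      using \<phi>_step[OF bounded f] by blast
    from not_eventuallyD[OF this] obtain l where l: "\<not> (\<exists>g\<in>dual_ball. near_along y (n + l) f g \<and>
        0 \<le> lam f - lam g \<and> \<phi> f + d < \<phi> g + (lam f - lam g))"
      by blast
    have "\<phi> g - lam g \<le> \<phi> f - lam f + d" if g: "g \<in> dual_ball" "near_along y (max n1 (n + l)) f g" for g
    proof -
      have "near_along y n1 f g" "near_along y (n + l) f g" using g(2) by (auto elim: near_along_mono)
      then have "\<phi> g \<le> \<phi> f + d" "0 \<le> lam f - lam g \<Longrightarrow> \<phi> g + (lam f - lam g) \<le> \<phi> f + d"
        using n1 l g(1) by (auto simp: not_less)
      then show ?thesis by linarith
    qed
    then show "\<exists>U. open U \<and> f \<in> U \<and> (\<forall>g\<in>U \<inter> dual_ball. \<phi> g - lam g \<le> \<phi> f - lam f + d)"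
      by (intro exI[of _ "{g. near_along y (max n1 (n + l)) f g}"]) (auto simp: open_near_along near_along_refl)
  qed
  have "\<exists>z\<in>B 0. \<forall>f\<in>dual_ball. H z f \<le> (b + e / 2) + e / 2"
  proof (rule Simons_minimax[OF compact_dual_ball, where C = "K + 3 * C + V + norm z0"])
    show "dual_ball \<noteq> ({} :: ('a \<Rightarrow> real) set)" using zero_in_dual_ball by blast
    show "convex (B n)" "B n \<noteq> {}" for n by (auto simp: B_def convex_convex_hull)
    show "B (Suc n) \<subseteq> B n" for n unfolding B_def by (intro hull_mono image_mono) auto
    show "e / 2 > 0" using \<open>e > 0\<close> by simp
    fix z
    have "continuous_on dual_ball (\<lambda>f. E f + max 0 (f z0 - f z))"
      by (rule continuous_on_subset[where s = UNIV])
        (auto intro!: continuous_on_add continuous_on_max continuous_on_diff continuous_on_eval E(1))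
    moreover have "usc_on dual_ball (\<lambda>f. max (\<phi> f) ((\<phi> f - lam f) + f z))"
      by (rule usc_on_max[OF usc\<phi> usc_on_add[OF usc\<psi> usc_on_continuous[OF continuous_on_eval]]])
    ultimately show "usc_on dual_ball (H z)" unfolding H_def
      by (rule usc_on_add[OF usc_on_continuous])
    assume z: "z \<in> B 0"
    fix f :: "'a \<Rightarrow> real" assume f: "f \<in> dual_ball"
    have "norm z \<le> C" using z hull_norm_le unfolding B_def by blast
    then have "\<bar>f z\<bar> \<le> C" "\<bar>f z0\<bar> \<le> norm z0" "\<bar>lam f\<bar> \<le> C"
      using dual_ball_le[OF f, of z] dual_ball_le[OF f, of z0] abs_lam_le[OF f] by auto
    then show "0 \<le> H z f \<and> H z f \<le> K + 3 * C + V + norm z0"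
      unfolding H_eq using E(2)[OF f] \<phi>_bounds[OF bounded f] by (auto simp: max_def)
  next
    fix f :: "'a \<Rightarrow> real" assume f: "f \<in> dual_ball"
    note lin = dual_ball_linear[OF f]
    show "convex_on (B 0) (\<lambda>z. H z f)"
    proof (rule convex_onI)
      fix t :: real and z z' :: 'a assume t: "0 < t" "t < 1"
      have eq: "f ((1 - t) *\<^sub>R z + t *\<^sub>R z') = (1 - t) * f z + t * f z'"
        using lin by (simp add: linear_add linear_cmul)
      have eq1: "(1 - t) * (f z0 - f z) + t * (f z0 - f z') = f z0 - f ((1 - t) *\<^sub>R z + t *\<^sub>R z')"
        unfolding eq by (simp add: algebra_simps)
      have eq2: "(1 - t) * (\<phi> f - lam f + f z) + t * (\<phi> f - lam f + f z') = \<phi> f - lam f + f ((1 - t) *\<^sub>R z + t *\<^sub>R z')"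
        unfolding eq by (simp add: algebra_simps)
      have eq3: "(1 - t) * c + t * c = c" for c :: real by (simp add: algebra_simps)
      have "max 0 (f z0 - f ((1 - t) *\<^sub>R z + t *\<^sub>R z')) \<le> (1 - t) * max 0 (f z0 - f z) + t * max 0 (f z0 - f z')"
        using max_convex[of t 0 0 "f z0 - f z" "f z0 - f z'", unfolded eq1 eq3] t by (simp only: less_imp_le)
      moreover have "max (\<phi> f) (\<phi> f - lam f + f ((1 - t) *\<^sub>R z + t *\<^sub>R z')) \<le>
          (1 - t) * max (\<phi> f) (\<phi> f - lam f + f z) + t * max (\<phi> f) (\<phi> f - lam f + f z')"
        using max_convex[of t "\<phi> f" "\<phi> f" "\<phi> f - lam f + f z" "\<phi> f - lam f + f z'", unfolded eq2 eq3] t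
        by (simp only: less_imp_le)
      ultimately show "H ((1 - t) *\<^sub>R z + t *\<^sub>R z') f \<le> (1 - t) * H z f + t * H z' f"
        unfolding H_def distrib_left using eq3[of "E f"] by linarith
    qed (simp add: B_def convex_convex_hull)
    \<comment> \<open>If \<open>f z\<close> is within \<open>e / 4\<close> of \<open>lam f\<close>,
      the first positive part exceeds \<open>max 0 (f z0 - lam f)\<close> by at most
      \<open>e / 4\<close> and the second is at most \<open>e / 4\<close>. The other
      \<open>e / 2\<close> is spent by the minimax lemma.\<close>
    obtain n where n: "\<forall>z\<in>convex hull (y ` {n..}). \<bar>f z - lam f\<bar> \<le> e / 4"
      using block_limit[OF f, of "e / 4"] \<open>e > 0\<close> by auto
    have "H z f \<le> b + e / 2" if "z \<in> B n" for z
    proof -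
      have "B n \<subseteq> convex hull (y ` {n..})" unfolding B_def by (intro hull_mono image_mono) auto
      then have "\<bar>f z - lam f\<bar> \<le> e / 4" using n that by blast
      then show ?thesis unfolding H_eq using inv[OF f] \<open>e > 0\<close> by (auto simp: max_def split: if_splits)
    qed
    then show "\<exists>n. \<forall>z\<in>B n. H z f \<le> b + e / 2" by blast
  qed
  then show ?thesis unfolding H_eq B_def by (simp add: add.commute)
qed

text \<open>Blocks are chosen so that the sum of the drops of \<open>f\<close> along them stays
  bounded on the dual ball, paid for by the potential; by symmetry of the ball so does their total
  variation. Since their limit \<open>lam\<close> is not given by a vector, the blocks are not
  Cauchy in norm, and jumps between them form a weakly unconditionally Cauchy series bounded away
  from 0.\<close>

lemma bounded_case:
  assumes bounded: "\<forall>T v. valid T v \<longrightarrow> v \<le> V"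
    and nonrep: "\<And>w. \<exists>f\<in>dual_ball. lam f \<noteq> f w"
  shows "contains_c0 TYPE('a)"
proof -
  \<comment> \<open>\<open>V\<close> bounds the potential, \<open>2 * C\<close> the initial term
    \<open>f (y 0) - lam f\<close>, and 1 is the sum of the tolerances
    \<open>(1/2) ^ Suc k\<close>.\<close>
  define K where "K = V + 2 * C + 1"
  define P where "P k s \<longleftrightarrow> continuous_on UNIV (fst s) \<and> (\<forall>f\<in>dual_ball. 0 \<le> fst s f) \<and>
      snd s \<in> convex hull (y ` {k..}) \<and>
      (\<forall>f\<in>dual_ball. fst s f + \<phi> f + max 0 (f (snd s) - lam f) \<le> K - (1/2) ^ k)"
    for k :: nat and s :: "(('a \<Rightarrow> real) \<Rightarrow> real) \<times> 'a"
  have le_K: "fst s f \<le> K" if "P k s" "f \<in> dual_ball" for k s f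
  proof -
    have "fst s f + \<phi> f + max 0 (f (snd s) - lam f) \<le> K - (1/2) ^ k" using that by (simp add: P_def)
    moreover have "(0::real) \<le> (1/2) ^ k" by simp
    ultimately show ?thesis using \<phi>_bounds(1)[OF bounded that(2)] by linarith
  qed
  have "\<exists>s. \<forall>k. P k (s k) \<and> fst (s (Suc k)) = (\<lambda>f. fst (s k) f + max 0 (f (snd (s k)) - f (snd (s (Suc k)))))"
  proof (rule dependent_nat_choice)
    have "P 0 (\<lambda>f. 0, y 0)" unfolding P_def
    proof (intro conjI ballI)
      show "snd (\<lambda>f. 0, y 0) \<in> convex hull (y ` {0..})" by (auto intro: hull_inc)
      fix f :: "'a \<Rightarrow> real" assume f: "f \<in> dual_ball"
      show "fst (\<lambda>f. 0, y 0) f + \<phi> f + max 0 (f (snd (\<lambda>f. 0, y 0)) - lam f) \<le> K - (1/2) ^ 0"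
        using \<phi>_bounds(2)[OF bounded f] abs_lam_le[OF f] abs_y_le[OF f, of 0] by (auto simp: K_def)
    qed auto
    then show "\<exists>s. P 0 s" by blast
  next
    fix s k assume s: "P k s"
    obtain z where z: "z \<in> convex hull (y ` {Suc k..})" "\<forall>f\<in>dual_ball.
        fst s f + max 0 (f (snd s) - f z) + \<phi> f + max 0 (f z - lam f) \<le> K - (1/2) ^ k + (1/2) ^ Suc k"
      using convex_block_exists[OF bounded, of "fst s" K "snd s" "K - (1/2) ^ k" "(1/2) ^ Suc k" "Suc k"] s le_K[OF s]
      by (auto simp: P_def)
    have "P (Suc k) (\<lambda>f. fst s f + max 0 (f (snd s) - f z), z)" unfolding P_def fst_conv snd_conv
    proof (intro conjI ballI)
      show "continuous_on UNIV (\<lambda>f. fst s f + max 0 (f (snd s) - f z))"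
        using s unfolding P_def
        by (intro continuous_on_add continuous_on_max continuous_on_diff continuous_on_const continuous_on_eval) auto
      fix f :: "'a \<Rightarrow> real" assume f: "f \<in> dual_ball"
      show "0 \<le> fst s f + max 0 (f (snd s) - f z)" using s f by (auto simp: P_def)
      show "fst s f + max 0 (f (snd s) - f z) + \<phi> f + max 0 (f z - lam f) \<le> K - (1/2) ^ Suc k"
        using z(2) f by fastforce
    qed (rule z(1))
    then show "\<exists>s'. P (Suc k) s' \<and> fst s' = (\<lambda>f. fst s f + max 0 (f (snd s) - f (snd s')))"
      by (intro exI[of _ "(\<lambda>f. fst s f + max 0 (f (snd s) - f z), z)"]) simp
  qed
  then obtain s where s: "\<And>k. P k (s k)"
    "\<And>k. fst (s (Suc k)) = (\<lambda>f. fst (s k) f + max 0 (f (snd (s k)) - f (snd (s (Suc k)))))" by blast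
  define z where "z k = snd (s k)" for k
  have pos: "(\<Sum>k<N. max 0 (f (z k) - f (z (Suc k)))) \<le> K" if f: "f \<in> dual_ball" for f N
  proof -
    have "(\<Sum>k<N. max 0 (f (z k) - f (z (Suc k)))) \<le> fst (s N) f"
    proof (induction N)
      case 0 then show ?case using s(1)[of 0] f by (simp add: P_def)
    next
      case (Suc N) then show ?case by (simp add: s(2) z_def)
    qed
    then show ?thesis using le_K[OF s(1) f] by (meson order_trans)
  qed
  have var: "(\<Sum>k<N. \<bar>f (z k) - f (z (Suc k))\<bar>) \<le> 2 * K" if f: "f \<in> dual_ball" for f N
  proof -
    have "(\<Sum>k<N. \<bar>f (z k) - f (z (Suc k))\<bar>) = (\<Sum>k<N. max 0 (f (z k) - f (z (Suc k)))) +
        (\<Sum>k<N. max 0 (- f (z k) - - f (z (Suc k))))"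
      unfolding sum.distrib[symmetric] by (intro sum.cong) auto
    then show ?thesis using pos[OF f, of N] pos[OF dual_ball_uminus[OF f], of N] by simp
  qed
  have z_lim: "(\<lambda>k. f (z k)) \<longlonglongrightarrow> lam f" if f: "f \<in> dual_ball" for f
    unfolding lim_sequentially
  proof (intro allI impI)
    fix e :: real assume "e > 0"
    then obtain n where n: "\<forall>z\<in>convex hull (y ` {n..}). \<bar>f z - lam f\<bar> \<le> e / 2"
      using block_limit[OF f, of "e / 2"] by auto
    have "dist (f (z k)) (lam f) < e" if "k \<ge> n" for k
    proof -
      have "z k \<in> convex hull (y ` {k..})" using s(1)[of k] by (simp add: P_def z_def)
      moreover have "convex hull (y ` {k..}) \<subseteq> convex hull (y ` {n..})"
        using that by (intro hull_mono image_mono) auto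
      ultimately have "\<bar>f (z k) - lam f\<bar> \<le> e / 2" using n by blast
      then show ?thesis using \<open>e > 0\<close> by (simp add: dist_real_def)
    qed
    then show "\<exists>n. \<forall>k\<ge>n. dist (f (z k)) (lam f) < e" by blast
  qed
  have "\<not> Cauchy z"
  proof
    assume "Cauchy z"
    then obtain w where w: "z \<longlonglongrightarrow> w" using Cauchy_convergent convergent_def by blast
    have "lam f = f w" if f: "f \<in> dual_ball" for f
      using bounded_linear.tendsto[OF dual_ball_bounded_linear[OF f] w] z_lim[OF f] LIMSEQ_unique by blast
    then show False using nonrep[of w] by blast
  qed
  then obtain \<delta> where \<delta>: "\<delta> > 0" "\<And>M. \<exists>m\<ge>M. \<exists>n\<ge>M. \<delta> \<le> dist (z m) (z n)"
    unfolding Cauchy_def by (auto simp: not_less)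
  have "\<exists>q. \<forall>j. True \<and> (q j < q (Suc j) \<and> \<delta> / 2 \<le> dist (z (q j)) (z (q (Suc j))))"
  proof (rule dependent_nat_choice)
    \<comment> \<open>Of two late terms at distance at least \<delta>, one has distance at least
      \<open>\<delta> / 2\<close> from \<open>z a\<close>, so consecutive terms can be kept
      apart.\<close>
    fix a j :: nat
    obtain m n where mn: "m \<ge> Suc a" "n \<ge> Suc a" "\<delta> \<le> dist (z m) (z n)" using \<delta>(2) by blast
    then have "\<delta> / 2 \<le> dist (z a) (z m) \<or> \<delta> / 2 \<le> dist (z a) (z n)"
      using dist_triangle3[of "z m" "z n" "z a"] by linarith
    then show "\<exists>b. True \<and> a < b \<and> \<delta> / 2 \<le> dist (z a) (z b)" using mn(1,2) by (metis Suc_le_lessD)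
  qed auto
  then obtain q :: "nat \<Rightarrow> nat" where q: "\<And>j. q j < q (Suc j)" "\<And>j. \<delta> / 2 \<le> dist (z (q j)) (z (q (Suc j)))"
    by blast
  define w where "w j = z (q j) - z (q (Suc j))" for j
  show ?thesis
  proof (rule wuc_contains_c0[of w "2 * K" "\<delta> / 2"])
    fix f :: "'a \<Rightarrow> real" and N assume f: "f \<in> dual_ball"
    have seg: "\<bar>f (z a) - f (z b)\<bar> \<le> (\<Sum>k=a..<b. \<bar>f (z k) - f (z (Suc k))\<bar>)" if "a \<le> b" for a b
      using that by (induction b rule: dec_induct) auto
    have "(\<Sum>j<N. \<bar>f (w j)\<bar>) \<le> (\<Sum>k<q N. \<bar>f (z k) - f (z (Suc k))\<bar>)"
    proof (induction N)
      case (Suc N)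
      have "\<bar>f (w N)\<bar> \<le> (\<Sum>k=q N..<q (Suc N). \<bar>f (z k) - f (z (Suc k))\<bar>)"
        using seg[of "q N" "q (Suc N)"] q(1)[of N] dual_ball_linear[OF f] by (simp add: w_def linear_diff)
      moreover have "(\<Sum>k<q (Suc N). \<bar>f (z k) - f (z (Suc k))\<bar>) = (\<Sum>k<q N. \<bar>f (z k) - f (z (Suc k))\<bar>) +
          (\<Sum>k=q N..<q (Suc N). \<bar>f (z k) - f (z (Suc k))\<bar>)"
        using q(1)[of N] by (simp add: lessThan_atLeast0 sum.atLeastLessThan_concat)
      ultimately show ?case using Suc by simp
    qed (simp add: sum_nonneg)
    then show "(\<Sum>j<N. \<bar>f (w j)\<bar>) \<le> 2 * K" using var[OF f, of "q N"] by linarith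
  qed (use q(2) \<delta>(1) in \<open>auto simp: w_def dist_norm\<close>)
qed

end

text \<open>The coefficients \<open>t i\<close> stand for the sums of the first coefficients of a
  series in the vectors themselves; summation by parts translates between the two, so this is
  convergence of the sum of coefficients.\<close>

theorem weak_Cauchy_subsequence:
  fixes y :: "nat \<Rightarrow> 'a::banach"
  assumes "\<And>n. norm (y n) \<le> C" and "\<And>f. f \<in> dual_ball \<Longrightarrow> (\<lambda>n. f (y n)) \<longlonglongrightarrow> lam f"
    and "\<And>w. \<exists>f\<in>dual_ball. lam f \<noteq> f w" and c0: "\<not> contains_c0 TYPE('a)"
  shows "\<exists>m :: nat \<Rightarrow> nat. strict_mono m \<and> (\<forall>t. bounded (range t) \<longrightarrow>
    bounded (range (\<lambda>N. \<Sum>i<N. t i *\<^sub>R (y (m i) - y (m (Suc i))))) \<longrightarrow> convergent t)"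
proof -
  interpret steps y lam C by unfold_locales (use assms in auto)
  have "\<not> (\<exists>V. \<forall>T v. valid T v \<longrightarrow> v \<le> V)"
    using bounded_case assms(3) c0 by blast
  then have "\<exists>T v. valid T v \<and> v \<ge> V" for V by (meson linear)
  then show ?thesis by (rule unbounded_case)
qed

section \<open>Bases\<close>

locale schauder =
  fixes S :: "'a::banach set" and e :: "nat \<Rightarrow> 'a"
  assumes S: "subspace S" "closed S" and basis: "schauder_basis_of S e"
begin

definition coef :: "'a \<Rightarrow> nat \<Rightarrow> real" where
  "coef x = (THE a. (\<lambda>n. a n *\<^sub>R e n) sums x)"

definition proj :: "nat \<Rightarrow> 'a \<Rightarrow> 'a" where
  "proj n x = (\<Sum>i<n. coef x i *\<^sub>R e i)"

lemma e_in: "e n \<in> S"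
  using basis by (auto simp: schauder_basis_of_def)

lemma coef_sums: "x \<in> S \<Longrightarrow> (\<lambda>n. coef x n *\<^sub>R e n) sums x"
  unfolding coef_def using basis theI'[of "\<lambda>a. (\<lambda>n. a n *\<^sub>R e n) sums x"]
  by (auto simp: schauder_basis_of_def)

lemma coef_unique: "x \<in> S \<Longrightarrow> (\<lambda>n. a n *\<^sub>R e n) sums x \<Longrightarrow> coef x = a"
  using basis coef_sums[of x] by (auto simp: schauder_basis_of_def)

lemma coef_add: "x \<in> S \<Longrightarrow> y \<in> S \<Longrightarrow> coef (x + y) n = coef x n + coef y n"
  using coef_unique[of "x + y" "\<lambda>n. coef x n + coef y n"] sums_add[OF coef_sums coef_sums, of x y]
    subspace_add[OF S(1)] by (simp add: scaleR_add_left)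

lemma coef_scale: "x \<in> S \<Longrightarrow> coef (c *\<^sub>R x) n = c * coef x n"
  using coef_unique[of "c *\<^sub>R x" "\<lambda>n. c * coef x n"] sums_scaleR_right[OF coef_sums, of x c]
    subspace_scale[OF S(1)] by simp

lemma coef_e: "coef (e m) n = (if n = m then 1 else 0)"
proof -
  have "(\<lambda>n. (if n = m then 1 else 0) *\<^sub>R e n) sums (\<Sum>n\<in>{m}. (if n = m then 1 else 0) *\<^sub>R e n)"
    by (rule sums_finite) auto
  then show ?thesis using coef_unique[OF e_in, of "\<lambda>n. if n = m then 1 else 0" m] by simp
qed

lemma proj_tendsto: "x \<in> S \<Longrightarrow> (\<lambda>n. proj n x) \<longlonglongrightarrow> x"
  using coef_sums[of x] by (simp add: sums_def proj_def)

lemma proj_scale: "x \<in> S \<Longrightarrow> proj n (c *\<^sub>R x) = c *\<^sub>R proj n x"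
  by (simp add: proj_def coef_scale scaleR_sum_right)

lemma coef_diff: "x \<in> S \<Longrightarrow> y \<in> S \<Longrightarrow> coef (x - y) n = coef x n - coef y n"
  using coef_add[of x "- 1 *\<^sub>R y" n] coef_scale[of y "- 1" n] subspace_scale[OF S(1), of y "- 1"] by simp

lemma proj_diff: "x \<in> S \<Longrightarrow> y \<in> S \<Longrightarrow> proj n (x - y) = proj n x - proj n y"
  by (simp add: proj_def coef_diff scaleR_diff_left sum_subtractf)

lemma coef_scaled: "coef x n *\<^sub>R e n = proj (Suc n) x - proj n x"
  by (simp add: proj_def)

lemma norm_coef_le:
  assumes "\<And>n. norm (proj n x) \<le> c" shows "\<bar>coef x n\<bar> * norm (e n) \<le> 2 * c"
proof -
  have "norm (coef x n *\<^sub>R e n) \<le> c + c"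
    unfolding coef_scaled using assms by (intro order_trans[OF norm_triangle_ineq4] add_mono)
  then show ?thesis by simp
qed

text \<open>By the Baire category theorem, the points with partial sums bounded by a fixed
  constant are dense in a ball, so every point is approximated up to half its norm.\<close>

lemma approximation:
  obtains M where "M \<ge> 0" "\<And>x. x \<in> S \<Longrightarrow> \<exists>u\<in>S. (\<forall>n. norm (proj n u) \<le> M * norm x) \<and> norm (x - u) \<le> norm x / 2"
proof -
  define A where "A m = {x\<in>S. \<forall>n. norm (proj n x) \<le> real m}" for m :: nat
  have A_sub: "closure (A m) \<subseteq> S" for m using S(2) by (intro closure_minimal) (auto simp: A_def)
  have "S \<subseteq> (\<Union>m. closure (A m))"
  proof
    fix x assume x: "x \<in> S"
    have "Bseq (\<lambda>n. proj n x)" using proj_tendsto[OF x] convergentI convergent_imp_Bseq by blast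
    then obtain c where c: "\<And>n. norm (proj n x) \<le> c" by (auto simp: Bseq_def)
    obtain m :: nat where "c \<le> real m" using real_arch_simple by blast
    then have "x \<in> A m" using x c by (auto simp: A_def intro: order_trans)
    then show "x \<in> (\<Union>m. closure (A m))" using closure_subset by blast
  qed
  then have UN: "(\<Union>m. closure (A m)) = S" using A_sub by blast
  have "\<exists>m. top_of_set S interior_of closure (A m) \<noteq> {}"
  proof (rule ccontr)
    assume "\<not> ?thesis"
    then have "top_of_set S interior_of \<Union>(range (\<lambda>m. closure (A m))) = {}"
      using A_sub S(2)
      by (intro Baire_category_alt disjI1 completely_metrizable_space_closedin completely_metrizable_space_euclidean)
        (auto simp: closed_subset intro: closed_closedin[THEN iffD1])
    moreover have "top_of_set S interior_of S = S" by (simp add: interior_of_openin)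
    ultimately show False using UN subspace_0[OF S(1)] by auto
  qed
  then obtain m x0 T where T: "openin (top_of_set S) T" "T \<subseteq> closure (A m)" "x0 \<in> T"
    by (auto simp: interior_of_def)
  then obtain \<rho> where \<rho>: "\<rho> > 0" "x0 \<in> S" "\<And>y. y \<in> S \<Longrightarrow> dist y x0 < \<rho> \<Longrightarrow> y \<in> closure (A m)"
    unfolding openin_euclidean_subtopology_iff by (meson subsetD)
  \<comment> \<open>Half the difference of \<open>x0 + x\<close> and \<open>x0 - x\<close> is
    \<open>x\<close>: this moves the ball found by the category argument to the origin.\<close>
  have ball: "x \<in> closure (A m)" if x: "x \<in> S" "norm x < \<rho>" for x
  proof -
    have 1: "x0 + x \<in> closure (A m)" "x0 - x \<in> closure (A m)"
      using \<rho> x subspace_add[OF S(1)] subspace_diff[OF S(1)] by (auto simp: dist_norm)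
    have half: "(1/2) *\<^sub>R a - (1/2) *\<^sub>R b \<in> A m" if "a \<in> A m" "b \<in> A m" for a b
    proof -
      have ab: "a \<in> S" "b \<in> S" using that by (auto simp: A_def)
      have "proj n ((1/2) *\<^sub>R a - (1/2) *\<^sub>R b) = (1/2) *\<^sub>R proj n a - (1/2) *\<^sub>R proj n b" for n
        using ab subspace_scale[OF S(1)] by (simp only: proj_diff proj_scale)
      moreover have "norm ((1/2) *\<^sub>R proj n a - (1/2) *\<^sub>R proj n b) \<le> real m" for n
      proof -
        have "norm (proj n a) \<le> real m" "norm (proj n b) \<le> real m" using that by (auto simp: A_def)
        then show ?thesis
          using norm_triangle_ineq4[of "(1/2) *\<^sub>R proj n a" "(1/2) *\<^sub>R proj n b"] by simp
      qed
      ultimately show ?thesis using ab subspace_scale[OF S(1)] subspace_diff[OF S(1)] by (simp add: A_def)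
    qed
    obtain a b where ab: "\<And>n. a n \<in> A m" "a \<longlonglongrightarrow> x0 + x" "\<And>n. b n \<in> A m" "b \<longlonglongrightarrow> x0 - x"
      using 1 unfolding closure_sequential by blast
    have "(\<lambda>n. (1/2) *\<^sub>R a n - (1/2) *\<^sub>R b n) \<longlonglongrightarrow> (1/2) *\<^sub>R (x0 + x) - (1/2) *\<^sub>R (x0 - x)"
      by (intro tendsto_intros ab)
    moreover have "(1/2) *\<^sub>R (x0 + x) - (1/2) *\<^sub>R (x0 - x) = x"
      by (simp add: scaleR_diff_right scaleR_add_right flip: scaleR_add_left)
    ultimately show ?thesis unfolding closure_sequential using half ab by (intro exI[of _ "\<lambda>n. (1/2) *\<^sub>R a n - (1/2) *\<^sub>R b n"]) auto
  qed
  show thesis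
  proof (rule that[of "2 * real m / \<rho>"])
    show "0 \<le> 2 * real m / \<rho>" using \<rho>(1) by simp
    fix x assume x: "x \<in> S"
    show "\<exists>u\<in>S. (\<forall>n. norm (proj n u) \<le> 2 * real m / \<rho> * norm x) \<and> norm (x - u) \<le> norm x / 2"
    proof (cases "x = 0")
      case True
      have "proj n 0 = 0" for n using proj_scale[OF x, of n 0] by simp
      then show ?thesis using True x by (intro bexI[of _ 0]) auto
    next
      case False
      \<comment> \<open>The multiple of \<open>x\<close> by \<open>r\<close> has norm
        \<open>\<rho> / 2\<close>, so an approximation up to \<open>\<rho> / 4\<close> is one up to
        half its norm.\<close>
      define r where "r = \<rho> / (2 * norm x)"
      have r: "r > 0" using False \<rho>(1) by (simp add: r_def)
      have "norm (r *\<^sub>R x) < \<rho>" using False \<rho>(1) by (simp add: r_def)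
      then have "r *\<^sub>R x \<in> closure (A m)" using x subspace_scale[OF S(1)] by (intro ball) auto
      then obtain u where u: "u \<in> A m" "dist u (r *\<^sub>R x) < \<rho> / 4"
        using \<rho>(1) unfolding closure_approachable by (meson divide_pos_pos zero_less_numeral)
      have uS: "u \<in> S" using u by (simp add: A_def)
      have "norm (proj n ((1 / r) *\<^sub>R u)) \<le> 2 * real m / \<rho> * norm x" for n
      proof -
        have "norm (proj n ((1 / r) *\<^sub>R u)) \<le> (1 / r) * real m"
          unfolding proj_scale[OF uS] using u(1) r by (simp add: A_def divide_right_mono)
        then show ?thesis by (simp add: r_def mult_ac)
      qed
      moreover have "norm (x - (1 / r) *\<^sub>R u) \<le> norm x / 2"
      proof -
        have "x - (1 / r) *\<^sub>R u = (1 / r) *\<^sub>R (r *\<^sub>R x - u)" using r by (simp add: scaleR_diff_right)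
        then have "norm (x - (1 / r) *\<^sub>R u) = (1 / r) * dist u (r *\<^sub>R x)"
          using r by (simp add: dist_norm norm_minus_commute)
        also have "\<dots> \<le> (1 / r) * (\<rho> / 4)" using u(2) r by (intro mult_left_mono) auto
        also have "\<dots> = norm x / 2" using False \<rho>(1) by (simp add: r_def)
        finally show ?thesis .
      qed
      ultimately show ?thesis using subspace_scale[OF S(1) uS] by blast
    qed
  qed
qed

text \<open>Iterated approximation writes \<open>x\<close> as a series of vectors \<open>u j\<close>
  whose partial sum projections decay geometrically. Continuity of \<open>proj n\<close> is not yet
  available, so \<open>proj n x\<close> is identified with the sum \<open>s n\<close> of the
  \<open>proj n (u j)\<close> by uniqueness of the expansion: the increments of \<open>s\<close> are
  multiples of \<open>e n\<close>, and \<open>s\<close> converges to \<open>x\<close>.\<close>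

lemma basis_constant:
  obtains K where "K > 0" "\<And>x n. x \<in> S \<Longrightarrow> norm (proj n x) \<le> K * norm x"
proof -
  obtain M where M: "M \<ge> 0" "\<And>x. x \<in> S \<Longrightarrow> \<exists>u\<in>S. (\<forall>n. norm (proj n u) \<le> M * norm x) \<and> norm (x - u) \<le> norm x / 2"
    using approximation by metis
  then obtain \<pi> where \<pi>: "\<And>x. x \<in> S \<Longrightarrow> \<pi> x \<in> S" "\<And>x n. x \<in> S \<Longrightarrow> norm (proj n (\<pi> x)) \<le> M * norm x"
    "\<And>x. x \<in> S \<Longrightarrow> norm (x - \<pi> x) \<le> norm x / 2" by metis
  have "norm (proj n x) \<le> (2 * M + 1) * norm x" if x: "x \<in> S" for x n
  proof -
    define r where "r = rec_nat x (\<lambda>_ v. v - \<pi> v)"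
    define u where "u j = \<pi> (r j)" for j
    have r: "r 0 = x" "\<And>j. r (Suc j) = r j - u j" by (simp_all add: r_def u_def)
    have rS: "r j \<in> S" for j by (induction j) (use r x \<pi>(1) subspace_diff[OF S(1)] in \<open>auto simp: u_def\<close>)
    have uS: "u j \<in> S" for j using \<pi>(1)[OF rS] by (simp add: u_def)
    have rn: "norm (r j) \<le> norm x * (1/2) ^ j" for j
    proof (induction j)
      case (Suc j) then show ?case using \<pi>(3)[OF rS[of j]] by (simp add: r u_def)
    qed (simp add: r)
    define c where "c j = M * (norm x * (1/2) ^ j)" for j
    have pu: "norm (proj n (u j)) \<le> c j" for n j
      using \<pi>(2)[OF rS[of j], of n] mult_left_mono[OF rn[of j] M(1)] by (simp add: u_def c_def)
    have un: "norm (u j) \<le> c j" for j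
      by (rule LIMSEQ_le_const2[OF tendsto_norm[OF proj_tendsto[OF uS]]]) (use pu in blast)
    have c_sum: "summable c" unfolding c_def by (intro summable_mult summable_geometric) auto
    have suminf_c: "suminf c = 2 * M * norm x"
      unfolding c_def using suminf_geometric[of "1/2::real"]
      by (simp add: suminf_mult summable_geometric mult_ac flip: power_one_over)
    have sum_u: "(\<Sum>j<J. u j) = x - r J" for J by (induction J) (auto simp: r)
    have "r \<longlonglongrightarrow> 0"
      by (rule Lim_null_comparison[where g = "\<lambda>j. norm x * (1/2) ^ j"])
        (use rn in \<open>auto intro!: always_eventually tendsto_mult_right_zero LIMSEQ_power_zero\<close>)
    then have u_sums: "u sums x"
      unfolding sums_def sum_u using tendsto_diff[OF tendsto_const, of r 0 sequentially x] by simp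
    have pu_sum: "summable (\<lambda>j. proj n (u j))" for n
      using pu by (intro summable_comparison_test'[OF c_sum, of 0]) auto
    define s where "s n = (\<Sum>j. proj n (u j))" for n
    have s_tail: "norm (s n - (\<Sum>j<J. proj n (u j))) \<le> (\<Sum>j. c (j + J))" for n J
    proof -
      have "s n - (\<Sum>j<J. proj n (u j)) = (\<Sum>j. proj n (u (j + J)))"
        unfolding s_def by (subst suminf_split_initial_segment[OF pu_sum, of _ J]) simp
      also have "norm \<dots> \<le> (\<Sum>j. c (j + J))"
        using pu by (intro norm_suminf_le summable_ignore_initial_segment c_sum)
      finally show ?thesis .
    qed
    have x_tail: "norm (x - (\<Sum>j<J. u j)) \<le> (\<Sum>j. c (j + J))" for J
    proof -
      have "x - (\<Sum>j<J. u j) = (\<Sum>j. u (j + J))"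
        using suminf_minus_initial_segment[OF sums_summable[OF u_sums], of J] sums_unique[OF u_sums] by simp
      also have "norm \<dots> \<le> (\<Sum>j. c (j + J))"
        using un by (intro norm_suminf_le summable_ignore_initial_segment c_sum)
      finally show ?thesis .
    qed
    \<comment> \<open>Interchange of limits: the tails of the series in \<open>j\<close> are bounded
      by those of \<open>c\<close>, uniformly in \<open>n\<close>.\<close>
    have "s \<longlonglongrightarrow> x"
    proof (rule LIMSEQ_I)
      fix d :: real assume "d > 0"
      then have "\<exists>N. \<forall>n\<ge>N. norm (\<Sum>i. c (i + n)) < d / 4" by (intro suminf_exist_split c_sum) simp
      then obtain J where "norm (\<Sum>j. c (j + J)) < d / 4" by blast
      then have J: "(\<Sum>j. c (j + J)) < d / 4" by simp
      have lim_J: "(\<lambda>n. \<Sum>j<J. proj n (u j)) \<longlonglongrightarrow> (\<Sum>j<J. u j)"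
        using uS by (intro tendsto_sum proj_tendsto)
      then obtain N where N: "\<And>n. n \<ge> N \<Longrightarrow> norm ((\<Sum>j<J. proj n (u j)) - (\<Sum>j<J. u j)) < d / 4"
      proof -
        have "\<exists>N. \<forall>n\<ge>N. norm ((\<Sum>j<J. proj n (u j)) - (\<Sum>j<J. u j)) < d / 4"
          using lim_J by (rule LIMSEQ_D) (use \<open>d > 0\<close> in simp)
        then show thesis using that by blast
      qed
      have "norm (s n - x) < d" if "n \<ge> N" for n
      proof -
        have "s n - x = (s n - (\<Sum>j<J. proj n (u j))) + ((\<Sum>j<J. proj n (u j)) - (\<Sum>j<J. u j)) - (x - (\<Sum>j<J. u j))"
          by simp
        then have "norm (s n - x) \<le> norm (s n - (\<Sum>j<J. proj n (u j))) + norm ((\<Sum>j<J. proj n (u j)) - (\<Sum>j<J. u j))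
            + norm (x - (\<Sum>j<J. u j))"
          using norm_triangle_ineq4[of "(s n - (\<Sum>j<J. proj n (u j))) + ((\<Sum>j<J. proj n (u j)) - (\<Sum>j<J. u j))" "x - (\<Sum>j<J. u j)"]
            norm_triangle_ineq[of "s n - (\<Sum>j<J. proj n (u j))" "(\<Sum>j<J. proj n (u j)) - (\<Sum>j<J. u j)"]
          by (simp only:)
        then show ?thesis using s_tail[of n J] x_tail[of J] N[OF that] J \<open>d > 0\<close> by linarith
      qed
      then show "\<exists>N. \<forall>n\<ge>N. norm (s n - x) < d" by blast
    qed
    have step: "s (Suc n) - s n \<in> range (\<lambda>t. t *\<^sub>R e n)" for n
    proof -
      have "s (Suc n) - s n = (\<Sum>j. coef (u j) n *\<^sub>R e n)"
        unfolding s_def suminf_diff[OF pu_sum pu_sum] coef_scaled ..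
      moreover have "summable (\<lambda>j. coef (u j) n *\<^sub>R e n)"
        unfolding coef_scaled by (intro summable_diff pu_sum)
      moreover have "summable (\<lambda>j. coef (u j) n)"
      proof (rule summable_comparison_test'[of "\<lambda>j. 2 * c j / norm (e n)" 0])
        show "summable (\<lambda>j. 2 * c j / norm (e n))" by (intro summable_divide summable_mult c_sum)
        have "e n \<noteq> 0" using coef_e[of n n] coef_scale[OF e_in, of 0 n n] by auto
        then show "norm (coef (u j) n) \<le> 2 * c j / norm (e n)" for j
          using norm_coef_le[of "u j" "c j" n] pu by (simp add: field_simps)
      qed
      ultimately have "s (Suc n) - s n = (\<Sum>j. coef (u j) n) *\<^sub>R e n"
        using suminf_scaleR_left[of "\<lambda>j. coef (u j) n" "e n"] by metis
      then show ?thesis by blast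
    qed
    then have "\<forall>n. \<exists>t. s (Suc n) - s n = t *\<^sub>R e n" by blast
    then obtain a where a: "\<forall>n. s (Suc n) - s n = a n *\<^sub>R e n" by (rule choice[THEN exE])
    have s_sum: "s n = (\<Sum>i<n. a i *\<^sub>R e i)" for n
    proof (induction n)
      case 0 show ?case by (simp add: s_def proj_def)
    next
      case (Suc n) then show ?case using a[THEN spec, of n] by (simp add: algebra_simps)
    qed
    then have "coef x = a" using \<open>s \<longlonglongrightarrow> x\<close> by (intro coef_unique[OF x]) (simp add: sums_def flip: s_sum)
    then have "proj n x = s n" by (simp add: proj_def s_sum)
    moreover have "norm (s n) \<le> suminf c" unfolding s_def using pu by (intro norm_suminf_le c_sum)
    ultimately have "norm (proj n x) \<le> 2 * M * norm x" using suminf_c by simp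
    also have "\<dots> \<le> (2 * M + 1) * norm x" by (intro mult_right_mono) auto
    finally show ?thesis .
  qed
  moreover have "2 * M + 1 > 0" using M(1) by simp
  ultimately show thesis by (rule that[rotated])
qed

text \<open>Hahn-Banach extends the coefficient functionals to the whole space, so that weak limits
  can be tested before they are known to lie in \<open>S\<close>. The lower bound on the norms of
  the \<open>e n\<close> makes one constant serve for all of them.\<close>

lemma bounded_coef:
  assumes lower: "\<And>n. \<delta> \<le> norm (e n)" and "\<delta> > 0"
  obtains cf :: "nat \<Rightarrow> 'a \<Rightarrow> real" and K
  where "K > 0" "\<And>n. linear (cf n)" "\<And>n x. \<bar>cf n x\<bar> \<le> K * norm x"
    "\<And>n m. cf n (e m) = (if n = m then 1 else 0)"
    "\<And>x. x \<in> S \<Longrightarrow> (\<lambda>n. cf n x *\<^sub>R e n) sums x"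
    "\<And>x N. x \<in> S \<Longrightarrow> norm (\<Sum>n<N. cf n x *\<^sub>R e n) \<le> K * norm x"
proof -
  obtain K where K: "K > 0" "\<And>x n. x \<in> S \<Longrightarrow> norm (proj n x) \<le> K * norm x"
    using basis_constant by metis
  define L where "L = 2 * K / \<delta>"
  have "L > 0" using K(1) \<open>\<delta> > 0\<close> by (simp add: L_def)
  have coef_le: "\<bar>coef x n\<bar> \<le> L * norm x" if "x \<in> S" for x n
  proof -
    have "\<bar>coef x n\<bar> * \<delta> \<le> \<bar>coef x n\<bar> * norm (e n)" using lower by (intro mult_left_mono) auto
    also have "\<dots> \<le> 2 * (K * norm x)" using K(2)[OF that] by (intro norm_coef_le)
    finally show ?thesis using \<open>\<delta> > 0\<close> by (simp add: L_def field_simps)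
  qed
  have "\<exists>g. linear g \<and> (\<forall>x. \<bar>g x\<bar> \<le> L * norm x) \<and> (\<forall>x\<in>S. g x = coef x n)" for n
  proof -
    obtain g where "linear g" "\<And>x. \<bar>g x\<bar> \<le> L * norm x" "\<And>x. x \<in> S \<Longrightarrow> g x = coef x n"
      by (rule Hahn_Banach[OF S(1), of "\<lambda>x. coef x n" L])
        (use coef_add coef_scale coef_le \<open>L > 0\<close> in auto)
    then show ?thesis by blast
  qed
  then obtain cf where cf: "\<And>n. linear (cf n)" "\<And>n x. \<bar>cf n x\<bar> \<le> L * norm x" "\<And>n x. x \<in> S \<Longrightarrow> cf n x = coef x n"
    by metis
  show thesis
  proof (rule that[of "max K L" cf])
    fix n m :: nat and x
    show "max K L > 0" using K(1) by simp
    show "linear (cf n)" by (rule cf(1))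
    show "\<bar>cf n x\<bar> \<le> max K L * norm x"
      using cf(2)[of n x] mult_right_mono[of L "max K L" "norm x"] by simp
    show "cf n (e m) = (if n = m then 1 else 0)" by (simp add: cf(3)[OF e_in] coef_e)
    assume x: "x \<in> S"
    show "(\<lambda>n. cf n x *\<^sub>R e n) sums x" using coef_sums[OF x] by (simp add: cf(3)[OF x])
    show "norm (\<Sum>n<m. cf n x *\<^sub>R e n) \<le> max K L * norm x"
      using K(2)[OF x, of m] mult_right_mono[of K "max K L" "norm x"] by (simp add: cf(3)[OF x] proj_def)
  qed
qed

end

section \<open>Closed spans and subsequences of basic sequences\<close>

lemma subspace_closed_span: "subspace (closed_span A)"
  unfolding closed_span_def
proof (rule subspaceI)
  show "0 \<in> closure (span A)" using closure_subset span_zero by blast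
next
  fix x y assume "x \<in> closure (span A)" "y \<in> closure (span A)"
  then obtain u v where "\<And>n. u n \<in> span A" "u \<longlonglongrightarrow> x" "\<And>n. v n \<in> span A" "v \<longlonglongrightarrow> y"
    unfolding closure_sequential by blast
  then have "\<forall>n. u n + v n \<in> span A" "(\<lambda>n. u n + v n) \<longlonglongrightarrow> x + y"
    by (auto intro: span_add tendsto_add)
  then show "x + y \<in> closure (span A)" unfolding closure_sequential
    by (intro exI[of _ "\<lambda>n. u n + v n"] conjI)
next
  fix c x assume "x \<in> closure (span A)"
  then obtain u where "\<And>n. u n \<in> span A" "u \<longlonglongrightarrow> x"
    unfolding closure_sequential by blast
  then have "\<forall>n. c *\<^sub>R u n \<in> span A" "(\<lambda>n. c *\<^sub>R u n) \<longlonglongrightarrow> c *\<^sub>R x"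
    by (auto intro: span_scale tendsto_scaleR)
  then show "c *\<^sub>R x \<in> closure (span A)" unfolding closure_sequential
    by (intro exI[of _ "\<lambda>n. c *\<^sub>R u n"] conjI)
qed

lemma closed_closed_span: "closed (closed_span A)"
  by (simp add: closed_span_def)

lemma subset_closed_span: "A \<subseteq> closed_span A"
  unfolding closed_span_def using span_superset closure_subset by blast

lemma closed_span_minimal: "A \<subseteq> T \<Longrightarrow> subspace T \<Longrightarrow> closed T \<Longrightarrow> closed_span A \<subseteq> T"
  unfolding closed_span_def by (intro closure_minimal span_minimal)

lemma schauder_basic_sequence: "basic_sequence x \<Longrightarrow> schauder (closed_span (range x)) (x :: nat \<Rightarrow> 'a::banach)"
  by (simp add: schauder_def subspace_closed_span closed_closed_span basic_sequence_def)

lemma bounded_linear_if_dominated: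
  "linear (f :: 'a::real_normed_vector \<Rightarrow> real) \<Longrightarrow> (\<And>x. \<bar>f x\<bar> \<le> K * norm x) \<Longrightarrow> bounded_linear f"
  by (auto simp: linear_iff bounded_linear_def bounded_linear_axioms_def mult.commute intro!: exI[of _ K])

lemma zero_on_closed_span:
  assumes "linear (f :: 'a::real_normed_vector \<Rightarrow> real)" "\<And>x. \<bar>f x\<bar> \<le> K * norm x" "\<And>x. x \<in> A \<Longrightarrow> f x = 0" "x \<in> closed_span A"
  shows "f x = 0"
proof -
  have "closed_span A \<subseteq> {x. f x = 0}"
  proof (rule closed_span_minimal)
    show "subspace {x. f x = 0}" by (rule linear_subspace_kernel[OF assms(1)])
    have "continuous_on UNIV f"
      using bounded_linear_if_dominated[OF assms(1,2)] by (simp add: linear_continuous_on)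
    then show "closed {x. f x = 0}" by (intro closed_Collect_eq continuous_on_const)
  qed (use assms in auto)
  then show ?thesis using assms(4) by blast
qed

text \<open>By Hahn-Banach, since a functional that vanishes on the span but not at \<open>w\<close>
  would contradict the convergence.\<close>

lemma weak_limit_in_closed_span:
  fixes v :: "nat \<Rightarrow> 'a::real_normed_vector"
  assumes v: "\<And>n. v n \<in> closed_span A" and lim: "\<And>f :: 'a \<Rightarrow> real. bounded_linear f \<Longrightarrow> (\<lambda>n. f (v n)) \<longlonglongrightarrow> f w"
  shows "w \<in> closed_span A"
proof (rule ccontr)
  assume "w \<notin> closed_span A"
  then obtain f :: "'a \<Rightarrow> real" where f: "bounded_linear f" "\<And>x. x \<in> closed_span A \<Longrightarrow> f x = 0" "f w \<noteq> 0"
    using separating_functional[OF subspace_closed_span closed_closed_span] by metis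
  then have "(\<lambda>n. f (v n)) \<longlonglongrightarrow> 0" using v by simp
  then show False using lim[OF f(1)] LIMSEQ_unique f(3) by blast
qed

text \<open>Coefficient functionals with index outside \<open>range r\<close> vanish on the span of
  the subsequence, so the expansion in the full sequence already is one in the subsequence.\<close>

lemma basic_sequence_subsequence:
  fixes x :: "nat \<Rightarrow> 'a::banach"
  assumes x: "basic_sequence x" and lower: "\<And>n. \<delta> \<le> norm (x n)" "\<delta> > 0" and r: "strict_mono r"
  shows "basic_sequence (x \<circ> r)"
proof -
  define S where "S = closed_span (range x)"
  define Y where "Y = closed_span (range (x \<circ> r))"
  interpret schauder S x unfolding S_def using x by (rule schauder_basic_sequence)
  obtain cf K where cf: "K > 0" "\<And>n. linear (cf n)" "\<And>n x. \<bar>cf n x\<bar> \<le> K * norm x"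
    "\<And>n m. cf n (x m) = (if n = m then 1 else 0)" "\<And>v. v \<in> S \<Longrightarrow> (\<lambda>n. cf n v *\<^sub>R x n) sums v"
    by (rule bounded_coef[OF lower]) (rule that)
  have YS: "Y \<subseteq> S" unfolding Y_def S_def
    by (intro closed_span_minimal subspace_closed_span closed_closed_span order_trans[OF _ subset_closed_span]) auto
  have inj: "r n = r m \<longleftrightarrow> n = m" for n m using r by (simp add: strict_mono_eq)
  have zero: "cf i v = 0" if "i \<notin> range r" "v \<in> Y" for i v
    by (rule zero_on_closed_span[OF cf(2) cf(3) _ that(2)[unfolded Y_def]]) (use that(1) cf(4) in auto)
  have "\<exists>!a. (\<lambda>n. a n *\<^sub>R (x \<circ> r) n) sums v" if v: "v \<in> Y" for v
  proof (rule ex1I)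
    have "(\<lambda>n. cf (r n) v *\<^sub>R x (r n)) sums v \<longleftrightarrow> (\<lambda>n. cf n v *\<^sub>R x n) sums v"
      by (rule sums_mono_reindex[OF r, of "\<lambda>n. cf n v *\<^sub>R x n"]) (simp add: zero v)
    then show "(\<lambda>n. cf (r n) v *\<^sub>R (x \<circ> r) n) sums v" using cf(5) v YS by auto
    fix a assume "(\<lambda>n. a n *\<^sub>R (x \<circ> r) n) sums v"
    then have a: "(\<lambda>n. cf (r m) (a n *\<^sub>R (x \<circ> r) n)) sums cf (r m) v" for m
      by (rule bounded_linear.sums[OF bounded_linear_if_dominated[OF cf(2,3)]])
    show "a = (\<lambda>n. cf (r n) v)"
    proof
      fix m
      have "(\<lambda>n. cf (r m) (a n *\<^sub>R (x \<circ> r) n)) = (\<lambda>n. if n = m then a n else 0)"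
        using cf(2) by (auto simp: linear_cmul cf(4) inj)
      then show "a m = cf (r m) v" using a[of m] sums_unique2[OF sums_single[of m a]] by auto
    qed
  qed
  moreover have "range (x \<circ> r) \<subseteq> Y" unfolding Y_def by (rule subset_closed_span)
  ultimately show ?thesis unfolding basic_sequence_def schauder_basis_of_def Y_def by blast
qed

section \<open>Shrinking bases\<close>

text \<open>\<open>shrink\<close> is the form in which the basis being shrinking is used: every
  bounded functional is a norm limit of finite combinations of the coordinate functionals.\<close>

locale shrinking_coordinates =
  fixes e :: "nat \<Rightarrow> 'a::banach" and E :: "nat \<Rightarrow> 'a \<Rightarrow> real" and K :: real
  assumes K_pos: "K > 0" and E_linear: "\<And>n. linear (E n)"
    and E_le: "\<And>n x. \<bar>E n x\<bar> \<le> K * norm x"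
    and E_e: "\<And>n m. E n (e m) = (if n = m then 1 else 0)"
    and E_sums: "\<And>x. (\<lambda>n. E n x *\<^sub>R e n) sums x"
    and proj_le: "\<And>x N. norm (\<Sum>n<N. E n x *\<^sub>R e n) \<le> K * norm x"
    and E_null: "\<And>x. (\<lambda>n. E n x) \<longlonglongrightarrow> 0"
    and shrink: "\<And>f d. bounded_linear f \<Longrightarrow> d > 0 \<Longrightarrow>
      \<exists>N. \<forall>x. \<bar>f x - f (\<Sum>n<N. E n x *\<^sub>R e n)\<bar> \<le> d * norm x"
begin

lemma E_bounded_linear: "bounded_linear (E n)"
  using E_linear E_le by (rule bounded_linear_if_dominated)

lemma E_diff: "E n (x - y) = E n x - E n y"
  using E_linear by (simp add: linear_diff)

lemma E_unique: "(\<lambda>n. c n *\<^sub>R e n) sums x \<Longrightarrow> E i x = c i"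
proof -
  assume "(\<lambda>n. c n *\<^sub>R e n) sums x"
  then have "(\<lambda>n. E i (c n *\<^sub>R e n)) sums E i x" by (rule bounded_linear.sums[OF E_bounded_linear])
  moreover have "(\<lambda>n. E i (c n *\<^sub>R e n)) = (\<lambda>n. if n = i then c n else 0)"
    using E_linear by (auto simp: linear_cmul E_e)
  ultimately show ?thesis using sums_unique2[OF sums_single[of i c]] by auto
qed

lemma linear_proj: "linear f \<Longrightarrow> f (\<Sum>n<N. E n x *\<^sub>R e n) = (\<Sum>n<N. E n x * (f (e n) :: real))"
  by (simp add: linear_sum linear_cmul)

text \<open>Up to a small multiple of the norm, a functional depends on finitely many coordinates
  only, and these converge.\<close>

lemma weak_Cauchy:
  assumes f: "bounded_linear f" and v: "\<And>n. norm (v n) \<le> C" and lim: "\<And>i. (\<lambda>n. E i (v n)) \<longlonglongrightarrow> l i"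
  shows "convergent (\<lambda>n. f (v n) :: real)"
proof -
  have "C \<ge> 0" using v[of 0] norm_ge_zero[of "v 0"] by linarith
  have "Cauchy (\<lambda>n. f (v n))"
  proof (rule metric_CauchyI)
    fix d :: real assume "d > 0"
    define d' where "d' = d / (4 * (C + 1))"
    have d': "d' > 0" "d' * C \<le> d / 4" using \<open>d > 0\<close> \<open>C \<ge> 0\<close> by (auto simp: d'_def field_simps)
    obtain N where N: "\<And>x. \<bar>f x - f (\<Sum>n<N. E n x *\<^sub>R e n)\<bar> \<le> d' * norm x"
      using shrink[OF f d'(1)] by blast
    define g where "g x = f (\<Sum>n<N. E n x *\<^sub>R e n)" for x
    have "(\<lambda>n. \<Sum>i<N. E i (v n) * f (e i)) \<longlonglongrightarrow> (\<Sum>i<N. l i * f (e i))"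
      by (intro tendsto_intros lim)
    then have "(\<lambda>n. g (v n)) \<longlonglongrightarrow> (\<Sum>i<N. l i * f (e i))"
      unfolding g_def linear_proj[OF bounded_linear.linear[OF f]] .
    then have "Cauchy (\<lambda>n. g (v n))" by (rule LIMSEQ_imp_Cauchy)
    then obtain M where M: "\<And>m n. m \<ge> M \<Longrightarrow> n \<ge> M \<Longrightarrow> dist (g (v m)) (g (v n)) < d / 2"
      using metric_CauchyD[of "\<lambda>n. g (v n)" "d / 2"] \<open>d > 0\<close> by auto
    have close: "\<bar>f (v n) - g (v n)\<bar> \<le> d / 4" for n
    proof -
      have "d' * norm (v n) \<le> d' * C" using v[of n] d'(1) by (intro mult_left_mono) auto
      then show ?thesis using N[of "v n"] d'(2) unfolding g_def by linarith
    qed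
    have "dist (f (v m)) (f (v n)) < d" if "m \<ge> M" "n \<ge> M" for m n
      using M[OF that] close[of m] close[of n] unfolding dist_real_def by linarith
    then show "\<exists>M. \<forall>m\<ge>M. \<forall>n\<ge>M. dist (f (v m)) (f (v n)) < d" by blast
  qed
  then show ?thesis by (rule Cauchy_convergent)
qed

lemma weak_null:
  assumes f: "bounded_linear f" and v: "\<And>n. norm (v n) \<le> C" and lim: "\<And>i. (\<lambda>n. E i (v n)) \<longlonglongrightarrow> 0"
  shows "(\<lambda>n. f (v n) :: real) \<longlonglongrightarrow> 0"
proof (rule LIMSEQ_I)
  have "C \<ge> 0" using v[of 0] norm_ge_zero[of "v 0"] by linarith
  fix d :: real assume "d > 0"
  define d' where "d' = d / (2 * (C + 1))"
  have d': "d' > 0" "d' * C \<le> d / 2" using \<open>d > 0\<close> \<open>C \<ge> 0\<close> by (auto simp: d'_def field_simps)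
  obtain N where N: "\<And>x. \<bar>f x - f (\<Sum>n<N. E n x *\<^sub>R e n)\<bar> \<le> d' * norm x"
    using shrink[OF f d'(1)] by blast
  have "(\<lambda>n. \<Sum>i<N. E i (v n) * f (e i)) \<longlonglongrightarrow> (\<Sum>i<N. 0 * f (e i))"
    by (intro tendsto_intros lim)
  then have "(\<lambda>n. f (\<Sum>i<N. E i (v n) *\<^sub>R e i)) \<longlonglongrightarrow> 0"
    unfolding linear_proj[OF bounded_linear.linear[OF f]] by simp
  then have "\<exists>M. \<forall>n\<ge>M. norm (f (\<Sum>i<N. E i (v n) *\<^sub>R e i) - 0) < d / 2" by (rule LIMSEQ_D) (use \<open>d > 0\<close> in simp)
  then obtain M where M: "\<And>n. n \<ge> M \<Longrightarrow> \<bar>f (\<Sum>i<N. E i (v n) *\<^sub>R e i)\<bar> < d / 2" by auto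
  have close: "\<bar>f (v n) - f (\<Sum>i<N. E i (v n) *\<^sub>R e i)\<bar> \<le> d / 2" for n
  proof -
    have "d' * norm (v n) \<le> d' * C" using v[of n] d'(1) by (intro mult_left_mono) auto
    then show ?thesis using N[of "v n"] d'(2) by linarith
  qed
  have "norm (f (v n) - 0) < d" if "n \<ge> M" for n
    using M[OF that] close[of n] unfolding real_norm_def by linarith
  then show "\<exists>M. \<forall>n\<ge>M. norm (f (v n) - 0) < d" by blast
qed

lemma weak_limit:
  assumes f: "bounded_linear f" and v: "\<And>n. norm (v n) \<le> C" and lim: "\<And>i. (\<lambda>n. E i (v n)) \<longlonglongrightarrow> E i w"
  shows "(\<lambda>n. f (v n) :: real) \<longlonglongrightarrow> f w"
proof -
  have "(\<lambda>n. f (v n - w)) \<longlonglongrightarrow> 0"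
  proof (rule weak_null[OF f])
    show "norm (v n - w) \<le> C + norm w" for n
      using norm_triangle_ineq4[of "v n" w] v[of n] by linarith
    show "(\<lambda>n. E i (v n - w)) \<longlonglongrightarrow> 0" for i
      unfolding E_diff using lim[of i] by (rule LIM_zero)
  qed
  then show ?thesis using bounded_linear.linear[OF f] by (simp add: linear_diff LIM_zero_iff)
qed

text \<open>\<open>fast z p \<mu>\<close>: up to small errors, the coordinates of \<open>z n\<close> are \<open>\<mu>\<close> up to \<open>p n\<close>
  and vanish beyond \<open>p (n + 1)\<close>.\<close>

definition fast :: "(nat \<Rightarrow> 'a) \<Rightarrow> (nat \<Rightarrow> nat) \<Rightarrow> (nat \<Rightarrow> real) \<Rightarrow> bool" where
  "fast z p \<mu> \<longleftrightarrow> strict_mono p \<and> (\<forall>n i. i \<le> p n \<longrightarrow> \<bar>E i (z n) - \<mu> i\<bar> \<le> (1/2) ^ n) \<and>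
    (\<forall>n k i. n < k \<longrightarrow> p k < i \<longrightarrow> \<bar>E i (z n)\<bar> \<le> (1/4) ^ k)"

lemma fast_subsequence:
  assumes "fast z p \<mu>" "strict_mono r"
  shows "fast (z \<circ> r) (p \<circ> r) \<mu>"
  unfolding fast_def
proof (intro conjI allI impI)
  show "strict_mono (p \<circ> r)" using assms by (auto simp: fast_def intro: strict_mono_o)
  have r: "n \<le> r n" for n using strict_mono_imp_increasing[OF assms(2)] .
  show "\<bar>E i ((z \<circ> r) n) - \<mu> i\<bar> \<le> (1/2) ^ n" if "i \<le> (p \<circ> r) n" for n i
  proof -
    have "\<bar>E i (z (r n)) - \<mu> i\<bar> \<le> (1/2) ^ r n" using assms(1) that by (simp add: fast_def)
    then show ?thesis unfolding o_apply using half_power_mono[OF r[of n]] by (rule order_trans)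
  qed
  show "\<bar>E i ((z \<circ> r) n)\<bar> \<le> (1/4) ^ k" if "n < k" "(p \<circ> r) k < i" for n k i
  proof -
    have "\<bar>E i (z (r n))\<bar> \<le> (1/4) ^ r k" using assms that by (simp add: fast_def strict_mono_less)
    also have "(1/4::real) ^ r k \<le> (1/4) ^ k" using r[of k] by (intro power_decreasing) auto
    finally show ?thesis by simp
  qed
qed

text \<open>At each stage the coordinate bound comes first: beyond it all vectors chosen before are
  small. Then a vector is taken that is close to \<mu> on every coordinate up to this bound.\<close>

lemma fast_exists:
  assumes lim: "\<And>i. (\<lambda>n. E i (v n)) \<longlonglongrightarrow> \<mu> i"
  obtains s p where "strict_mono s" "fast (v \<circ> s) p \<mu>"
proof -
  define P where "P f k ab \<longleftrightarrow> (\<forall>n<k. fst (f n) < fst ab \<and> snd (f n) < snd ab \<and> (\<forall>i>snd ab. \<bar>E i (v (fst (f n)))\<bar> \<le> (1/4) ^ k)) \<and>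
      (\<forall>i\<le>snd ab. \<bar>E i (v (fst ab)) - \<mu> i\<bar> \<le> (1/2) ^ k)" for f :: "nat \<Rightarrow> nat \<times> nat" and k ab
  have "\<exists>f. \<forall>k. P f k (f k)"
  proof (rule dependent_wellorder_choice)
    show "P f k ab = P g k ab" if "\<And>n. n < k \<Longrightarrow> f n = g n" for ab f g k
      using that by (simp add: P_def)
    show "\<exists>ab. P f k ab" for k f
    proof -
      have ev: "eventually (\<lambda>i. \<bar>E i (v a)\<bar> \<le> (1/4) ^ k) sequentially" for a
        using order_tendstoD(2)[OF tendsto_rabs_zero[OF E_null[of "v a"]], of "(1/4) ^ k"]
        by (auto elim!: eventually_mono)
      have "eventually (\<lambda>i. \<forall>n\<in>{..<k}. \<bar>E i (v (fst (f n)))\<bar> \<le> (1/4) ^ k \<and> snd (f n) < i) sequentially"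
        using ev by (intro eventually_ball_finite ballI eventually_conj eventually_gt_at_top) auto
      then obtain b where b: "\<And>i. i \<ge> b \<Longrightarrow> \<forall>n\<in>{..<k}. \<bar>E i (v (fst (f n)))\<bar> \<le> (1/4) ^ k \<and> snd (f n) < i"
        unfolding eventually_sequentially by blast
      have ev2: "eventually (\<lambda>a. \<bar>E i (v a) - \<mu> i\<bar> \<le> (1/2) ^ k) sequentially" for i
        using order_tendstoD(2)[OF tendsto_rabs_zero[OF LIM_zero[OF lim[of i]]], of "(1/2) ^ k"]
        by (auto elim!: eventually_mono)
      have "eventually (\<lambda>a. (\<forall>i\<in>{..b}. \<bar>E i (v a) - \<mu> i\<bar> \<le> (1/2) ^ k) \<and> (\<forall>n\<in>{..<k}. fst (f n) < a)) sequentially"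
        using ev2 by (intro eventually_ball_finite ballI eventually_conj eventually_gt_at_top) auto
      then obtain a where a: "\<forall>i\<in>{..b}. \<bar>E i (v a) - \<mu> i\<bar> \<le> (1/2) ^ k" "\<forall>n\<in>{..<k}. fst (f n) < a"
        using eventually_happens' sequentially_bot by blast
      have "P f k (a, b)" unfolding P_def using a b by auto
      then show ?thesis by blast
    qed
  qed
  then obtain f where f: "\<And>k. P f k (f k)" by blast
  show thesis
  proof (rule that[of "\<lambda>k. fst (f k)" "\<lambda>k. snd (f k)"])
    show "strict_mono (\<lambda>k. fst (f k))" using f unfolding P_def strict_mono_def by blast
    have "strict_mono (\<lambda>k. snd (f k))" using f unfolding P_def strict_mono_def by blast
    then show "fast (v \<circ> (\<lambda>k. fst (f k))) (\<lambda>k. snd (f k)) \<mu>"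
      unfolding fast_def using f unfolding P_def comp_def by blast
  qed
qed

lemma fast_le:
  assumes "fast z p \<mu>" "i \<le> n" shows "\<bar>E i (z n) - \<mu> i\<bar> \<le> (1/2) ^ n"
proof -
  have "n \<le> p n" using assms(1) strict_mono_imp_increasing by (auto simp: fast_def)
  then show ?thesis using assms by (auto simp: fast_def)
qed

lemma fast_lim:
  assumes "fast z p \<mu>" shows "(\<lambda>n. E i (z n)) \<longlonglongrightarrow> \<mu> i"
proof -
  have "eventually (\<lambda>n. norm (E i (z n) - \<mu> i) \<le> (1/2) ^ n) sequentially"
    unfolding eventually_sequentially using fast_le[OF assms] by auto
  then have "(\<lambda>n. E i (z n) - \<mu> i) \<longlonglongrightarrow> 0"
    by (rule Lim_null_comparison) (intro LIMSEQ_power_zero, simp)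
  then show ?thesis by (simp add: LIM_zero_iff)
qed

text \<open>For \<open>p k < i \<le> p (Suc k)\<close>, the vectors before \<open>z k\<close>
  contribute almost nothing to coordinate \<open>i\<close> and a later vector \<open>z n\<close>
  contributes about \<open>a n * \<mu> i\<close>. So the limit coordinate \<open>c i\<close> is
  close to \<open>a k * E i (z k)\<close> plus \<open>\<mu> i\<close> times a remainder of the sum
  of the \<open>a n\<close>; \<open>Q\<close> makes both tend to 0. Then \<open>super\<close> yields
  a vector with coordinates \<open>c\<close>, to which the partial sums converge weakly.\<close>

lemma boundedly_complete_if_fast:
  assumes super: "\<And>a :: nat \<Rightarrow> real. bounded (range (\<lambda>n. \<Sum>i<n. a i *\<^sub>R e i)) \<Longrightarrow> a \<longlonglongrightarrow> 0 \<Longrightarrow> summable (\<lambda>n. a n *\<^sub>R e n)"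
    and z: "basic_sequence z" and lower: "\<And>n. \<delta> \<le> norm (z n)" "\<delta> > 0" and upper: "\<And>n. norm (z n) \<le> C"
    and fast: "fast z p \<mu>"
    and Q: "\<And>a. bounded (range (\<lambda>N. \<Sum>n<N. a n *\<^sub>R z n)) \<Longrightarrow> a \<longlonglongrightarrow> 0 \<and> ((\<forall>i. \<mu> i = 0) \<or> convergent (\<lambda>N. \<Sum>n<N. a n))"
  shows "boundedly_complete z"
proof -
  interpret schauder "closed_span (range z)" z using z by (rule schauder_basic_sequence)
  obtain cf Kz where cf: "\<And>n. linear (cf n)" "\<And>n x. \<bar>cf n x\<bar> \<le> Kz * norm x"
    "\<And>n m. cf n (z m) = (if n = m then 1 else 0)" "\<And>v. v \<in> closed_span (range z) \<Longrightarrow> (\<lambda>n. cf n v *\<^sub>R z n) sums v"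
    by (rule bounded_coef[OF lower]) (rule that)
  have C0: "C \<ge> 0" using upper[of 0] norm_ge_zero[of "z 0"] by linarith
  have p: "strict_mono p" using fast by (simp add: fast_def)
  have Ez: "\<bar>E i (z n)\<bar> \<le> K * C" for i n
    using E_le[of i "z n"] mult_left_mono[OF upper[of n], of K] K_pos by linarith
  have L: "\<bar>\<mu> i\<bar> \<le> K * C" for i
    by (rule LIMSEQ_le_const2[OF tendsto_rabs[OF fast_lim[OF fast]]]) (use Ez in blast)
  have "summable (\<lambda>n. a n *\<^sub>R z n)" if bd: "bounded (range (\<lambda>N. \<Sum>n<N. a n *\<^sub>R z n))" for a
  proof -
    define S where "S N = (\<Sum>n<N. a n *\<^sub>R z n)" for N
    obtain D where D: "\<And>N. norm (S N) \<le> D" using bd by (auto simp: bounded_iff S_def)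
    have a0: "a \<longlonglongrightarrow> 0" using Q[OF bd] by blast
    then have "Bseq a" using convergentI convergent_imp_Bseq by blast
    then obtain A where A: "A > 0" "\<And>n. \<bar>a n\<bar> \<le> A" by (auto simp: Bseq_def)
    \<comment> \<open>If \<mu> vanishes, the sums of the \<open>a n\<close> need not converge; they
      occur only multiplied by \<mu>, so 0 may replace them.\<close>
    define d where "d N = (if \<forall>i. \<mu> i = 0 then 0 else \<Sum>n<N. a n)" for N
    have "convergent d"
    proof (cases "\<forall>i. \<mu> i = 0")
      case True
      then have "d = (\<lambda>N. 0)" by (intro ext) (simp add: d_def)
      then show ?thesis by (simp add: convergent_const)
    next
      case False
      then have "d = (\<lambda>N. \<Sum>n<N. a n)" by (intro ext) (simp only: d_def if_False)
      then show ?thesis using Q[OF bd] False by simp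
    qed
    then obtain \<sigma> where \<sigma>: "d \<longlonglongrightarrow> \<sigma>" by (auto simp: convergent_def)
    have \<mu>d: "\<mu> i * (\<Sum>n<N. a n) = \<mu> i * d N" for i N by (simp add: d_def)
    define t where "t i n = a n * (E i (z n) - \<mu> i)" for i n
    have t_le: "norm (t i n) \<le> A * (1/2) ^ n" if "\<bar>E i (z n) - \<mu> i\<bar> \<le> (1/2) ^ n" for i n
      unfolding t_def real_norm_def abs_mult using A that by (intro mult_mono) auto
    have geom: "summable (\<lambda>n. A * (1/2::real) ^ n)" by (intro summable_mult summable_geometric) auto
    have t_sum: "summable (t i)" for i
      by (rule summable_comparison_test'[OF geom, of i]) (use t_le fast_le[OF fast] in blast)
    define c where "c i = suminf (t i) + \<mu> i * \<sigma>" for i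
    have ES: "E i (S N) = (\<Sum>n<N. t i n) + \<mu> i * d N" for i N
    proof -
      have "E i (S N) = (\<Sum>n<N. a n * E i (z n))" unfolding S_def using E_linear by (simp add: linear_sum linear_cmul)
      also have "\<dots> = (\<Sum>n<N. t i n) + \<mu> i * (\<Sum>n<N. a n)"
        by (simp add: t_def sum_distrib_left algebra_simps flip: sum.distrib)
      finally show ?thesis by (simp only: \<mu>d)
    qed
    have ES_lim: "(\<lambda>N. E i (S N)) \<longlonglongrightarrow> c i" for i
      unfolding ES c_def by (intro tendsto_add tendsto_mult tendsto_const \<sigma> summable_LIMSEQ t_sum)
    \<comment> \<open>The three summands bound the errors of the vectors other than
      \<open>z k\<close>, the term of \<open>z k\<close> itself, and the remainder of the sum of
      coefficients.\<close>
    define \<beta> where "\<beta> k = 2 * A * (1/2) ^ k + \<bar>a k\<bar> * (K * C) + K * C * \<bar>\<sigma> - d (Suc k)\<bar>" for k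
    have c_le: "\<bar>c i\<bar> \<le> \<beta> k" if i: "p k < i" "i \<le> p (Suc k)" for i k
    proof -
      have "suminf (t i) = (\<Sum>n. t i (n + Suc k)) + (\<Sum>n<Suc k. t i n)"
        by (rule suminf_split_initial_segment[OF t_sum])
      moreover have "(\<Sum>n<Suc k. t i n) = E i (S (Suc k)) - \<mu> i * d (Suc k)" by (simp add: ES)
      moreover have "E i (S (Suc k)) = (\<Sum>n<k. a n * E i (z n)) + a k * E i (z k)"
        unfolding S_def using E_linear by (simp add: linear_sum linear_add linear_cmul)
      ultimately have c_eq: "c i = (\<Sum>n. t i (n + Suc k)) + (\<Sum>n<k. a n * E i (z n)) + a k * E i (z k) + \<mu> i * (\<sigma> - d (Suc k))"
        unfolding c_def by (simp add: right_diff_distrib)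
      \<comment> \<open>There are \<open>k\<close> earlier vectors, and \<open>k\<close> is at most
        \<open>2 ^ k\<close>; the rate \<open>(1/4) ^ k\<close> in \<open>fast\<close> therefore
        leaves \<open>(1/2) ^ k\<close> for their sum.\<close>
      have "\<bar>\<Sum>n<k. a n * E i (z n)\<bar> \<le> (\<Sum>n<k. A * (1/4) ^ k)"
      proof (intro order_trans[OF sum_abs] sum_mono)
        fix n assume "n \<in> {..<k}"
        then have "\<bar>E i (z n)\<bar> \<le> (1/4) ^ k" using fast i(1) by (simp add: fast_def)
        then show "\<bar>a n * E i (z n)\<bar> \<le> A * (1/4) ^ k" unfolding abs_mult using A by (intro mult_mono) auto
      qed
      also have "\<dots> = A * (real k * (1/4) ^ k)" by simp
      also have "\<dots> \<le> A * (1/2) ^ k"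
      proof (intro mult_left_mono)
        have "real k * (1/4) ^ k \<le> 2 ^ k * (1/4) ^ k"
          using of_nat_less_two_power[of k] by (intro mult_right_mono) (auto simp: less_imp_le)
        also have "\<dots> = (1/2) ^ k" by (simp flip: power_mult_distrib)
        finally show "real k * (1/4) ^ k \<le> (1/2) ^ k" .
      qed (use A in simp)
      finally have 1: "\<bar>\<Sum>n<k. a n * E i (z n)\<bar> \<le> A * (1/2) ^ k" .
      have "norm (\<Sum>n. t i (n + Suc k)) \<le> (\<Sum>n. A * (1/2) ^ (n + Suc k))"
      proof (rule norm_suminf_le)
        fix n
        have "p (Suc k) \<le> p (n + Suc k)" using p by (simp add: strict_mono_less_eq)
        then have "\<bar>E i (z (n + Suc k)) - \<mu> i\<bar> \<le> (1/2) ^ (n + Suc k)"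
          using fast i(2) unfolding fast_def by (meson order_trans)
        then show "norm (t i (n + Suc k)) \<le> A * (1/2) ^ (n + Suc k)" by (rule t_le)
      qed (rule summable_ignore_initial_segment[OF geom])
      also have "(\<Sum>n. A * (1/2) ^ (n + Suc k)) = (\<Sum>n. (A * (1/2) ^ Suc k) * (1/2) ^ n)"
        by (simp add: power_add mult_ac)
      also have "\<dots> = A * (1/2) ^ k"
        using suminf_geometric[of "1/2::real"] by (subst suminf_mult) (auto intro: summable_geometric)
      finally have 2: "\<bar>\<Sum>n. t i (n + Suc k)\<bar> \<le> A * (1/2) ^ k" by simp
      have 3: "\<bar>a k * E i (z k)\<bar> \<le> \<bar>a k\<bar> * (K * C)" unfolding abs_mult using Ez by (intro mult_left_mono) auto
      have 4: "\<bar>\<mu> i * (\<sigma> - d (Suc k))\<bar> \<le> K * C * \<bar>\<sigma> - d (Suc k)\<bar>" unfolding abs_mult using L by (intro mult_right_mono) auto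
      show ?thesis unfolding c_eq \<beta>_def using 1 2 3 4 by linarith
    qed
    have "(\<lambda>k. d (Suc k)) \<longlonglongrightarrow> \<sigma>" using \<sigma> by (rule LIMSEQ_Suc)
    then have "(\<lambda>k. \<sigma> - d (Suc k)) \<longlonglongrightarrow> \<sigma> - \<sigma>" by (intro tendsto_diff tendsto_const)
    moreover have "(\<lambda>k. (1/2::real) ^ k) \<longlonglongrightarrow> 0" by (rule LIMSEQ_power_zero) simp
    ultimately have "\<beta> \<longlonglongrightarrow> 2 * A * 0 + \<bar>0\<bar> * (K * C) + K * C * \<bar>\<sigma> - \<sigma>\<bar>"
      unfolding \<beta>_def using a0 by (intro tendsto_add tendsto_mult tendsto_const tendsto_rabs)
    then have \<beta>0: "\<beta> \<longlonglongrightarrow> 0" by simp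
    have "c \<longlonglongrightarrow> 0"
    proof (rule LIMSEQ_I)
      fix r :: real assume "r > 0"
      then obtain k0 where k0: "\<And>k. k \<ge> k0 \<Longrightarrow> \<beta> k < r"
        using order_tendstoD(2)[OF \<beta>0] by (auto simp: eventually_sequentially)
      have "norm (c i - 0) < r" if i: "i \<ge> Suc (p k0)" for i
      proof -
        \<comment> \<open>The least \<open>m\<close> with \<open>i \<le> p m\<close> locates the
          block containing \<open>i\<close>.\<close>
        define m where "m = (LEAST m. i \<le> p m)"
        have "i \<le> p i" using strict_mono_imp_increasing[OF p] .
        then have m: "i \<le> p m" unfolding m_def by (rule LeastI)
        then have "k0 < m" using i p by (metis Suc_le_lessD less_le_trans strict_mono_less)
        then obtain k where k: "m = Suc k" "k0 \<le> k" by (cases m) auto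
        then have "p k < i" unfolding m_def using not_less_Least[of k "\<lambda>m. i \<le> p m"] by (metis lessI m_def not_le)
        then show ?thesis using c_le[of k i] m k k0[of k] by simp
      qed
      then show "\<exists>no. \<forall>i\<ge>no. norm (c i - 0) < r" by blast
    qed
    moreover have "bounded (range (\<lambda>M. \<Sum>i<M. c i *\<^sub>R e i))"
    proof -
      have "norm (\<Sum>i<M. c i *\<^sub>R e i) \<le> K * D" for M
      proof (rule LIMSEQ_le_const2)
        show "(\<lambda>N. norm (\<Sum>i<M. E i (S N) *\<^sub>R e i)) \<longlonglongrightarrow> norm (\<Sum>i<M. c i *\<^sub>R e i)"
          by (intro tendsto_norm tendsto_sum tendsto_scaleR tendsto_const ES_lim)
        show "\<exists>N0. \<forall>N\<ge>N0. norm (\<Sum>i<M. E i (S N) *\<^sub>R e i) \<le> K * D"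
          using proj_le mult_left_mono[OF D, of K] K_pos by (meson less_imp_le order_trans)
      qed
      then show ?thesis by (auto simp: bounded_iff)
    qed
    ultimately have "summable (\<lambda>i. c i *\<^sub>R e i)" using super by blast
    then obtain w where w: "(\<lambda>i. c i *\<^sub>R e i) sums w" by (auto simp: summable_def)
    have Ew: "E i w = c i" for i using w by (rule E_unique)
    have weak: "(\<lambda>N. f (S N)) \<longlonglongrightarrow> f w" if "bounded_linear f" for f :: "'a \<Rightarrow> real"
      using ES_lim by (intro weak_limit[OF that D]) (simp add: Ew)
    have "S N \<in> closed_span (range z)" for N unfolding S_def
      using subset_closed_span[of "range z"] by (intro subspace_sum subspace_scale subspace_closed_span) auto
    then have wZ: "w \<in> closed_span (range z)" using weak by (rule weak_limit_in_closed_span)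
    \<comment> \<open>Weak convergence preserves the coordinates with respect to \<open>z\<close>,
      so the given series is the norm convergent expansion of \<open>w\<close>.\<close>
    have "cf n w = a n" for n
    proof -
      have "cf n (S N) = a n" if "N \<ge> Suc n" for N
      proof -
        have "cf n (S N) = (\<Sum>m<N. a m * (if n = m then 1 else 0))"
          unfolding S_def using cf(1)[of n] by (simp add: linear_sum linear_cmul cf(3))
        also have "\<dots> = (\<Sum>m<N. if m = n then a m else 0)" by (intro sum.cong) auto
        also have "\<dots> = a n" using that by simp
        finally show ?thesis .
      qed
      then have "(\<lambda>N. cf n (S N)) \<longlonglongrightarrow> a n"
        by (intro tendsto_eventually) (auto simp: eventually_sequentially)
      then show ?thesis using weak[OF bounded_linear_if_dominated[OF cf(1,2)]] LIMSEQ_unique by blast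
    qed
    then show ?thesis using cf(4)[OF wZ] by (simp add: sums_iff)
  qed
  then show ?thesis using z by (simp add: boundedly_complete_def)
qed

end

section \<open>Biduals\<close>

definition restr :: "'a set \<Rightarrow> ('a \<Rightarrow> real) \<Rightarrow> 'a \<Rightarrow> real" where
  "restr Y g = (\<lambda>v. if v \<in> Y then g v else 0)"

lemma dualD:
  assumes "f \<in> dual Y"
  shows "\<And>x y. x \<in> Y \<Longrightarrow> y \<in> Y \<Longrightarrow> f (x + y) = f x + f y"
    "\<And>c x. x \<in> Y \<Longrightarrow> f (c *\<^sub>R x) = c * f x" "\<And>x. x \<notin> Y \<Longrightarrow> f x = 0"
    "\<exists>B. \<forall>x\<in>Y. \<bar>f x\<bar> \<le> B * norm x"
  using assms unfolding dual_def dual_space_def by blast+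

lemma restr_in_dual:
  assumes "subspace Y" "bounded_linear g" shows "restr Y g \<in> dual Y"
proof -
  obtain B where "\<And>x. \<bar>g x\<bar> \<le> norm x * B" using bounded_linear.bounded[OF assms(2)] by auto
  moreover have "linear g" using assms(2) by (rule bounded_linear.linear)
  ultimately show ?thesis using assms(1)
    by (auto simp: dual_def dual_space_def restr_def linear_add linear_cmul subspace_add subspace_scale
        mult.commute intro!: exI[of _ B])
qed

text \<open>By Hahn-Banach. It allows the bidual of \<open>Y\<close> to be studied through
  functionals on the whole space, in particular through the coordinate functionals of the ambient
  basis.\<close>

lemma dual_restr:
  fixes Y :: "'a::real_normed_vector set"
  assumes Y: "subspace Y" and f: "f \<in> dual Y"
  obtains g where "bounded_linear g" "f = restr Y g"
proof -
  obtain B where B: "\<And>x. x \<in> Y \<Longrightarrow> \<bar>f x\<bar> \<le> B * norm x" using dualD(4)[OF f] by blast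
  have B': "\<bar>f x\<bar> \<le> \<bar>B\<bar> * norm x" if "x \<in> Y" for x
    using B[OF that] mult_right_mono[OF abs_ge_self[of B], of "norm x"] by simp
  obtain g where g: "linear g" "\<And>x. \<bar>g x\<bar> \<le> \<bar>B\<bar> * norm x" "\<And>x. x \<in> Y \<Longrightarrow> g x = f x"
    by (rule Hahn_Banach[OF Y, of f "\<bar>B\<bar>"]) (use dualD[OF f] B' in auto)
  show thesis
  proof
    show "bounded_linear g" using g(1,2) by (rule bounded_linear_if_dominated)
    show "f = restr Y g" using g(3) dualD(3)[OF f] by (auto simp: restr_def)
  qed
qed

lemma functional_norm_le:
  fixes Y :: "'a::real_normed_vector set"
  assumes "0 \<in> Y" "\<And>v. v \<in> Y \<Longrightarrow> \<bar>f v\<bar> \<le> B * norm v" "B \<ge> 0"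
  shows "functional_norm Y norm f \<le> B"
  unfolding functional_norm_def
proof (rule cSUP_least)
  show "{x \<in> Y. norm x \<le> 1} \<noteq> {}" using assms(1) by (auto intro!: exI[of _ 0])
  fix x assume "x \<in> {x \<in> Y. norm x \<le> 1}"
  then show "\<bar>f x\<bar> \<le> B" using assms(2)[of x] mult_left_mono[of "norm x" 1 B] assms(3) by auto
qed

lemma le_functional_norm:
  fixes Y :: "'a::real_normed_vector set"
  assumes Y: "subspace Y" and scale: "\<And>c v. v \<in> Y \<Longrightarrow> f (c *\<^sub>R v) = c * f v"
    and B: "\<And>v. v \<in> Y \<Longrightarrow> \<bar>f v\<bar> \<le> B * norm v" and v: "v \<in> Y"
  shows "\<bar>f v\<bar> \<le> functional_norm Y norm f * norm v"
proof (cases "v = 0")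
  case True
  then show ?thesis using scale[OF v, of 0] by simp
next
  case False
  define u where "u = (1 / norm v) *\<^sub>R v"
  have u: "u \<in> Y" "norm u \<le> 1" using subspace_scale[OF Y v] False by (auto simp: u_def)
  have "\<bar>f x\<bar> \<le> \<bar>B\<bar>" if "x \<in> Y" "norm x \<le> 1" for x
  proof -
    have "\<bar>f x\<bar> \<le> B * norm x" by (rule B) fact
    also have "\<dots> \<le> \<bar>B\<bar> * norm x" by (intro mult_right_mono) auto
    also have "\<dots> \<le> \<bar>B\<bar> * 1" using that by (intro mult_left_mono) auto
    finally show ?thesis by simp
  qed
  then have "bdd_above ((\<lambda>x. \<bar>f x\<bar>) ` {x \<in> Y. norm x \<le> 1})" by (intro bdd_aboveI2[of _ _ "\<bar>B\<bar>"]) auto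
  then have "\<bar>f u\<bar> \<le> functional_norm Y norm f" unfolding functional_norm_def using u by (intro cSUP_upper) auto
  moreover have "\<bar>f v\<bar> = \<bar>f u\<bar> * norm v" using scale[OF v, of "1 / norm v"] False by (simp add: u_def abs_mult)
  ultimately show ?thesis by (simp add: mult_right_mono)
qed

lemma le_functional_norm_dual:
  assumes "subspace Y" "f \<in> dual Y" "v \<in> Y"
  shows "\<bar>f v\<bar> \<le> functional_norm Y norm f * norm v"
proof -
  obtain B where "\<And>x. x \<in> Y \<Longrightarrow> \<bar>f x\<bar> \<le> B * norm x" using dualD(4)[OF assms(2)] by blast
  then show ?thesis using le_functional_norm[OF assms(1) _ _ assms(3)] dualD(2)[OF assms(2)] by blast
qed

text \<open>Composed with restriction to \<open>Y\<close>, an element of the bidual becomes a map on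
  all functions, for which linearity makes sense at bounded linear arguments only.\<close>

definition linear_on_duals :: "(('a::real_normed_vector \<Rightarrow> real) \<Rightarrow> real) \<Rightarrow> bool" where
  "linear_on_duals \<Phi> \<longleftrightarrow>
     (\<forall>g h. bounded_linear g \<longrightarrow> bounded_linear h \<longrightarrow> \<Phi> (\<lambda>x. g x + h x) = \<Phi> g + \<Phi> h) \<and>
     (\<forall>c g. bounded_linear g \<longrightarrow> \<Phi> (\<lambda>x. c * g x) = c * \<Phi> g)"

lemma linear_on_duals_add:
  "linear_on_duals \<Phi> \<Longrightarrow> bounded_linear g \<Longrightarrow> bounded_linear h \<Longrightarrow> \<Phi> (\<lambda>x. g x + h x) = \<Phi> g + \<Phi> h"
  by (simp add: linear_on_duals_def)

lemma linear_on_duals_scale: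
  "linear_on_duals \<Phi> \<Longrightarrow> bounded_linear g \<Longrightarrow> \<Phi> (\<lambda>x. c * g x) = c * \<Phi> g"
  by (simp add: linear_on_duals_def)

lemma linear_on_duals_diff:
  assumes "linear_on_duals \<Phi>" "bounded_linear g" "bounded_linear h"
  shows "\<Phi> (\<lambda>x. g x - h x) = \<Phi> g - \<Phi> h"
proof -
  have "bounded_linear (\<lambda>x. - 1 * h x)" using assms(3) by (intro bounded_linear_const_mult)
  then have "\<Phi> (\<lambda>x. g x + - 1 * h x) = \<Phi> g + - 1 * \<Phi> h"
    by (simp only: linear_on_duals_add[OF assms(1,2)] linear_on_duals_scale[OF assms(1,3)])
  then show ?thesis by simp
qed

lemma bounded_linear_finite_comb:
  fixes N :: nat and b :: "nat \<Rightarrow> real"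
  shows "(\<And>n. bounded_linear (h n)) \<Longrightarrow> bounded_linear (\<lambda>x. \<Sum>n<N. b n * h n x)"
  by (intro bounded_linear_sum bounded_linear_const_mult)

lemma linear_on_duals_sum:
  fixes N :: nat
  assumes \<Phi>: "linear_on_duals \<Phi>" and h: "\<And>n. bounded_linear (h n)"
  shows "\<Phi> (\<lambda>x. \<Sum>n<N. b n * h n x) = (\<Sum>n<N. b n * \<Phi> (h n))"
proof (induction N)
  case 0
  have "\<Phi> (\<lambda>x. 0 * h 0 x) = 0 * \<Phi> (h 0)" by (rule linear_on_duals_scale[OF \<Phi> h])
  then show ?case by simp
next
  case (Suc N)
  have "\<Phi> (\<lambda>x. (\<Sum>n<N. b n * h n x) + b N * h N x) = \<Phi> (\<lambda>x. \<Sum>n<N. b n * h n x) + \<Phi> (\<lambda>x. b N * h N x)"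
    by (rule linear_on_duals_add[OF \<Phi> bounded_linear_finite_comb[of h, OF h] bounded_linear_const_mult[OF h]])
  also have "\<Phi> (\<lambda>x. b N * h N x) = b N * \<Phi> (h N)" by (rule linear_on_duals_scale[OF \<Phi> h])
  finally show ?case using Suc by simp
qed

lemma bidualD:
  assumes "F \<in> bidual Y"
  shows "\<forall>f\<in>dual Y. \<forall>h\<in>dual Y. F (\<lambda>x. f x + h x) = F f + F h"
    "\<forall>c. \<forall>f\<in>dual Y. F (\<lambda>x. c * f x) = c * F f"
    "\<exists>C. \<forall>f\<in>dual Y. \<bar>F f\<bar> \<le> C * functional_norm Y norm f"
    "\<forall>f. f \<notin> dual Y \<longrightarrow> F f = 0"
  using assms unfolding bidual_def dual_space_def[of "dual Y"] mem_Collect_eq by simp_all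

lemma bidual_restr:
  fixes Y :: "'a::real_normed_vector set"
  assumes Y: "subspace Y" and F: "F \<in> bidual Y"
  obtains C where "C \<ge> 0" "linear_on_duals (\<lambda>g. F (restr Y g))"
    "\<And>g B. bounded_linear g \<Longrightarrow> B \<ge> 0 \<Longrightarrow> (\<And>v. v \<in> Y \<Longrightarrow> \<bar>g v\<bar> \<le> B * norm v) \<Longrightarrow> \<bar>F (restr Y g)\<bar> \<le> C * B"
proof -
  obtain C where C: "\<And>f. f \<in> dual Y \<Longrightarrow> \<bar>F f\<bar> \<le> C * functional_norm Y norm f"
    and add: "\<And>f h. f \<in> dual Y \<Longrightarrow> h \<in> dual Y \<Longrightarrow> F (\<lambda>x. f x + h x) = F f + F h"
    and scale: "\<And>c f. f \<in> dual Y \<Longrightarrow> F (\<lambda>x. c * f x) = c * F f"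
    using bidualD(1-3)[OF F] by fast
  show thesis
  proof (rule that[of "\<bar>C\<bar>"])
    show "linear_on_duals (\<lambda>g. F (restr Y g))"
      unfolding linear_on_duals_def
    proof (intro conjI allI impI)
      fix g h :: "'a \<Rightarrow> real" assume "bounded_linear g" "bounded_linear h"
      moreover have "restr Y (\<lambda>x. g x + h x) = (\<lambda>x. restr Y g x + restr Y h x)" by (auto simp: restr_def)
      ultimately show "F (restr Y (\<lambda>x. g x + h x)) = F (restr Y g) + F (restr Y h)"
        using add restr_in_dual[OF Y] by simp
    next
      fix c and g :: "'a \<Rightarrow> real" assume "bounded_linear g"
      moreover have "restr Y (\<lambda>x. c * g x) = (\<lambda>x. c * restr Y g x)" by (auto simp: restr_def)
      ultimately show "F (restr Y (\<lambda>x. c * g x)) = c * F (restr Y g)"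
        using scale restr_in_dual[OF Y] by simp
    qed
    fix g :: "'a \<Rightarrow> real" and B assume g: "bounded_linear g" and B: "B \<ge> 0" "\<And>v. v \<in> Y \<Longrightarrow> \<bar>g v\<bar> \<le> B * norm v"
    have le: "functional_norm Y norm (restr Y g) \<le> B"
      using B subspace_0[OF Y] by (intro functional_norm_le) (auto simp: restr_def)
    have "0 \<le> functional_norm Y norm (restr Y g)"
      unfolding functional_norm_def
    proof (rule cSUP_upper2[of _ _ 0])
      have "\<bar>restr Y g x\<bar> \<le> B" if "x \<in> Y" "norm x \<le> 1" for x
        using B(2)[OF that(1)] mult_left_mono[OF that(2) B(1)] that(1) by (simp add: restr_def)
      then show "bdd_above ((\<lambda>x. \<bar>restr Y g x\<bar>) ` {x \<in> Y. norm x \<le> 1})" by (intro bdd_aboveI2[of _ _ B]) auto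
    qed (use subspace_0[OF Y] in auto)
    then have "C * functional_norm Y norm (restr Y g) \<le> \<bar>C\<bar> * B" using le by (intro mult_mono) auto
    then show "\<bar>F (restr Y g)\<bar> \<le> \<bar>C\<bar> * B" using C[OF restr_in_dual[OF Y g]] by linarith
  qed auto
qed

lemma bidual_outside: "F \<in> bidual Y \<Longrightarrow> f \<notin> dual Y \<Longrightarrow> F f = 0"
  using bidualD(4) by blast

lemma bidualI:
  assumes "\<And>f h. f \<in> dual Y \<Longrightarrow> h \<in> dual Y \<Longrightarrow> F (\<lambda>x. f x + h x) = F f + F h"
    "\<And>c f. f \<in> dual Y \<Longrightarrow> F (\<lambda>x. c * f x) = c * F f"
    "\<And>f. f \<in> dual Y \<Longrightarrow> \<bar>F f\<bar> \<le> C * functional_norm Y norm f" "\<And>f. f \<notin> dual Y \<Longrightarrow> F f = 0"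
  shows "F \<in> bidual Y"
  unfolding bidual_def dual_space_def[of "dual Y"] mem_Collect_eq
  by (intro conjI ballI allI impI exI[of _ C] assms)

lemma dual_add: "f \<in> dual Y \<Longrightarrow> h \<in> dual Y \<Longrightarrow> (\<lambda>x. f x + h x) \<in> dual Y"
proof -
  assume f: "f \<in> dual Y" and h: "h \<in> dual Y"
  obtain B B' where "\<forall>x\<in>Y. \<bar>f x\<bar> \<le> B * norm x" "\<forall>x\<in>Y. \<bar>h x\<bar> \<le> B' * norm x"
    using f h unfolding dual_def dual_space_def by blast
  then have "\<forall>x\<in>Y. \<bar>f x + h x\<bar> \<le> (B + B') * norm x"
    by (auto simp: distrib_right intro: order_trans[OF abs_triangle_ineq] add_mono)
  then have "\<exists>K. \<forall>x\<in>Y. \<bar>f x + h x\<bar> \<le> K * norm x" by blast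
  then show ?thesis using dualD(1-3)[OF f] dualD(1-3)[OF h]
    unfolding dual_def dual_space_def by (auto simp: algebra_simps)
qed

lemma dual_scale: "f \<in> dual Y \<Longrightarrow> (\<lambda>x. c * f x) \<in> dual Y"
proof -
  assume f: "f \<in> dual Y"
  obtain B where "\<forall>x\<in>Y. \<bar>f x\<bar> \<le> B * norm x"
    using f unfolding dual_def dual_space_def by blast
  then have "\<forall>x\<in>Y. \<bar>c * f x\<bar> \<le> (\<bar>c\<bar> * B) * norm x"
    by (auto simp: abs_mult mult.assoc intro: mult_left_mono)
  then have "\<exists>K. \<forall>x\<in>Y. \<bar>c * f x\<bar> \<le> K * norm x" by blast
  then show ?thesis using dualD(1-3)[OF f] unfolding dual_def dual_space_def by (auto simp: algebra_simps)
qed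

lemma canonical_in_bidual:
  assumes "subspace Y" "y \<in> Y" shows "canonical Y y \<in> bidual Y"
proof (rule bidualI[where C = "norm y"])
  show "\<bar>canonical Y y f\<bar> \<le> norm y * functional_norm Y norm f" if "f \<in> dual Y" for f
    using le_functional_norm_dual[OF assms(1) that assms(2)] that by (simp add: canonical_def mult.commute)
qed (simp_all add: canonical_def dual_add dual_scale)

lemma biorthogonal_sums:
  fixes f :: "'a::real_normed_vector \<Rightarrow> real"
  assumes f: "bounded_linear f" "\<And>m. f (z m) = (if n = m then 1 else 0)" and sums: "(\<lambda>m. a m *\<^sub>R z m) sums w"
  shows "f w = a n"
proof -
  have "(\<lambda>m. f (a m *\<^sub>R z m)) sums f w" using f(1) sums by (rule bounded_linear.sums)
  moreover have "(\<lambda>m. f (a m *\<^sub>R z m)) = (\<lambda>m. if m = n then a m else 0)"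
    using bounded_linear.linear[OF f(1)] f(2) by (auto simp: linear_cmul)
  ultimately show ?thesis using sums_unique2[OF sums_single[of n a]] by auto
qed

lemma nonpos_if_le_multiples:
  fixes a :: real
  assumes "M \<ge> 0" "\<And>d. d > 0 \<Longrightarrow> a \<le> M * d" shows "a \<le> 0"
proof (rule field_le_epsilon)
  fix r :: real assume "r > 0"
  then have "a \<le> M * (r / (M + 1))" using assms by (intro assms(2)) simp
  also have "\<dots> \<le> r" using \<open>r > 0\<close> \<open>M \<ge> 0\<close> by (simp add: field_simps)
  finally show "a \<le> 0 + r" by simp
qed

section \<open>The bidual of the closed span of the subsequence\<close>

context shrinking_coordinates
begin

text \<open>Bounded completeness provides the vector \<open>w\<close> with coordinates
  \<open>F\<close> of the biorthogonal functionals. The difference \<Psi> of \<open>F\<close> and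
  \<open>w\<close> vanishes on these, hence on every \<open>g\<close> with absolutely summable
  values \<open>g (z n)\<close>. Rapid convergence of the coordinates makes
  \<open>\<mu> j * E i - \<mu> i * E j\<close> such a functional, so \<open>\<Psi> (E i)\<close> is
  proportional to \<open>\<mu> i\<close>.\<close>

lemma bidual_structure:
  assumes bc: "boundedly_complete z" and lower: "\<And>n. \<delta> \<le> norm (z n)" "\<delta> > 0" and upper: "\<And>n. norm (z n) \<le> C"
    and fast: "fast z p \<mu>" and F: "F \<in> bidual (closed_span (range z))"
  shows "\<exists>w\<in>closed_span (range z). \<exists>c. ((\<forall>i. \<mu> i = 0) \<longrightarrow> c = 0) \<and>
    (\<forall>g. bounded_linear g \<longrightarrow> F (restr (closed_span (range z)) g) = g w + c * lim (\<lambda>n. g (z n)))"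
proof -
  define Y where "Y = closed_span (range z)"
  have Y: "subspace Y" "closed Y" unfolding Y_def by (rule subspace_closed_span closed_closed_span)+
  have zY: "z n \<in> Y" for n unfolding Y_def using subset_closed_span[of "range z"] by auto
  interpret schauder Y z unfolding Y_def using bc by (intro schauder_basic_sequence) (simp add: boundedly_complete_def)
  obtain cf Kz where cf: "Kz > 0" "\<And>n. linear (cf n)" "\<And>n x. \<bar>cf n x\<bar> \<le> Kz * norm x"
    "\<And>n m. cf n (z m) = (if n = m then 1 else 0)" "\<And>v. v \<in> Y \<Longrightarrow> (\<lambda>n. cf n v *\<^sub>R z n) sums v"
    "\<And>v N. v \<in> Y \<Longrightarrow> norm (\<Sum>n<N. cf n v *\<^sub>R z n) \<le> Kz * norm v"
    by (rule bounded_coef[OF lower]) (rule that)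
  have cf_bl: "bounded_linear (cf n)" for n using cf(2,3) by (rule bounded_linear_if_dominated)
  obtain KF where KF: "KF \<ge> 0" "linear_on_duals (\<lambda>g. F (restr Y g))"
    "\<And>g B. bounded_linear g \<Longrightarrow> B \<ge> 0 \<Longrightarrow> (\<And>v. v \<in> Y \<Longrightarrow> \<bar>g v\<bar> \<le> B * norm v) \<Longrightarrow> \<bar>F (restr Y g)\<bar> \<le> KF * B"
    using bidual_restr[OF Y(1) F[folded Y_def]] by blast
  define \<Phi> where "\<Phi> g = F (restr Y g)" for g
  have \<Phi>: "linear_on_duals \<Phi>" unfolding \<Phi>_def by (rule KF(2))
  define a where "a n = \<Phi> (cf n)" for n
  \<comment> \<open>Testing the partial sum with \<open>g\<close> amounts to applying \<Phi> to
    \<open>g\<close> composed with a partial sum projection, whose norm on \<open>Y\<close> is at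
    most \<open>Kz\<close>.\<close>
  have "norm (\<Sum>n<N. a n *\<^sub>R z n) \<le> KF * Kz" for N
  proof (rule norm_le_dual_ball)
    fix g :: "'a \<Rightarrow> real" assume g: "g \<in> dual_ball"
    note lin = dual_ball_linear[OF g]
    have "g (\<Sum>n<N. a n *\<^sub>R z n) = (\<Sum>n<N. g (z n) * \<Phi> (cf n))"
      using lin by (simp add: linear_sum linear_cmul a_def mult.commute)
    also have "\<dots> = \<Phi> (\<lambda>x. \<Sum>n<N. g (z n) * cf n x)" by (rule linear_on_duals_sum[OF \<Phi> cf_bl, symmetric])
    also have "\<dots> \<le> KF * Kz"
    proof -
      have "\<bar>\<Sum>n<N. g (z n) * cf n v\<bar> \<le> Kz * norm v" if "v \<in> Y" for v
      proof -
        have "(\<Sum>n<N. g (z n) * cf n v) = g (\<Sum>n<N. cf n v *\<^sub>R z n)"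
          using lin by (simp add: linear_sum linear_cmul mult.commute)
        then show ?thesis using dual_ball_le[OF g, of "\<Sum>n<N. cf n v *\<^sub>R z n"] cf(6)[OF that, of N] by simp
      qed
      then have "\<bar>\<Phi> (\<lambda>x. \<Sum>n<N. g (z n) * cf n x)\<bar> \<le> KF * Kz"
        unfolding \<Phi>_def using cf(1) by (intro KF(3) bounded_linear_finite_comb cf_bl) auto
      then show ?thesis by simp
    qed
    finally show "g (\<Sum>n<N. a n *\<^sub>R z n) \<le> KF * Kz" .
  qed
  then have "bounded (range (\<lambda>N. \<Sum>n<N. a n *\<^sub>R z n))" by (auto simp: bounded_iff)
  then have "summable (\<lambda>n. a n *\<^sub>R z n)" using bc by (auto simp: boundedly_complete_def)
  then obtain w where w: "(\<lambda>n. a n *\<^sub>R z n) sums w" by (auto simp: summable_def)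
  have wY: "w \<in> Y"
  proof (rule closed_sequentially[OF Y(2)])
    show "(\<Sum>n<N. a n *\<^sub>R z n) \<in> Y" for N using zY Y(1) by (intro subspace_sum subspace_scale)
    show "(\<lambda>N. \<Sum>n<N. a n *\<^sub>R z n) \<longlonglongrightarrow> w" using w by (simp add: sums_def)
  qed
  define \<Psi> where "\<Psi> g = \<Phi> g - g w" for g
  define M where "M = KF + norm w"
  have M0: "M \<ge> 0" using KF(1) by (simp add: M_def)
  have \<Psi>: "linear_on_duals \<Psi>" using \<Phi> unfolding linear_on_duals_def \<Psi>_def by (auto simp: algebra_simps)
  have \<Psi>_le: "\<bar>\<Psi> g\<bar> \<le> M * B" if "bounded_linear g" "B \<ge> 0" "\<And>v. v \<in> Y \<Longrightarrow> \<bar>g v\<bar> \<le> B * norm v" for g B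
  proof -
    have "\<bar>\<Phi> g\<bar> \<le> KF * B" unfolding \<Phi>_def using that by (rule KF(3))
    moreover have "\<bar>g w\<bar> \<le> B * norm w" using that(3)[OF wY] .
    ultimately show ?thesis unfolding \<Psi>_def M_def by (simp add: algebra_simps)
  qed
  have \<Psi>_cf: "\<Psi> (cf n) = 0" for n
    using biorthogonal_sums[OF cf_bl cf(4) w] by (simp add: \<Psi>_def a_def)
  \<comment> \<open>Such a \<open>g\<close> is a norm limit on \<open>Y\<close> of combinations of
    the \<open>cf n\<close>: the error is at most \<open>Kz\<close> times a tail of the sum of the
    \<open>\<bar>g (z n)\<bar>\<close>.\<close>
  have \<Psi>_summable: "\<Psi> g = 0" if g: "bounded_linear g" and summ: "summable (\<lambda>n. \<bar>g (z n)\<bar>)" for g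
  proof -
    have lin: "linear g" using g by (rule bounded_linear.linear)
    have "\<bar>\<Psi> g\<bar> \<le> M * Kz * d" if "d > 0" for d
    proof -
      have "\<exists>N. \<forall>n\<ge>N. norm (\<Sum>i. \<bar>g (z (i + n))\<bar>) < d" using that summ by (intro suminf_exist_split)
      then obtain N where "norm (\<Sum>i. \<bar>g (z (i + N))\<bar>) < d" by blast
      then have N: "(\<Sum>i. \<bar>g (z (i + N))\<bar>) < d" by simp
      have N0: "0 \<le> (\<Sum>i. \<bar>g (z (i + N))\<bar>)"
        by (intro suminf_nonneg summable_ignore_initial_segment summ) auto
      define h where "h x = g x - (\<Sum>n<N. g (z n) * cf n x)" for x
      have h: "bounded_linear h" unfolding h_def by (intro bounded_linear_sub g bounded_linear_finite_comb cf_bl)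
      have "\<bar>h v\<bar> \<le> (\<Sum>i. \<bar>g (z (i + N))\<bar>) * Kz * norm v" if v: "v \<in> Y" for v
      proof -
        have "(\<lambda>n. g (cf n v *\<^sub>R z n)) sums g v" using g cf(5)[OF v] by (rule bounded_linear.sums)
        then have gs: "(\<lambda>n. g (z n) * cf n v) sums g v" using lin by (simp add: linear_cmul mult.commute)
        then have "h v = (\<Sum>i. g (z (i + N)) * cf (i + N) v)"
          unfolding h_def using suminf_minus_initial_segment[OF sums_summable[OF gs], of N] sums_unique[OF gs] by simp
        also have "\<bar>\<dots>\<bar> \<le> (\<Sum>i. \<bar>g (z (i + N))\<bar> * (Kz * norm v))"
        proof -
          have "norm (\<Sum>i. g (z (i + N)) * cf (i + N) v) \<le> (\<Sum>i. \<bar>g (z (i + N))\<bar> * (Kz * norm v))"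
            using cf(3) by (intro norm_suminf_le summable_mult2 summable_ignore_initial_segment summ)
              (auto simp: abs_mult intro!: mult_left_mono)
          then show ?thesis by simp
        qed
        also have "\<dots> = (\<Sum>i. \<bar>g (z (i + N))\<bar>) * (Kz * norm v)"
          by (intro suminf_mult2[symmetric] summable_ignore_initial_segment summ)
        finally show ?thesis by (simp add: mult.assoc)
      qed
      then have "\<bar>\<Psi> h\<bar> \<le> M * ((\<Sum>i. \<bar>g (z (i + N))\<bar>) * Kz)" using cf(1) N0 by (intro \<Psi>_le h) auto
      also have "\<dots> \<le> M * (d * Kz)" using N M0 cf(1) by (intro mult_left_mono mult_right_mono) auto
      finally have "\<bar>\<Psi> h\<bar> \<le> M * Kz * d" by (simp add: mult_ac)
      moreover have "\<Psi> h = \<Psi> g - (\<Sum>n<N. g (z n) * \<Psi> (cf n))"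
        unfolding h_def using linear_on_duals_diff[OF \<Psi> g bounded_linear_finite_comb[of cf, OF cf_bl]]
          linear_on_duals_sum[of \<Psi> cf, OF \<Psi> cf_bl] by simp
      ultimately show ?thesis by (simp add: \<Psi>_cf)
    qed
    moreover have "0 \<le> M * Kz" using M0 cf(1) by (intro mult_nonneg_nonneg) auto
    ultimately have "\<bar>\<Psi> g\<bar> \<le> 0" by (intro nonpos_if_le_multiples[of "M * Kz"])
    then show ?thesis by simp
  qed
  have \<mu>_sum: "summable (\<lambda>n. \<bar>E i (z n) - \<mu> i\<bar>)" for i
    by (rule summable_comparison_test'[of "\<lambda>n. (1/2) ^ n" i]) (use fast_le[OF fast] in \<open>auto intro: summable_geometric\<close>)
  obtain c where c: "(\<forall>i. \<mu> i = 0) \<longrightarrow> c = 0" "\<And>i. \<Psi> (E i) = c * \<mu> i"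
  proof (cases "\<forall>i. \<mu> i = 0")
    case True
    have "\<Psi> (E i) = 0" for i using \<mu>_sum[of i] True by (intro \<Psi>_summable E_bounded_linear) simp
    then show thesis using True by (intro that[of 0]) auto
  next
    case False
    then obtain j where j: "\<mu> j \<noteq> 0" by blast
    \<comment> \<open>Along \<open>z\<close> the limits of the two scaled coordinates cancel, and
      what remains is summable.\<close>
    have "\<mu> j * \<Psi> (E i) = \<mu> i * \<Psi> (E j)" for i
    proof -
      have bl: "bounded_linear (\<lambda>x. \<mu> j * E i x)" "bounded_linear (\<lambda>x. \<mu> i * E j x)"
        by (intro bounded_linear_const_mult E_bounded_linear)+
      have "\<Psi> (\<lambda>x. \<mu> j * E i x - \<mu> i * E j x) = 0"
      proof (rule \<Psi>_summable)
        show "summable (\<lambda>n. \<bar>\<mu> j * E i (z n) - \<mu> i * E j (z n)\<bar>)"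
        proof (rule summable_comparison_test'[of "\<lambda>n. \<bar>\<mu> j\<bar> * \<bar>E i (z n) - \<mu> i\<bar> + \<bar>\<mu> i\<bar> * \<bar>E j (z n) - \<mu> j\<bar>" 0])
          fix n
          have "\<mu> j * E i (z n) - \<mu> i * E j (z n) = \<mu> j * (E i (z n) - \<mu> i) - \<mu> i * (E j (z n) - \<mu> j)"
            by (simp add: algebra_simps)
          also have "\<bar>\<dots>\<bar> \<le> \<bar>\<mu> j\<bar> * \<bar>E i (z n) - \<mu> i\<bar> + \<bar>\<mu> i\<bar> * \<bar>E j (z n) - \<mu> j\<bar>"
            unfolding abs_mult[symmetric] by (rule abs_triangle_ineq4)
          finally show "norm \<bar>\<mu> j * E i (z n) - \<mu> i * E j (z n)\<bar> \<le> \<bar>\<mu> j\<bar> * \<bar>E i (z n) - \<mu> i\<bar> + \<bar>\<mu> i\<bar> * \<bar>E j (z n) - \<mu> j\<bar>"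
            by simp
        qed (intro summable_add summable_mult \<mu>_sum)
      qed (intro bounded_linear_sub bl)
      moreover have "\<Psi> (\<lambda>x. \<mu> j * E i x) = \<mu> j * \<Psi> (E i)" "\<Psi> (\<lambda>x. \<mu> i * E j x) = \<mu> i * \<Psi> (E j)"
        by (rule linear_on_duals_scale[OF \<Psi> E_bounded_linear])+
      ultimately show ?thesis using linear_on_duals_diff[OF \<Psi> bl] by simp
    qed
    then show thesis using j by (intro that[of "\<Psi> (E j) / \<mu> j"]) (auto simp: field_simps)
  qed
  have lim: "(\<lambda>n. g (z n)) \<longlonglongrightarrow> lim (\<lambda>n. g (z n))" if "bounded_linear g" for g :: "'a \<Rightarrow> real"
    using weak_Cauchy[OF that upper fast_lim[OF fast]] by (simp add: convergent_LIMSEQ_iff)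
  have C0: "C \<ge> 0" using upper[of 0] norm_ge_zero[of "z 0"] by linarith
  \<comment> \<open>Both sides are bounded in the norm of \<open>g\<close> and agree on the
    coordinate functionals, which span a dense subspace.\<close>
  have "\<Psi> g = c * lim (\<lambda>n. g (z n))" if g: "bounded_linear g" for g
  proof -
    have "\<bar>\<Psi> g - c * lim (\<lambda>n. g (z n))\<bar> \<le> (M + \<bar>c\<bar> * C) * d" if "d > 0" for d
    proof -
      obtain N where N: "\<And>x. \<bar>g x - g (\<Sum>n<N. E n x *\<^sub>R e n)\<bar> \<le> d * norm x" using shrink[OF g \<open>d > 0\<close>] by blast
      define h where "h x = g x - (\<Sum>n<N. g (e n) * E n x)" for x
      have h: "bounded_linear h"
        unfolding h_def by (intro bounded_linear_sub g bounded_linear_finite_comb E_bounded_linear)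
      have h_le: "\<bar>h x\<bar> \<le> d * norm x" for x
        using N[of x] linear_proj[OF bounded_linear.linear[OF g]] by (simp add: h_def mult.commute)
      have "\<Psi> h = \<Psi> g - (\<Sum>n<N. g (e n) * \<Psi> (E n))"
        unfolding h_def using linear_on_duals_diff[OF \<Psi> g bounded_linear_finite_comb[of E, OF E_bounded_linear]]
          linear_on_duals_sum[of \<Psi> E, OF \<Psi> E_bounded_linear] by simp
      moreover have "(\<lambda>n. h (z n)) \<longlonglongrightarrow> lim (\<lambda>n. g (z n)) - (\<Sum>n<N. g (e n) * \<mu> n)"
        unfolding h_def by (intro tendsto_intros lim[OF g] fast_lim[OF fast])
      then have l: "lim (\<lambda>n. h (z n)) = lim (\<lambda>n. g (z n)) - (\<Sum>n<N. g (e n) * \<mu> n)"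
        by (rule limI)
      ultimately have eq: "\<Psi> g - c * lim (\<lambda>n. g (z n)) = \<Psi> h - c * lim (\<lambda>n. h (z n))"
        by (simp add: c(2) right_diff_distrib sum_distrib_left mult_ac)
      have "\<bar>\<Psi> h\<bar> \<le> M * d" using h_le \<open>d > 0\<close> by (intro \<Psi>_le h) auto
      moreover have "\<bar>lim (\<lambda>n. h (z n))\<bar> \<le> d * C"
      proof (rule LIMSEQ_le_const2[OF tendsto_rabs[OF lim[OF h]]])
        have "\<bar>h (z n)\<bar> \<le> d * C" for n
          using h_le[of "z n"] mult_left_mono[OF upper[of n], of d] \<open>d > 0\<close> by linarith
        then show "\<exists>N. \<forall>n\<ge>N. \<bar>h (z n)\<bar> \<le> d * C" by blast
      qed
      then have "\<bar>c * lim (\<lambda>n. h (z n))\<bar> \<le> \<bar>c\<bar> * (d * C)" unfolding abs_mult by (intro mult_left_mono) auto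
      ultimately have "\<bar>\<Psi> h - c * lim (\<lambda>n. h (z n))\<bar> \<le> M * d + \<bar>c\<bar> * (d * C)" by linarith
      then show ?thesis unfolding eq by (simp add: algebra_simps)
    qed
    moreover have "0 \<le> M + \<bar>c\<bar> * C" using M0 C0 by (intro add_nonneg_nonneg mult_nonneg_nonneg) auto
    ultimately have "\<bar>\<Psi> g - c * lim (\<lambda>n. g (z n))\<bar> \<le> 0" by (intro nonpos_if_le_multiples[of "M + \<bar>c\<bar> * C"])
    then show ?thesis by simp
  qed
  then have "F (restr Y g) = g w + c * lim (\<lambda>n. g (z n))" if "bounded_linear g" for g
    using that unfolding \<Psi>_def \<Phi>_def by (simp add: algebra_simps)
  then show ?thesis unfolding Y_def[symmetric] using wY c(1) by blast
qed

lemma reflexive_if_fast: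
  assumes bc: "boundedly_complete z" and lower: "\<And>n. \<delta> \<le> norm (z n)" "\<delta> > 0" and upper: "\<And>n. norm (z n) \<le> C"
    and fast: "fast z p \<mu>" and \<mu>: "\<And>i. \<mu> i = 0"
  shows "reflexive_subspace (closed_span (range z))"
proof -
  define Y where "Y = closed_span (range z)"
  have Y: "subspace Y" unfolding Y_def by (rule subspace_closed_span)
  have "F \<in> canonical Y ` Y" if F: "F \<in> bidual Y" for F
  proof -
    obtain w where w: "w \<in> Y" "\<And>g. bounded_linear g \<Longrightarrow> F (restr Y g) = g w"
      using bidual_structure[OF bc lower upper fast F[unfolded Y_def]] \<mu> unfolding Y_def by auto
    have "F f = canonical Y w f" for f
    proof (cases "f \<in> dual Y")
      case True
      then obtain g where "bounded_linear g" "f = restr Y g" using dual_restr[OF Y] by blast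
      then show ?thesis using w True by (simp add: canonical_def restr_def)
    qed (simp add: canonical_def bidual_outside[OF F])
    then show ?thesis using w(1) by blast
  qed
  then show ?thesis unfolding reflexive_subspace_def Y_def[symmetric] using canonical_in_bidual[OF Y] by blast
qed

text \<open>The additional direction is the weak* limit \<Lambda> of \<open>z\<close>. If it came
  from a vector \<open>w\<close>, then \<mu> would be the coordinates of \<open>w\<close> and its
  series would converge.\<close>

lemma order_one_quasireflexive_if_fast:
  assumes bc: "boundedly_complete z" and lower: "\<And>n. \<delta> \<le> norm (z n)" "\<delta> > 0" and upper: "\<And>n. norm (z n) \<le> C"
    and fast: "fast z p \<mu>" and \<mu>: "\<not> summable (\<lambda>i. \<mu> i *\<^sub>R e i)"
  shows "order_one_quasireflexive (closed_span (range z))"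
proof -
  define Y where "Y = closed_span (range z)"
  have Y: "subspace Y" unfolding Y_def by (rule subspace_closed_span)
  have zY: "z n \<in> Y" for n unfolding Y_def using subset_closed_span[of "range z"] by auto
  define \<Lambda> where "\<Lambda> f = (if f \<in> dual Y then lim (\<lambda>n. f (z n)) else 0)" for f
  have lim: "(\<lambda>n. g (z n)) \<longlonglongrightarrow> lim (\<lambda>n. g (z n))" if "bounded_linear g" for g :: "'a \<Rightarrow> real"
    using weak_Cauchy[OF that upper fast_lim[OF fast]] by (simp add: convergent_LIMSEQ_iff)
  have limd: "(\<lambda>n. f (z n)) \<longlonglongrightarrow> \<Lambda> f" if "f \<in> dual Y" for f
  proof -
    obtain g where "bounded_linear g" "f = restr Y g" using dual_restr[OF Y \<open>f \<in> dual Y\<close>] by blast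
    then show ?thesis using lim[of g] \<open>f \<in> dual Y\<close> by (simp add: \<Lambda>_def restr_def zY)
  qed
  have "\<Lambda> \<in> bidual Y"
  proof (rule bidualI[where C = C])
    fix f h assume fh: "f \<in> dual Y" "h \<in> dual Y"
    show "\<Lambda> (\<lambda>x. f x + h x) = \<Lambda> f + \<Lambda> h"
      using LIMSEQ_unique[OF limd[OF dual_add[OF fh]] tendsto_add[OF limd[OF fh(1)] limd[OF fh(2)]]] .
  next
    fix c f assume f: "f \<in> dual Y"
    show "\<Lambda> (\<lambda>x. c * f x) = c * \<Lambda> f"
      using LIMSEQ_unique[OF limd[OF dual_scale[OF f]] tendsto_mult_left[OF limd[OF f]]] .
  next
    fix f assume f: "f \<in> dual Y"
    have nn: "0 \<le> functional_norm Y norm f"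
    proof -
      have "0 < norm (z 0)" using lower(1)[of 0] lower(2) by linarith
      moreover have "0 \<le> functional_norm Y norm f * norm (z 0)"
        using le_functional_norm_dual[OF Y f zY[of 0]] by linarith
      ultimately show ?thesis by (simp add: zero_le_mult_iff)
    qed
    have "\<bar>f (z n)\<bar> \<le> C * functional_norm Y norm f" for n
      using le_functional_norm_dual[OF Y f zY[of n]] mult_left_mono[OF upper[of n] nn] by (simp add: mult.commute)
    then show "\<bar>\<Lambda> f\<bar> \<le> C * functional_norm Y norm f"
      by (intro LIMSEQ_le_const2[OF tendsto_rabs[OF limd[OF f]]]) blast
  qed (simp add: \<Lambda>_def)
  moreover have "\<Lambda> \<noteq> canonical Y w" if "w \<in> Y" for w
  proof
    assume eq: "\<Lambda> = canonical Y w"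
    have "E i w = \<mu> i" for i
    proof -
      have d: "restr Y (E i) \<in> dual Y" using Y E_bounded_linear by (rule restr_in_dual)
      have "(\<lambda>n. E i (z n)) \<longlonglongrightarrow> \<Lambda> (restr Y (E i))" using limd[OF d] by (simp add: restr_def zY)
      moreover have "\<Lambda> (restr Y (E i)) = E i w" unfolding eq using d that by (simp add: canonical_def restr_def)
      ultimately show ?thesis using fast_lim[OF fast, of i] LIMSEQ_unique by metis
    qed
    then show False using \<mu> sums_summable[OF E_sums[of w]] by simp
  qed
  moreover have "\<exists>c. \<exists>y\<in>Y. G = (\<lambda>f. c * \<Lambda> f + canonical Y y f)" if G: "G \<in> bidual Y" for G
  proof -
    have "\<exists>w\<in>Y. \<exists>c. \<forall>g. bounded_linear g \<longrightarrow> G (restr Y g) = g w + c * lim (\<lambda>n. g (z n))"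
      using bidual_structure[OF bc lower upper fast G[unfolded Y_def]] unfolding Y_def by fast
    then obtain w c where w: "w \<in> Y" "\<forall>g. bounded_linear g \<longrightarrow> G (restr Y g) = g w + c * lim (\<lambda>n. g (z n))"
      by (elim bexE exE) (rule that)
    have "G f = c * \<Lambda> f + canonical Y w f" for f
    proof (cases "f \<in> dual Y")
      case True
      then obtain g where "bounded_linear g" "f = restr Y g" using dual_restr[OF Y] by blast
      then show ?thesis using w True by (simp add: canonical_def restr_def \<Lambda>_def zY)
    qed (simp add: canonical_def \<Lambda>_def bidual_outside[OF G])
    then show ?thesis using w(1) by blast
  qed
  ultimately show ?thesis unfolding order_one_quasireflexive_def Y_def[symmetric] by blast
qed

end

section \<open>Subsequences of basic sequences\<close>

lemma semi_normalizedD: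
  assumes "semi_normalized e"
  obtains \<delta> C where "\<delta> > 0" "\<And>n. \<delta> \<le> norm (e n)" "\<And>n. norm (e n) \<le> C"
proof -
  obtain C where "\<And>n. norm (e n) \<le> C" using assms by (auto simp: semi_normalized_def bdd_above_def)
  moreover have "(INF n. norm (e n)) \<le> norm (e n)" for n
    by (intro cINF_lower) (auto intro: bdd_belowI[of _ 0])
  moreover have "(INF n. norm (e n)) > 0" using assms by (simp add: semi_normalized_def)
  ultimately show thesis using order_refl that[of "INF n. norm (e n)" C] by blast
qed

lemma bounded_coefficients:
  fixes z :: "nat \<Rightarrow> 'a::real_normed_vector"
  assumes "\<And>N. norm (\<Sum>n<N. a n *\<^sub>R z n) \<le> D" "\<And>n. \<delta> \<le> norm (z n)" "\<delta> > 0"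
  shows "\<bar>a n\<bar> \<le> 2 * D / \<delta>"
proof -
  have "a n *\<^sub>R z n = (\<Sum>i<Suc n. a i *\<^sub>R z i) - (\<Sum>i<n. a i *\<^sub>R z i)" by simp
  then have "norm (a n *\<^sub>R z n) \<le> norm (\<Sum>i<Suc n. a i *\<^sub>R z i) + norm (\<Sum>i<n. a i *\<^sub>R z i)"
    by (metis norm_triangle_ineq4)
  also have "\<dots> \<le> D + D" by (intro add_mono assms(1))
  finally have "\<bar>a n\<bar> * norm (z n) \<le> 2 * D" by simp
  moreover have "\<bar>a n\<bar> * \<delta> \<le> \<bar>a n\<bar> * norm (z n)" using assms(2) by (rule mult_left_mono) simp
  ultimately show ?thesis using assms(3) by (simp add: field_simps)
qed

lemma shrinking_coordinates_exist:
  fixes e :: "nat \<Rightarrow> 'a::banach"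
  assumes basis: "schauder_basis_of (UNIV :: 'a set) e" and sn: "semi_normalized e" and sh: "shrinking e"
  obtains E K where "shrinking_coordinates e E K"
proof -
  obtain \<delta> C where \<delta>: "\<delta> > 0" "\<And>n. \<delta> \<le> norm (e n)" "\<And>n. norm (e n) \<le> C"
    using semi_normalizedD[OF sn] by blast
  interpret schauder UNIV e using basis by (simp add: schauder_def)
  obtain E K where E: "K > 0" "\<And>n. linear (E n)" "\<And>n x. \<bar>E n x\<bar> \<le> K * norm x"
    "\<And>n m. E n (e m) = (if n = m then 1 else 0)"
    "\<And>x. x \<in> UNIV \<Longrightarrow> (\<lambda>n. E n x *\<^sub>R e n) sums x"
    "\<And>x N. x \<in> UNIV \<Longrightarrow> norm (\<Sum>n<N. E n x *\<^sub>R e n) \<le> K * norm x"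
    by (rule bounded_coef[OF \<delta>(2,1)]) (rule that)
  have null: "(\<lambda>n. E n x) \<longlonglongrightarrow> 0" for x
  proof -
    have "(\<lambda>n. E n x *\<^sub>R e n) \<longlonglongrightarrow> 0" using E(5) sums_summable summable_LIMSEQ_zero by blast
    then have lim: "(\<lambda>n. norm (E n x *\<^sub>R e n) / \<delta>) \<longlonglongrightarrow> 0"
      using tendsto_divide[OF tendsto_norm_zero tendsto_const, of _ sequentially \<delta>] \<delta>(1) by force
    have le: "norm (E n x) \<le> norm (E n x *\<^sub>R e n) / \<delta>" for n
      using mult_left_mono[OF \<delta>(2)[of n], of "\<bar>E n x\<bar>"] \<delta>(1) by (simp add: field_simps)
    show ?thesis by (rule Lim_null_comparison[OF always_eventually[OF allI[OF le]] lim])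
  qed
  have shrink: "\<exists>N. \<forall>x. \<bar>f x - f (\<Sum>n<N. E n x *\<^sub>R e n)\<bar> \<le> d * norm x"
    if f: "bounded_linear f" and d: "d > 0" for f :: "'a \<Rightarrow> real" and d
  proof -
    have lin: "linear f" using f by (rule bounded_linear.linear)
    obtain B where B: "\<And>x. \<bar>f x\<bar> \<le> norm x * B" using bounded_linear.bounded[OF f] by auto
    define T where "T n = closed_span (e ` {n..})" for n
    have "(\<lambda>n. functional_norm (T n) norm (blinfun_apply (Blinfun f))) \<longlonglongrightarrow> 0"
      using sh unfolding shrinking_def T_def by blast
    then have "(\<lambda>n. functional_norm (T n) norm f) \<longlonglongrightarrow> 0" by (simp add: bounded_linear_Blinfun_apply[OF f])
    \<comment> \<open>The remainder of \<open>x\<close> after \<open>N\<close> terms has norm at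
      most \<open>(1 + K) * norm x\<close>, hence the divisor.\<close>
    then have "eventually (\<lambda>n. functional_norm (T n) norm f < d / (1 + K)) sequentially"
      using d E(1) by (intro order_tendstoD(2)) auto
    then obtain N where N: "functional_norm (T N) norm f < d / (1 + K)" by (auto simp: eventually_sequentially)
    have "\<bar>f x - f (\<Sum>n<N. E n x *\<^sub>R e n)\<bar> \<le> d * norm x" for x
    proof -
      define u where "u = x - (\<Sum>n<N. E n x *\<^sub>R e n)"
      have "u \<in> T N"
      proof (rule closed_sequentially[of "T N" "\<lambda>m. \<Sum>n=N..<m+N. E n x *\<^sub>R e n"])
        show "closed (T N)" unfolding T_def by (rule closed_closed_span)
        show "(\<Sum>n=N..<m+N. E n x *\<^sub>R e n) \<in> T N" for m unfolding T_def
          using subset_closed_span[of "e ` {N..}"]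
          by (intro subspace_sum subspace_scale subspace_closed_span) auto
        have "(\<lambda>m. (\<Sum>n<m+N. E n x *\<^sub>R e n) - (\<Sum>n<N. E n x *\<^sub>R e n)) \<longlonglongrightarrow> u"
          unfolding u_def using E(5)[of x] by (intro tendsto_diff tendsto_const LIMSEQ_ignore_initial_segment) (simp add: sums_def)
        then show "(\<lambda>m. \<Sum>n=N..<m+N. E n x *\<^sub>R e n) \<longlonglongrightarrow> u"
          by (simp add: sum_diff_nat_ivl lessThan_atLeast0)
      qed
      then have "\<bar>f u\<bar> \<le> functional_norm (T N) norm f * norm u"
        using B lin by (intro le_functional_norm[of "T N" f B]) (auto simp: T_def subspace_closed_span linear_cmul mult.commute)
      also have "\<dots> \<le> d / (1 + K) * norm u" using N by (intro mult_right_mono) auto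
      also have "\<dots> \<le> d / (1 + K) * ((1 + K) * norm x)"
      proof (rule mult_left_mono)
        have "norm u \<le> norm x + norm (\<Sum>n<N. E n x *\<^sub>R e n)" unfolding u_def by (rule norm_triangle_ineq4)
        then show "norm u \<le> (1 + K) * norm x" using E(6)[of x N] by (simp add: distrib_right)
      qed (use d E(1) in simp)
      also have "\<dots> = d * norm x" using E(1) by simp
      finally show ?thesis using lin by (simp add: u_def linear_diff)
    qed
    then show ?thesis by blast
  qed
  have "shrinking_coordinates e E K"
    by (rule shrinking_coordinates.intro)
      (rule E(1) E(2) E(3) E(4) E(5)[OF UNIV_I] E(6)[OF UNIV_I] null shrink | assumption)+
  then show thesis by (rule that)
qed

section \<open>Choice of the subsequence\<close>

context shrinking_coordinates
begin

text \<open>The coordinate sequences lie in a compact box of a countable product of lines; its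
  sequential compactness replaces the diagonal argument.\<close>

lemma coordinatewise_convergent_subsequence:
  fixes x :: "nat \<Rightarrow> 'a"
  assumes "\<And>n. norm (x n) \<le> C"
  obtains q l where "strict_mono q" "\<And>i. (\<lambda>n. E i (x (q n))) \<longlonglongrightarrow> l i"
proof -
  define g where "g n = (\<lambda>i. E i (x n))" for n
  have "- (K * C) \<le> E i (x n) \<and> E i (x n) \<le> K * C" for i n
    using E_le[of i "x n"] mult_left_mono[OF assms[of n], of K] K_pos by linarith
  then have gin: "g n \<in> PiE UNIV (\<lambda>i. {- (K * C)..K * C})" for n
    by (simp add: g_def PiE_UNIV_domain)
  have "seq_compact (PiE UNIV (\<lambda>i::nat. {- (K * C)..K * C}))"
    by (rule compact_imp_seq_compact[OF compact_box])
  from this[unfolded seq_compact_def, THEN spec, of g] gin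
  have "\<exists>l\<in>PiE UNIV (\<lambda>i. {- (K * C)..K * C}). \<exists>q. strict_mono q \<and> (g \<circ> q) \<longlonglongrightarrow> l" by simp
  then obtain l q where q: "strict_mono q" "(g \<circ> q) \<longlonglongrightarrow> l" by auto
  have "(\<lambda>n. (g \<circ> q) n i) \<longlonglongrightarrow> l i" for i
    using continuous_on_tendsto_compose[OF continuous_on_eval[of UNIV i] q(2)] by auto
  then show thesis using q(1) by (intro that) (auto simp: g_def)
qed

lemma subsequence_exists:
  assumes super: "\<And>a :: nat \<Rightarrow> real. bounded (range (\<lambda>n. \<Sum>i<n. a i *\<^sub>R e i)) \<Longrightarrow> a \<longlonglongrightarrow> 0 \<Longrightarrow> summable (\<lambda>n. a n *\<^sub>R e n)"
    and y: "basic_sequence y" and lower: "\<And>n. \<delta> \<le> norm (y n)" "\<delta> > 0" and upper: "\<And>n. norm (y n) \<le> C"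
    and fast: "fast y p \<mu>" and c0: "\<not> contains_c0 TYPE('a)"
  shows "\<exists>m. strict_mono m \<and> boundedly_complete (y \<circ> m) \<and>
    (reflexive_subspace (closed_span (range (y \<circ> m))) \<or> order_one_quasireflexive (closed_span (range (y \<circ> m))))"
proof -
  have coef_bdd: "bounded (range a)" if bd: "bounded (range (\<lambda>N. \<Sum>n<N. a n *\<^sub>R y (m n)))" for a and m :: "nat \<Rightarrow> nat"
  proof -
    obtain D where D: "\<And>N. norm (\<Sum>n<N. a n *\<^sub>R y (m n)) \<le> D" using bd by (auto simp: bounded_iff)
    have "\<bar>a n\<bar> \<le> 2 * D / \<delta>" for n by (rule bounded_coefficients[OF D lower])
    then show ?thesis by (auto simp: bounded_iff)
  qed
  have basic: "basic_sequence (y \<circ> m)" if "strict_mono m" for m :: "nat \<Rightarrow> nat"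
    using y lower that by (rule basic_sequence_subsequence)
  have lower': "\<delta> \<le> norm ((y \<circ> m) n)" and upper': "norm ((y \<circ> m) n) \<le> C" for m :: "nat \<Rightarrow> nat" and n
    using lower(1) upper by auto
  show ?thesis
  proof (cases "summable (\<lambda>i. \<mu> i *\<^sub>R e i)")
    case True
    then obtain w where w: "(\<lambda>i. \<mu> i *\<^sub>R e i) sums w" by (auto simp: summable_def)
    have Ew: "E i w = \<mu> i" for i using w by (rule E_unique)
    have weak: "(\<lambda>n. f (y n)) \<longlonglongrightarrow> f w" if "bounded_linear f" for f :: "'a \<Rightarrow> real"
      using fast_lim[OF fast] by (intro weak_limit[OF that upper]) (simp add: Ew)
    interpret schauder "closed_span (range y)" y using y by (rule schauder_basic_sequence)
    obtain cf Kz where cf: "\<And>n. linear (cf n)" "\<And>n x. \<bar>cf n x\<bar> \<le> Kz * norm x"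
      "\<And>n m. cf n (y m) = (if n = m then 1 else 0)" "\<And>v. v \<in> closed_span (range y) \<Longrightarrow> (\<lambda>n. cf n v *\<^sub>R y n) sums v"
      by (rule bounded_coef[OF lower]) (rule that)
    have "y n \<in> closed_span (range y)" for n using subset_closed_span[of "range y"] by auto
    then have wY: "w \<in> closed_span (range y)" using weak by (rule weak_limit_in_closed_span)
    \<comment> \<open>The k-th coordinate of \<open>y n\<close> with respect to \<open>y\<close>
      vanishes for \<open>n > k\<close>. So the weak limit \<open>w\<close> has no coordinates and
      is 0: convergence of the series of \<mu> already forces \<mu> to vanish.\<close>
    have "cf k w = 0" for k
    proof -
      have "(\<lambda>n. cf k (y n)) \<longlonglongrightarrow> 0"
        by (rule tendsto_eventually) (auto simp: eventually_sequentially cf(3) intro!: exI[of _ "Suc k"])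
      then show ?thesis using weak[OF bounded_linear_if_dominated[OF cf(1,2)]] LIMSEQ_unique by blast
    qed
    then have "w = 0" using cf(4)[OF wY] sums_unique2[OF sums_zero] by simp
    then have \<mu>0: "\<mu> i = 0" for i using Ew[of i] E_linear[of i] by (simp add: linear_0)
    have null: "(\<lambda>n. f (y n)) \<longlonglongrightarrow> 0" if "f \<in> dual_ball" for f
      using weak[OF dual_ball_bounded_linear[OF that]] \<open>w = 0\<close> dual_ball_linear[OF that] by (simp add: linear_0)
    have "\<exists>m :: nat \<Rightarrow> nat. strict_mono m \<and> (\<forall>a. bounded (range (\<lambda>N. \<Sum>n<N. a n *\<^sub>R y (m n))) \<longrightarrow>
        bounded (range a) \<longrightarrow> a \<longlonglongrightarrow> 0)"
      using null lower c0 by (rule weakly_null_subsequence)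
    then obtain m :: "nat \<Rightarrow> nat" where m: "strict_mono m"
      "\<And>a. bounded (range (\<lambda>N. \<Sum>n<N. a n *\<^sub>R y (m n))) \<Longrightarrow> bounded (range a) \<Longrightarrow> a \<longlonglongrightarrow> 0"
      by auto
    have fast': "fast (y \<circ> m) (p \<circ> m) \<mu>" using fast m(1) by (rule fast_subsequence)
    have bc: "boundedly_complete (y \<circ> m)"
      by (rule boundedly_complete_if_fast[OF super basic[OF m(1)] lower' lower(2) upper' fast'])
        (use m(2) coef_bdd \<mu>0 in auto)
    then show ?thesis
      using reflexive_if_fast[OF bc lower' lower(2) upper' fast' \<mu>0] m(1) by blast
  next
    case False
    obtain j where j: "\<mu> j \<noteq> 0"
    proof (rule ccontr)
      assume "\<not> thesis"
      then have "(\<lambda>i. \<mu> i *\<^sub>R e i) = (\<lambda>i. 0)" using that by fastforce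
      then show False using False by simp
    qed
    define lam where "lam f = lim (\<lambda>n. f (y n))" for f :: "'a \<Rightarrow> real"
    have lam: "(\<lambda>n. f (y n)) \<longlonglongrightarrow> lam f" if "f \<in> dual_ball" for f
      unfolding lam_def using weak_Cauchy[OF dual_ball_bounded_linear[OF that] upper fast_lim[OF fast]]
      by (simp add: convergent_LIMSEQ_iff)
    have nonrep: "\<exists>f\<in>dual_ball. lam f \<noteq> f w" for w
    proof (rule ccontr)
      assume *: "\<not> ?thesis"
      have "E i w = \<mu> i" for i
      proof -
        \<comment> \<open>Division by \<open>K\<close> puts the coordinate functional into the dual
          ball. If \<open>lam\<close> were evaluation at \<open>w\<close>, then \<mu> would be the
          coordinates of \<open>w\<close>, whose expansion converges.\<close>
        define f where "f x = (1 / K) *\<^sub>R E i x" for x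
        have "linear f" unfolding f_def using E_linear by (rule linear_compose_scale_right)
        moreover have "\<bar>f x\<bar> \<le> norm x" for x using E_le[of i x] K_pos by (simp add: f_def abs_mult field_simps)
        ultimately have f: "f \<in> dual_ball" by (simp add: dual_ball_def)
        have "(\<lambda>n. f (y n)) \<longlonglongrightarrow> (1 / K) *\<^sub>R \<mu> i" unfolding f_def by (intro tendsto_intros fast_lim[OF fast])
        then have "lam f = (1 / K) *\<^sub>R \<mu> i" using lam[OF f] LIMSEQ_unique by blast
        moreover have "lam f = f w" using * f by blast
        ultimately show ?thesis using K_pos by (simp add: f_def)
      qed
      then show False using False sums_summable[OF E_sums[of w]] by simp
    qed
    have "\<exists>m :: nat \<Rightarrow> nat. strict_mono m \<and> (\<forall>t. bounded (range t) \<longrightarrow>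
        bounded (range (\<lambda>N. \<Sum>i<N. t i *\<^sub>R (y (m i) - y (m (Suc i))))) \<longrightarrow> convergent t)"
      using upper lam nonrep c0 by (rule weak_Cauchy_subsequence)
    then obtain m :: "nat \<Rightarrow> nat" where m: "strict_mono m"
      "\<And>t. bounded (range t) \<Longrightarrow> bounded (range (\<lambda>N. \<Sum>i<N. t i *\<^sub>R (y (m i) - y (m (Suc i))))) \<Longrightarrow> convergent t"
      by auto
    define z where "z = y \<circ> m"
    have fast': "fast z (p \<circ> m) \<mu>" unfolding z_def using fast m(1) by (rule fast_subsequence)
    have z: "basic_sequence z" "\<And>n. \<delta> \<le> norm (z n)" "\<And>n. norm (z n) \<le> C"
      unfolding z_def using basic[OF m(1)] lower' upper' by auto
    have "a \<longlonglongrightarrow> 0 \<and> convergent (\<lambda>N. \<Sum>n<N. a n)" if bd: "bounded (range (\<lambda>N. \<Sum>n<N. a n *\<^sub>R z n))" for a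
    proof -
      obtain D where D: "\<And>N. norm (\<Sum>n<N. a n *\<^sub>R z n) \<le> D" using bd by (auto simp: bounded_iff)
      define A where "A = 2 * D / \<delta>"
      have A: "\<bar>a n\<bar> \<le> A" for n unfolding A_def by (rule bounded_coefficients[OF D z(2) lower(2)])
      then have "A \<ge> 0" using abs_ge_zero[of "a 0"] order_trans by blast
      define s where "s N = (\<Sum>n<N. a n)" for N
      have "summable (\<lambda>n. \<bar>E j (z n) - \<mu> j\<bar>)"
        by (rule summable_comparison_test'[of "\<lambda>n. (1/2) ^ n" j])
          (use fast_le[OF fast'] in \<open>auto intro: summable_geometric\<close>)
      then have summ: "summable (\<lambda>n. A * \<bar>E j (z n) - \<mu> j\<bar>)" by (rule summable_mult)
      define T where "T = (\<Sum>n. A * \<bar>E j (z n) - \<mu> j\<bar>)"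
      \<comment> \<open>A coordinate with \<open>\<mu> j \<noteq> 0\<close> recovers the sums of
        coefficients, because it sends each \<open>z n\<close> to \<open>\<mu> j\<close> up to a
        summable error.\<close>
      have s_le: "\<bar>s N\<bar> \<le> (K * D + T) / \<bar>\<mu> j\<bar>" for N
      proof -
        have "E j (\<Sum>n<N. a n *\<^sub>R z n) = (\<Sum>n<N. a n * E j (z n))" using E_linear by (simp add: linear_sum linear_cmul)
        also have "\<dots> = (\<Sum>n<N. a n * (E j (z n) - \<mu> j) + \<mu> j * a n)"
          by (intro sum.cong) (simp_all add: algebra_simps)
        also have "\<dots> = (\<Sum>n<N. a n * (E j (z n) - \<mu> j)) + \<mu> j * s N"
          by (simp add: s_def sum_distrib_left sum.distrib)
        finally have eq: "\<mu> j * s N = E j (\<Sum>n<N. a n *\<^sub>R z n) - (\<Sum>n<N. a n * (E j (z n) - \<mu> j))" by simp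
        have "\<bar>\<Sum>n<N. a n * (E j (z n) - \<mu> j)\<bar> \<le> (\<Sum>n<N. A * \<bar>E j (z n) - \<mu> j\<bar>)"
          using A by (intro order_trans[OF sum_abs] sum_mono) (auto simp: abs_mult intro!: mult_right_mono)
        also have "\<dots> \<le> T" unfolding T_def using \<open>A \<ge> 0\<close> by (intro sum_le_suminf summ) auto
        finally have "\<bar>\<Sum>n<N. a n * (E j (z n) - \<mu> j)\<bar> \<le> T" .
        moreover have "\<bar>E j (\<Sum>n<N. a n *\<^sub>R z n)\<bar> \<le> K * D"
          using E_le[of j "\<Sum>n<N. a n *\<^sub>R z n"] mult_left_mono[OF D[of N], of K] K_pos by linarith
        ultimately have "\<bar>\<mu> j * s N\<bar> \<le> K * D + T" unfolding eq by linarith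
        then show ?thesis using j by (simp add: abs_mult field_simps)
      qed
      define B where "B = (K * D + T) / \<bar>\<mu> j\<bar>"
      have s_le: "\<bar>s N\<bar> \<le> B" for N unfolding B_def by (rule s_le)
      \<comment> \<open>Summation by parts; the shift to \<open>s (Suc i)\<close> is what matches
        \<open>z i - z (Suc i)\<close>, and the boundary term is bounded because \<open>s\<close>
        is.\<close>
      have eq: "(\<Sum>i<N. s (Suc i) *\<^sub>R (z i - z (Suc i))) = (\<Sum>i<N. a i *\<^sub>R z i) - s N *\<^sub>R z N" for N
        by (induction N) (auto simp: s_def algebra_simps)
      have "norm (\<Sum>i<N. s (Suc i) *\<^sub>R (z i - z (Suc i))) \<le> D + B * C" for N
      proof -
        have "norm (s N *\<^sub>R z N) \<le> B * C"
          unfolding norm_scaleR using s_le[of N] z(3)[of N] by (intro mult_mono) auto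
        then show ?thesis unfolding eq using D[of N] by (intro order_trans[OF norm_triangle_ineq4] add_mono)
      qed
      then have "bounded (range (\<lambda>N. \<Sum>i<N. s (Suc i) *\<^sub>R (y (m i) - y (m (Suc i)))))"
        by (auto simp: bounded_iff z_def)
      moreover have "bounded (range (\<lambda>i. s (Suc i)))" using s_le by (auto simp: bounded_iff)
      ultimately have "convergent (\<lambda>i. s (Suc i))" by (intro m(2))
      then obtain \<sigma> where \<sigma>: "(\<lambda>i. s (Suc i)) \<longlonglongrightarrow> \<sigma>" by (auto simp: convergent_def)
      then have \<sigma>': "s \<longlonglongrightarrow> \<sigma>" by (rule LIMSEQ_imp_Suc)
      have "(\<lambda>i. s (Suc i) - s i) \<longlonglongrightarrow> \<sigma> - \<sigma>" using \<sigma> \<sigma>' by (rule tendsto_diff)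
      then have "a \<longlonglongrightarrow> 0" by (simp add: s_def)
      then show ?thesis using \<sigma>' unfolding s_def convergent_def by blast
    qed
    then have bc: "boundedly_complete z"
      by (intro boundedly_complete_if_fast[OF super z(1,2) lower(2) z(3) fast']) auto
    then show ?thesis
      using order_one_quasireflexive_if_fast[OF bc z(2) lower(2) z(3) fast' False] m(1) unfolding z_def by blast
  qed
qed

end

theorem corollary2p4:
  fixes e x :: "nat \<Rightarrow> 'a::banach"
  assumes "schauder_basis_of (UNIV :: 'a set) e"
    and "semi_normalized e"
    and "supershrinking e"
    and "\<not> contains_c0 TYPE('a)"
    and "basic_sequence x"
    and "semi_normalized x"
  shows "\<exists>r :: nat \<Rightarrow> nat. strict_mono r \<and> boundedly_complete (x \<circ> r) \<and>
    (reflexive_subspace (closed_span (range (x \<circ> r))) \<or>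
     order_one_quasireflexive (closed_span (range (x \<circ> r))))"
proof -
  have sh: "shrinking e" and super: "\<And>a :: nat \<Rightarrow> real. bounded (range (\<lambda>n. \<Sum>i<n. a i *\<^sub>R e i)) \<Longrightarrow>
      a \<longlonglongrightarrow> 0 \<Longrightarrow> summable (\<lambda>n. a n *\<^sub>R e n)"
    using assms(3) by (auto simp: supershrinking_def)
  obtain E K where "shrinking_coordinates e E K"
    using shrinking_coordinates_exist[OF assms(1,2) sh] by blast
  then interpret shrinking_coordinates e E K .
  obtain \<delta> C where x: "\<delta> > 0" "\<And>n. \<delta> \<le> norm (x n)" "\<And>n. norm (x n) \<le> C"
    using semi_normalizedD[OF assms(6)] by blast
  obtain q l where q: "strict_mono q" "\<And>i. (\<lambda>n. E i (x (q n))) \<longlonglongrightarrow> l i"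
    by (rule coordinatewise_convergent_subsequence[OF x(3)]) (rule that)
  obtain s p where s: "strict_mono s" "fast ((\<lambda>n. x (q n)) \<circ> s) p l"
    by (rule fast_exists[OF q(2)]) (rule that)
  define y where "y = x \<circ> (q \<circ> s)"
  have qs: "strict_mono (q \<circ> s)" using q(1) s(1) by (rule strict_mono_o)
  have "basic_sequence y" unfolding y_def using assms(5) x(2,1) qs by (rule basic_sequence_subsequence)
  moreover have "fast y p l" using s(2) by (simp add: y_def comp_def)
  moreover have "\<delta> \<le> norm (y n)" "norm (y n) \<le> C" for n using x by (simp_all add: y_def)
  ultimately obtain m where m: "strict_mono m" "boundedly_complete (y \<circ> m)"
    "reflexive_subspace (closed_span (range (y \<circ> m))) \<or> order_one_quasireflexive (closed_span (range (y \<circ> m)))"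
    using subsequence_exists[OF super _ _ x(1) _ _ assms(4)] by blast
  have "y \<circ> m = x \<circ> (q \<circ> s \<circ> m)" by (simp add: y_def comp_assoc)
  moreover have "strict_mono (q \<circ> s \<circ> m)" using qs m(1) by (rule strict_mono_o)
  ultimately show ?thesis using m(2,3) by (intro exI[of _ "q \<circ> s \<circ> m"]) simp
qed

end
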